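(* Let $\mathcal{T}$ be a $k$-linear, Hom-finite, Krull-Schmidt triangulated category equipped with a linear generator $G$. Then the category $\langle G\rangle_2$ is triangulated, and hence equivalent to $\mathcal{T}$. In other words, the generation time of $G$ is $1$.
   Context: $k$ is an algebraically closed field. For a triangulated category $\mathcal{T}$ with suspension $[1]$, write $\mathcal{T}(X,Y)$ for the space of morphisms $X\to Y$. For $X\in\mathcal{T}$: $\langle X\rangle$ is the smallest thick subcategory containing $X$; $\langle X\rangle_1$ is the smallest additive full subcategory of $\mathcal{T}$ which contains $X$ and is closed under direct summands and the suspension functor $[1]$; inductively, for $m\ge2$, $\langle X\rangle_m$ is the full subcategory of objects $A$ fitting into a triangle $B\to A\to C\to B[1]$ with $B\in\langle X\rangle_1$ and $C\in\langle X\rangle_{m-1}$. $G$ is a classical generator if $\langle G\rangle=\mathcal{T}$. If $\langle G\rangle_m=\mathcal{T}$ for some $m\ge 1$ and $n$ is the smallest positive integer with $\langle G\rangle_n=\mathcal{T}$, the generation time of $G$ is $n-1$. A linear generator is a classical generator $G$ such that: (G1) the set of isomorphism classes of indecomposable objects in $\langle G\rangle_1$ admits a total ordering defined by: $Q\le P$ if and only if $\mathcal{T}(P,Q)\cong k$; moreover, if $Q\le P$ and $Q\not\cong P$, then $\mathcal{T}(Q,P)=0$; (G2) $P\le P[1]$ for each indecomposable $P\in\langle G\rangle_1$; (G3) for indecomposables $P,Q\in\langle G\rangle_1$, $P\le Q\le P[1]$ implies that $Q$ is isomorphic to at least one of $P$ and $P[1]$; (G4) for indecomposables $R\le Q\le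 P$ in $\langle G\rangle_1$, any morphism from $P$ to $R$ factors non-trivially through $Q$.
   Formalization: Generation time is shown to be at most 1, and equal to 1 when ⟨G⟩₁ has two non-isomorphic indecomposables (otherwise it is 0, e.g. vector spaces with [1]=id, G=k); closure under [1] means under [1] and [-1]; (G4) is required for nonzero morphisms only. *)

theory Defs
  imports "HOL-Computational_Algebra.Polynomial"
begin

section \<open>Linear categories\<close>

text \<open>
  \<open>Cmp C X Y Z g f\<close> is the composite of \<open>f : X \<rightarrow> Y\<close> followed by \<open>g : Y \<rightarrow> Z\<close>.
  All morphisms live in one type \<open>'m\<close>, which is a vector space over \<open>'k\<close>, and each \<open>Hom C X Y\<close> is a
  subspace of it. This is no loss of generality, because any family of vector spaces embeds into its
  direct sum. The Hom-spaces need not be disjoint, so composition depends on the objects involved.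
\<close>

record ('o, 'm) cat =
  Obj :: "'o set"
  Hom :: "'o \<Rightarrow> 'o \<Rightarrow> 'm set"
  Idn :: "'o \<Rightarrow> 'm"
  Cmp :: "'o \<Rightarrow> 'o \<Rightarrow> 'o \<Rightarrow> 'm \<Rightarrow> 'm \<Rightarrow> 'm"

locale linear_category = vector_space scale
  for scale :: "'k::field \<Rightarrow> 'm::ab_group_add \<Rightarrow> 'm" +
  fixes C :: "('o, 'm, 'x) cat_scheme"
  assumes Hom_subspace: "\<lbrakk>X \<in> Obj C; Y \<in> Obj C\<rbrakk> \<Longrightarrow> subspace (Hom C X Y)"
    and Idn_in_Hom: "X \<in> Obj C \<Longrightarrow> Idn C X \<in> Hom C X X"
    and Cmp_in_Hom: "\<lbrakk>X \<in> Obj C; Y \<in> Obj C; Z \<in> Obj C; f \<in> Hom C X Y; g \<in> Hom C Y Z\<rbrakk>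
      \<Longrightarrow> Cmp C X Y Z g f \<in> Hom C X Z"
    and Cmp_Idn_right: "\<lbrakk>X \<in> Obj C; Y \<in> Obj C; f \<in> Hom C X Y\<rbrakk> \<Longrightarrow> Cmp C X X Y f (Idn C X) = f"
    and Cmp_Idn_left: "\<lbrakk>X \<in> Obj C; Y \<in> Obj C; f \<in> Hom C X Y\<rbrakk> \<Longrightarrow> Cmp C X Y Y (Idn C Y) f = f"
    and Cmp_assoc: "\<lbrakk>W \<in> Obj C; X \<in> Obj C; Y \<in> Obj C; Z \<in> Obj C;
        f \<in> Hom C W X; g \<in> Hom C X Y; h \<in> Hom C Y Z\<rbrakk>
      \<Longrightarrow> Cmp C W Y Z h (Cmp C W X Y g f) = Cmp C W X Z (Cmp C X Y Z h g) f"
    and Cmp_add_right: "\<lbrakk>X \<in> Obj C; Y \<in> Obj C; Z \<in> Obj C;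
        f \<in> Hom C X Y; f' \<in> Hom C X Y; g \<in> Hom C Y Z\<rbrakk>
      \<Longrightarrow> Cmp C X Y Z g (f + f') = Cmp C X Y Z g f + Cmp C X Y Z g f'"
    and Cmp_add_left: "\<lbrakk>X \<in> Obj C; Y \<in> Obj C; Z \<in> Obj C;
        f \<in> Hom C X Y; g \<in> Hom C Y Z; g' \<in> Hom C Y Z\<rbrakk>
      \<Longrightarrow> Cmp C X Y Z (g + g') f = Cmp C X Y Z g f + Cmp C X Y Z g' f"
    and Cmp_scale_right: "\<lbrakk>X \<in> Obj C; Y \<in> Obj C; Z \<in> Obj C; f \<in> Hom C X Y; g \<in> Hom C Y Z\<rbrakk>
      \<Longrightarrow> Cmp C X Y Z g (scale a f) = scale a (Cmp C X Y Z g f)"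
    and Cmp_scale_left: "\<lbrakk>X \<in> Obj C; Y \<in> Obj C; Z \<in> Obj C; f \<in> Hom C X Y; g \<in> Hom C Y Z\<rbrakk>
      \<Longrightarrow> Cmp C X Y Z (scale a g) f = scale a (Cmp C X Y Z g f)"

definition is_iso :: "('o, 'm, 'x) cat_scheme \<Rightarrow> 'o \<Rightarrow> 'o \<Rightarrow> 'm \<Rightarrow> bool" where
  "is_iso C X Y f \<longleftrightarrow> f \<in> Hom C X Y \<and>
     (\<exists>g \<in> Hom C Y X. Cmp C X Y X g f = Idn C X \<and> Cmp C Y X Y f g = Idn C Y)"

definition isomorphic :: "('o, 'm, 'x) cat_scheme \<Rightarrow> 'o \<Rightarrow> 'o \<Rightarrow> bool" where
  "isomorphic C X Y \<longleftrightarrow> X \<in> Obj C \<and> Y \<in> Obj C \<and> (\<exists>f. is_iso C X Y f)"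

definition is_zero :: "('o, 'm::ab_group_add, 'x) cat_scheme \<Rightarrow> 'o \<Rightarrow> bool" where
  "is_zero C X \<longleftrightarrow> X \<in> Obj C \<and> (\<forall>Y \<in> Obj C. Hom C X Y = {0} \<and> Hom C Y X = {0})"

text \<open>\<open>Z\<close> is a biproduct of the finite family \<open>Xs\<close>; for the empty family, \<open>Z\<close> is a zero object.\<close>

definition is_direct_sum :: "('o, 'm::ab_group_add, 'x) cat_scheme \<Rightarrow> 'o list \<Rightarrow> 'o \<Rightarrow> bool" where
  "is_direct_sum C Xs Z \<longleftrightarrow> set Xs \<subseteq> Obj C \<and> Z \<in> Obj C \<and>
     (\<exists>\<iota> \<pi>.
       (\<forall>a<length Xs. \<iota> a \<in> Hom C (Xs ! a) Z \<and> \<pi> a \<in> Hom C Z (Xs ! a)) \<and>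
       (\<forall>a<length Xs. \<forall>b<length Xs.
          Cmp C (Xs ! a) Z (Xs ! b) (\<pi> b) (\<iota> a) = (if a = b then Idn C (Xs ! a) else 0)) \<and>
       (\<Sum>a<length Xs. Cmp C Z (Xs ! a) Z (\<iota> a) (\<pi> a)) = Idn C Z)"

definition has_direct_sums :: "('o, 'm::ab_group_add, 'x) cat_scheme \<Rightarrow> bool" where
  "has_direct_sums C \<longleftrightarrow> (\<forall>Xs. set Xs \<subseteq> Obj C \<longrightarrow> (\<exists>Z. is_direct_sum C Xs Z))"

definition is_summand :: "('o, 'm::ab_group_add, 'x) cat_scheme \<Rightarrow> 'o \<Rightarrow> 'o \<Rightarrow> bool" where
  "is_summand C Y X \<longleftrightarrow> (\<exists>Z. is_direct_sum C [Y, Z] X)"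

definition indecomposable :: "('o, 'm::ab_group_add, 'x) cat_scheme \<Rightarrow> 'o \<Rightarrow> bool" where
  "indecomposable C X \<longleftrightarrow> X \<in> Obj C \<and> \<not> is_zero C X \<and>
     (\<forall>Y Z. is_direct_sum C [Y, Z] X \<longrightarrow> is_zero C Y \<or> is_zero C Z)"

definition hom_finite ::
  "('k::field \<Rightarrow> 'm::ab_group_add \<Rightarrow> 'm) \<Rightarrow> ('o, 'm, 'x) cat_scheme \<Rightarrow> bool" where
  "hom_finite scale C \<longleftrightarrow>
     (\<forall>X \<in> Obj C. \<forall>Y \<in> Obj C. \<exists>B. finite B \<and> Hom C X Y = module.span scale B)"

text \<open>The endomorphism ring is nonzero and its non-units are closed under addition.\<close>

definition local_End :: "('o, 'm::ab_group_add, 'x) cat_scheme \<Rightarrow> 'o \<Rightarrow> bool" where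
  "local_End C X \<longleftrightarrow> Idn C X \<noteq> 0 \<and>
     (\<forall>f \<in> Hom C X X. \<forall>g \<in> Hom C X X. is_iso C X X (f + g) \<longrightarrow> is_iso C X X f \<or> is_iso C X X g)"

definition krull_schmidt :: "('o, 'm::ab_group_add, 'x) cat_scheme \<Rightarrow> bool" where
  "krull_schmidt C \<longleftrightarrow>
     (\<forall>Z \<in> Obj C. \<exists>Xs. is_direct_sum C Xs Z \<and> (\<forall>X \<in> set Xs. local_End C X))"

definition linear_functor ::
  "('k::field \<Rightarrow> 'm::ab_group_add \<Rightarrow> 'm) \<Rightarrow> ('o, 'm, 'x) cat_scheme \<Rightarrow>
   ('k \<Rightarrow> 'n::ab_group_add \<Rightarrow> 'n) \<Rightarrow> ('p, 'n, 'y) cat_scheme \<Rightarrow>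
   ('o \<Rightarrow> 'p) \<Rightarrow> ('o \<Rightarrow> 'o \<Rightarrow> 'm \<Rightarrow> 'n) \<Rightarrow> bool" where
  "linear_functor s C s' D F Fm \<longleftrightarrow>
     (\<forall>X \<in> Obj C. F X \<in> Obj D \<and> Fm X X (Idn C X) = Idn D (F X)) \<and>
     (\<forall>X \<in> Obj C. \<forall>Y \<in> Obj C. \<forall>f \<in> Hom C X Y.
        Fm X Y f \<in> Hom D (F X) (F Y) \<and>
        (\<forall>a. Fm X Y (s a f) = s' a (Fm X Y f)) \<and>
        (\<forall>f' \<in> Hom C X Y. Fm X Y (f + f') = Fm X Y f + Fm X Y f')) \<and>
     (\<forall>X \<in> Obj C. \<forall>Y \<in> Obj C. \<forall>Z \<in> Obj C. \<forall>f \<in> Hom C X Y. \<forall>g \<in> Hom C Y Z.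
        Fm X Z (Cmp C X Y Z g f) = Cmp D (F X) (F Y) (F Z) (Fm Y Z g) (Fm X Y f))"

definition linear_equivalence ::
  "('k::field \<Rightarrow> 'm::ab_group_add \<Rightarrow> 'm) \<Rightarrow> ('o, 'm, 'x) cat_scheme \<Rightarrow>
   ('k \<Rightarrow> 'n::ab_group_add \<Rightarrow> 'n) \<Rightarrow> ('p, 'n, 'y) cat_scheme \<Rightarrow>
   ('o \<Rightarrow> 'p) \<Rightarrow> ('o \<Rightarrow> 'o \<Rightarrow> 'm \<Rightarrow> 'n) \<Rightarrow> bool" where
  "linear_equivalence s C s' D F Fm \<longleftrightarrow> linear_functor s C s' D F Fm \<and>
     (\<forall>X \<in> Obj C. \<forall>Y \<in> Obj C. bij_betw (Fm X Y) (Hom C X Y) (Hom D (F X) (F Y))) \<and>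
     (\<forall>Z \<in> Obj D. \<exists>X \<in> Obj C. isomorphic D (F X) Z)"


section \<open>Triangulated categories\<close>

text \<open>
  \<open>Sh\<close> and \<open>ShM\<close> are the suspension functor on objects and morphisms, and
  \<open>(X, Y, Z, f, g, h) \<in> Tri T\<close> says that \<open>X -f\<rightarrow> Y -g\<rightarrow> Z -h\<rightarrow> Sh X\<close> is a distinguished triangle.
  The suspension is an autoequivalence, not necessarily an automorphism.
\<close>

record ('o, 'm) tricat = "('o, 'm) cat" +
  Sh :: "'o \<Rightarrow> 'o"
  ShM :: "'o \<Rightarrow> 'o \<Rightarrow> 'm \<Rightarrow> 'm"
  Tri :: "('o \<times> 'o \<times> 'o \<times> 'm \<times> 'm \<times> 'm) set"

locale triangulated_category = linear_category scale T
  for scale :: "'k::field \<Rightarrow> 'm::ab_group_add \<Rightarrow> 'm" and T :: "('o, 'm, 'x) tricat_scheme" +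
  assumes direct_sums: "has_direct_sums T"
    and Sh_equivalence: "linear_equivalence scale T scale T (Sh T) (ShM T)"
    and Tri_closed: "(X, Y, Z, f, g, h) \<in> Tri T \<Longrightarrow>
      X \<in> Obj T \<and> Y \<in> Obj T \<and> Z \<in> Obj T \<and>
      f \<in> Hom T X Y \<and> g \<in> Hom T Y Z \<and> h \<in> Hom T Z (Sh T X)"
    and Tri_iso: "\<lbrakk>(X, Y, Z, f, g, h) \<in> Tri T;
        X' \<in> Obj T; Y' \<in> Obj T; Z' \<in> Obj T;
        f' \<in> Hom T X' Y'; g' \<in> Hom T Y' Z'; h' \<in> Hom T Z' (Sh T X');
        is_iso T X X' a; is_iso T Y Y' b; is_iso T Z Z' c;
        Cmp T X Y Y' b f = Cmp T X X' Y' f' a;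
        Cmp T Y Z Z' c g = Cmp T Y Y' Z' g' b;
        Cmp T Z (Sh T X) (Sh T X') (ShM T X X' a) h = Cmp T Z Z' (Sh T X') h' c\<rbrakk>
      \<Longrightarrow> (X', Y', Z', f', g', h') \<in> Tri T"
    and Tri_Idn: "\<lbrakk>X \<in> Obj T; is_zero T Z\<rbrakk> \<Longrightarrow> (X, X, Z, Idn T X, 0, 0) \<in> Tri T"
    and Tri_ex: "\<lbrakk>X \<in> Obj T; Y \<in> Obj T; f \<in> Hom T X Y\<rbrakk> \<Longrightarrow> \<exists>Z g h. (X, Y, Z, f, g, h) \<in> Tri T"
    and Tri_rotate: "\<lbrakk>X \<in> Obj T; Y \<in> Obj T; Z \<in> Obj T;
        f \<in> Hom T X Y; g \<in> Hom T Y Z; h \<in> Hom T Z (Sh T X)\<rbrakk>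
      \<Longrightarrow> (X, Y, Z, f, g, h) \<in> Tri T \<longleftrightarrow> (Y, Z, Sh T X, g, h, - ShM T X Y f) \<in> Tri T"
    and Tri_morphism: "\<lbrakk>(X, Y, Z, f, g, h) \<in> Tri T; (X', Y', Z', f', g', h') \<in> Tri T;
        a \<in> Hom T X X'; b \<in> Hom T Y Y'; Cmp T X Y Y' b f = Cmp T X X' Y' f' a\<rbrakk>
      \<Longrightarrow> \<exists>c \<in> Hom T Z Z'. Cmp T Y Z Z' c g = Cmp T Y Y' Z' g' b \<and>
            Cmp T Z (Sh T X) (Sh T X') (ShM T X X' a) h = Cmp T Z Z' (Sh T X') h' c"
    and octahedral: "\<lbrakk>(X, Y, A, f, a, a') \<in> Tri T; (Y, Z, B, g, b, b') \<in> Tri T;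
        (X, Z, D, Cmp T X Y Z g f, d, d') \<in> Tri T\<rbrakk>
      \<Longrightarrow> \<exists>u v. (A, D, B, u, v, Cmp T B (Sh T Y) (Sh T A) (ShM T Y A a) b') \<in> Tri T \<and>
            Cmp T Y A D u a = Cmp T Y Z D d g \<and>
            Cmp T A D (Sh T X) d' u = a' \<and>
            Cmp T Z D B v d = b \<and>
            Cmp T D B (Sh T Y) b' v = Cmp T D (Sh T X) (Sh T Y) (ShM T X Y f) d'"

text \<open>
  The full subcategory on \<open>S\<close>, with the suspension and the distinguished triangles of \<open>T\<close>. It is a
  full triangulated subcategory iff the result is again a \<open>triangulated_category\<close>.
\<close>

definition full_sub :: "('o, 'm, 'x) tricat_scheme \<Rightarrow> 'o set \<Rightarrow> ('o, 'm, 'x) tricat_scheme" where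
  "full_sub T S = T\<lparr>Obj := S,
     Tri := {(X, Y, Z, f, g, h) \<in> Tri T. X \<in> S \<and> Y \<in> S \<and> Z \<in> S}\<rparr>"

definition summand_closed :: "('o, 'm::ab_group_add, 'x) cat_scheme \<Rightarrow> 'o set \<Rightarrow> bool" where
  "summand_closed C S \<longleftrightarrow> (\<forall>X \<in> S. \<forall>Y. is_summand C Y X \<longrightarrow> Y \<in> S)"

text \<open>
  Subcategories closed under direct summands are closed under isomorphisms, so that full subcategories
  can be compared through their sets of objects.
\<close>

definition thick ::
  "('k::field \<Rightarrow> 'm::ab_group_add \<Rightarrow> 'm) \<Rightarrow> ('o, 'm, 'x) tricat_scheme \<Rightarrow> 'o set \<Rightarrow> bool" where
  "thick scale T S \<longleftrightarrow>
     S \<subseteq> Obj T \<and> triangulated_category scale (full_sub T S) \<and> summand_closed T S"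

definition thick_closure ::
  "('k::field \<Rightarrow> 'm::ab_group_add \<Rightarrow> 'm) \<Rightarrow> ('o, 'm, 'x) tricat_scheme \<Rightarrow> 'o \<Rightarrow> 'o set" where
  "thick_closure scale T X = \<Inter>{S. thick scale T S \<and> X \<in> S}"

definition classical_generator ::
  "('k::field \<Rightarrow> 'm::ab_group_add \<Rightarrow> 'm) \<Rightarrow> ('o, 'm, 'x) tricat_scheme \<Rightarrow> 'o \<Rightarrow> bool" where
  "classical_generator scale T G \<longleftrightarrow> G \<in> Obj T \<and> thick_closure scale T G = Obj T"

text \<open>
  Closure under the functor \<open>[1]\<close> is meant as \<open>S[1] = S\<close>, that is, under \<open>[1]\<close> and its inverse.
\<close>

definition Sh_closed :: "('o, 'm, 'x) tricat_scheme \<Rightarrow> 'o set \<Rightarrow> bool" where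
  "Sh_closed T S \<longleftrightarrow> (\<forall>X \<in> Obj T. Sh T X \<in> S \<longleftrightarrow> X \<in> S)"

definition additive_closure :: "('o, 'm::ab_group_add, 'x) tricat_scheme \<Rightarrow> 'o \<Rightarrow> 'o set" where
  "additive_closure T X = \<Inter>{S. S \<subseteq> Obj T \<and> X \<in> S \<and> has_direct_sums (full_sub T S) \<and>
     summand_closed T S \<and> Sh_closed T S}"

text \<open>\<open>level T X m\<close> is \<open>\<langle>X\<rangle>\<^sub>m\<close> for \<open>m \<ge> 1\<close>; the value at \<open>0\<close> is a dummy.\<close>

fun level :: "('o, 'm::ab_group_add, 'x) tricat_scheme \<Rightarrow> 'o \<Rightarrow> nat \<Rightarrow> 'o set" where
  "level T X 0 = {}"
| "level T X (Suc 0) = additive_closure T X"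
| "level T X (Suc (Suc m)) = {A. \<exists>B C f g h. (B, A, C, f, g, h) \<in> Tri T \<and>
     B \<in> level T X (Suc 0) \<and> C \<in> level T X (Suc m)}"

text \<open>The least \<open>n \<ge> 1\<close> with \<open>\<langle>G\<rangle>\<^sub>n = T\<close> exists and equals \<open>t + 1\<close>. If all indecomposables
  in \<open>\<langle>G\<rangle>\<^sub>1\<close> are isomorphic, as for \<open>T = 0\<close>, or for finite-dimensional vector spaces with \<open>[1] = id\<close> and
  \<open>G = k\<close>, a linear generator \<open>G\<close> has generation time \<open>0\<close>.\<close>

definition has_generation_time :: "('o, 'm::ab_group_add, 'x) tricat_scheme \<Rightarrow> 'o \<Rightarrow> nat \<Rightarrow> bool" where
  "has_generation_time T G t \<longleftrightarrow>
     level T G (t + 1) = Obj T \<and> (\<forall>n. 1 \<le> n \<and> n < t + 1 \<longrightarrow> level T G n \<noteq> Obj T)"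


section \<open>Linear generators\<close>

definition indecs :: "('o, 'm::ab_group_add, 'x) tricat_scheme \<Rightarrow> 'o \<Rightarrow> 'o set" where
  "indecs T G = {P \<in> level T G 1. indecomposable T P}"

definition iso_classes :: "('o, 'm, 'x) cat_scheme \<Rightarrow> 'o set \<Rightarrow> 'o set set" where
  "iso_classes C S = S // {(X, Y). isomorphic C X Y}"

definition iso_class :: "('o, 'm, 'x) cat_scheme \<Rightarrow> 'o \<Rightarrow> 'o set" where
  "iso_class C X = {(X, Y). isomorphic C X Y} `` {X}"

text \<open>\<open>Q \<le> P\<close> iff the space of morphisms from \<open>P\<close> to \<open>Q\<close> is isomorphic to the ground field.\<close>

definition hom_le ::
  "('k::field \<Rightarrow> 'm::ab_group_add \<Rightarrow> 'm) \<Rightarrow> ('o, 'm, 'x) cat_scheme \<Rightarrow> 'o \<Rightarrow> 'o \<Rightarrow> bool" where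
  "hom_le scale C Q P \<longleftrightarrow>
     (\<exists>\<phi>. Vector_Spaces.linear ((*) :: 'k \<Rightarrow> 'k \<Rightarrow> 'k) scale \<phi> \<and> bij_betw \<phi> UNIV (Hom C P Q))"

text \<open>
  In (G4) the factorisation is required for nonzero morphisms only: the zero morphism cannot be a
  composite of nonzero ones here, since already the one-dimensional algebra \<open>Hom T P P\<close> has no zero
  divisors.
\<close>

definition linear_generator ::
  "('k::field \<Rightarrow> 'm::ab_group_add \<Rightarrow> 'm) \<Rightarrow> ('o, 'm, 'x) tricat_scheme \<Rightarrow> 'o \<Rightarrow> bool" where
  "linear_generator scale T G \<longleftrightarrow> classical_generator scale T G \<and>
     \<comment> \<open>(G1)\<close>
     linear_order_on (iso_classes T (indecs T G))
       {(iso_class T Q, iso_class T P) | Q P. Q \<in> indecs T G \<and> P \<in> indecs T G \<and> hom_le scale T Q P} \<and>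
     (\<forall>P \<in> indecs T G. \<forall>Q \<in> indecs T G.
        hom_le scale T Q P \<and> \<not> isomorphic T Q P \<longrightarrow> Hom T Q P = {0}) \<and>
     \<comment> \<open>(G2)\<close>
     (\<forall>P \<in> indecs T G. hom_le scale T P (Sh T P)) \<and>
     \<comment> \<open>(G3)\<close>
     (\<forall>P \<in> indecs T G. \<forall>Q \<in> indecs T G. hom_le scale T P Q \<and> hom_le scale T Q (Sh T P) \<longrightarrow>
        isomorphic T Q P \<or> isomorphic T Q (Sh T P)) \<and>
     \<comment> \<open>(G4)\<close>
     (\<forall>P \<in> indecs T G. \<forall>Q \<in> indecs T G. \<forall>R \<in> indecs T G.
        hom_le scale T R Q \<and> hom_le scale T Q P \<longrightarrow>
        (\<forall>f \<in> Hom T P R. f \<noteq> 0 \<longrightarrow>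
           (\<exists>g \<in> Hom T P Q. \<exists>h \<in> Hom T Q R. g \<noteq> 0 \<and> h \<noteq> 0 \<and> f = Cmp T P Q R h g)))"

end

theory Submission
  imports Defs
begin

text \<open>
  Write \<open>P\<close> for the additive closure of \<open>G\<close>. Every object \<open>M\<close> is studied through the
  functor \<open>Hom (-, M)\<close> on \<open>P\<close>, that is, as a module over the category of indecomposables in \<open>P\<close>.

  By the order and factorisation conditions on \<open>G\<close>, this category behaves like the linearisation of a
  totally ordered set: the morphism spaces are zero or one-dimensional, and composites of nonzero
  morphisms are nonzero (\<open>Cmp_nonzero\<close>).
  Gaussian elimination over it, with the indecomposable summands in the right order, shows that each
  morphism in \<open>P\<close> has an image in \<open>P\<close> (\<open>image_of_family\<close>, \<open>image_of_morphism\<close>). So \<open>P\<close> behaves like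
  the projective modules over a semihereditary ring: coherent modules have projective resolutions of
  length at most one.

  The objects \<open>M\<close> whose module is coherent form a thick subcategory (\<open>coherent_cone\<close>,
  \<open>thick_coherent\<close>), which contains \<open>G\<close> and so is everything. A resolution of the module of \<open>M\<close> is
  given by a morphism \<open>I \<rightarrow> A\<close> in \<open>P\<close>, whose cone \<open>C\<close> has a morphism to \<open>M\<close> inducing an isomorphism
  of modules; as \<open>P\<close> is closed under \<open>Sh\<close> and generates, this is an isomorphism. Rotating the triangle
  \<open>I \<rightarrow> A \<rightarrow> M\<close> gives \<open>A \<rightarrow> M \<rightarrow> Sh I\<close>, with \<open>A\<close> and \<open>Sh I\<close> in \<open>P\<close> (\<open>presentation\<close>).

  Hence every object has level at most two. If there are two nonisomorphic indecomposables, the cone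
  of a nonzero morphism between them is not in \<open>P\<close> (\<open>level_1_neq\<close>).
\<close>

section \<open>Retracts and direct sums in linear categories\<close>

text \<open>
  \<open>Y\<close> is a retract of \<open>X\<close>. Unlike for direct summands, no complement is required; in a triangulated
  category the two notions agree (\<open>retract_iff_summand\<close>).
\<close>

definition retract :: "('o, 'm, 'x) cat_scheme \<Rightarrow> 'o \<Rightarrow> 'o \<Rightarrow> bool" where
  "retract C Y X \<longleftrightarrow> (\<exists>i \<in> Hom C Y X. \<exists>p \<in> Hom C X Y. Cmp C Y X Y p i = Idn C Y)"

context linear_category
begin

lemma Hom_0 [simp]: "\<lbrakk>X \<in> Obj C; Y \<in> Obj C\<rbrakk> \<Longrightarrow> 0 \<in> Hom C X Y"
  and Hom_add [simp]: "\<lbrakk>X \<in> Obj C; Y \<in> Obj C; f \<in> Hom C X Y; g \<in> Hom C X Y\<rbrakk> \<Longrightarrow> f + g \<in> Hom C X Y"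
  and Hom_diff [simp]: "\<lbrakk>X \<in> Obj C; Y \<in> Obj C; f \<in> Hom C X Y; g \<in> Hom C X Y\<rbrakk> \<Longrightarrow> f - g \<in> Hom C X Y"
  and Hom_minus [simp]: "\<lbrakk>X \<in> Obj C; Y \<in> Obj C; f \<in> Hom C X Y\<rbrakk> \<Longrightarrow> - f \<in> Hom C X Y"
  and Hom_scale [simp]: "\<lbrakk>X \<in> Obj C; Y \<in> Obj C; f \<in> Hom C X Y\<rbrakk> \<Longrightarrow> scale a f \<in> Hom C X Y"
  by (simp_all add: Hom_subspace subspace_0 subspace_add subspace_diff subspace_neg subspace_scale)

lemma Hom_sum:
  "\<lbrakk>X \<in> Obj C; Y \<in> Obj C; \<And>a. a \<in> I \<Longrightarrow> f a \<in> Hom C X Y\<rbrakk> \<Longrightarrow> (\<Sum>a\<in>I. f a) \<in> Hom C X Y"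
  by (simp add: Hom_subspace subspace_sum)

lemmas typing [simp] = Idn_in_Hom Cmp_in_Hom

lemma Cmp_0_left [simp]:
  "\<lbrakk>X \<in> Obj C; Y \<in> Obj C; Z \<in> Obj C; f \<in> Hom C X Y\<rbrakk> \<Longrightarrow> Cmp C X Y Z 0 f = 0"
  using Cmp_add_left[of X Y Z f 0 0] by simp

lemma Cmp_0_right [simp]:
  "\<lbrakk>X \<in> Obj C; Y \<in> Obj C; Z \<in> Obj C; g \<in> Hom C Y Z\<rbrakk> \<Longrightarrow> Cmp C X Y Z g 0 = 0"
  using Cmp_add_right[of X Y Z 0 0 g] by simp

lemma Cmp_minus_left:
  "\<lbrakk>X \<in> Obj C; Y \<in> Obj C; Z \<in> Obj C; f \<in> Hom C X Y; g \<in> Hom C Y Z\<rbrakk>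
    \<Longrightarrow> Cmp C X Y Z (- g) f = - Cmp C X Y Z g f"
  using Cmp_add_left[of X Y Z f g "- g"] by (simp add: eq_neg_iff_add_eq_0 add.commute)

lemma Cmp_minus_right:
  "\<lbrakk>X \<in> Obj C; Y \<in> Obj C; Z \<in> Obj C; f \<in> Hom C X Y; g \<in> Hom C Y Z\<rbrakk>
    \<Longrightarrow> Cmp C X Y Z g (- f) = - Cmp C X Y Z g f"
  using Cmp_add_right[of X Y Z f "- f" g] by (simp add: eq_neg_iff_add_eq_0 add.commute)

lemma Cmp_diff_left:
  "\<lbrakk>X \<in> Obj C; Y \<in> Obj C; Z \<in> Obj C; f \<in> Hom C X Y; g \<in> Hom C Y Z; g' \<in> Hom C Y Z\<rbrakk>
    \<Longrightarrow> Cmp C X Y Z (g - g') f = Cmp C X Y Z g f - Cmp C X Y Z g' f"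
  using Cmp_add_left[of X Y Z f g "- g'"] by (simp add: Cmp_minus_left)

lemma Cmp_diff_right:
  "\<lbrakk>X \<in> Obj C; Y \<in> Obj C; Z \<in> Obj C; f \<in> Hom C X Y; f' \<in> Hom C X Y; g \<in> Hom C Y Z\<rbrakk>
    \<Longrightarrow> Cmp C X Y Z g (f - f') = Cmp C X Y Z g f - Cmp C X Y Z g f'"
  using Cmp_add_right[of X Y Z f "- f'" g] by (simp add: Cmp_minus_right)

lemmas bilinear = Cmp_add_left Cmp_add_right Cmp_diff_left Cmp_diff_right
  Cmp_minus_left Cmp_minus_right

lemma Cmp_sum_left:
  assumes "X \<in> Obj C" "Y \<in> Obj C" "Z \<in> Obj C" "f \<in> Hom C X Y" "\<And>a. a \<in> I \<Longrightarrow> g a \<in> Hom C Y Z"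
  shows "Cmp C X Y Z (\<Sum>a\<in>I. g a) f = (\<Sum>a\<in>I. Cmp C X Y Z (g a) f)"
  using assms(5)
  by (induction I rule: infinite_finite_induct) (simp_all add: assms(1-4) Cmp_add_left Hom_sum)

lemma Cmp_sum_right:
  assumes "X \<in> Obj C" "Y \<in> Obj C" "Z \<in> Obj C" "g \<in> Hom C Y Z" "\<And>a. a \<in> I \<Longrightarrow> f a \<in> Hom C X Y"
  shows "Cmp C X Y Z g (\<Sum>a\<in>I. f a) = (\<Sum>a\<in>I. Cmp C X Y Z g (f a))"
  using assms(5)
  by (induction I rule: infinite_finite_induct) (simp_all add: assms(1-4) Cmp_add_right Hom_sum)

lemma is_zero_iff: "is_zero C X \<longleftrightarrow> X \<in> Obj C \<and> Idn C X = 0"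
proof
  assume "is_zero C X"
  then show "X \<in> Obj C \<and> Idn C X = 0"
    using Idn_in_Hom unfolding is_zero_def by blast
next
  assume X: "X \<in> Obj C \<and> Idn C X = 0"
  have "f = 0" if "Y \<in> Obj C" "f \<in> Hom C X Y" for Y f
    using Cmp_Idn_right[of X Y f] X that by simp
  moreover have "f = 0" if "Y \<in> Obj C" "f \<in> Hom C Y X" for Y f
    using Cmp_Idn_left[of Y X f] X that by simp
  ultimately show "is_zero C X"
    using X unfolding is_zero_def by (auto simp del: Hom_0 intro: Hom_0)
qed

lemma is_iso_Idn: "X \<in> Obj C \<Longrightarrow> is_iso C X X (Idn C X)"
  unfolding is_iso_def by (auto intro!: bexI[of _ "Idn C X"] simp: Cmp_Idn_left)

lemma isomorphic_refl: "X \<in> Obj C \<Longrightarrow> isomorphic C X X"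
  unfolding isomorphic_def using is_iso_Idn by blast

lemma isomorphic_sym: "isomorphic C X Y \<Longrightarrow> isomorphic C Y X"
  unfolding isomorphic_def is_iso_def by blast

lemma isomorphic_retract: "isomorphic C X Y \<Longrightarrow> retract C X Y"
  unfolding isomorphic_def is_iso_def retract_def by blast

lemma is_direct_sumE:
  assumes "is_direct_sum C Xs Z"
  obtains \<iota> \<pi> where
    "\<And>a. a < length Xs \<Longrightarrow> Xs ! a \<in> Obj C" "Z \<in> Obj C"
    "\<And>a. a < length Xs \<Longrightarrow> \<iota> a \<in> Hom C (Xs ! a) Z" "\<And>a. a < length Xs \<Longrightarrow> \<pi> a \<in> Hom C Z (Xs ! a)"
    "\<And>a. a < length Xs \<Longrightarrow> Cmp C (Xs ! a) Z (Xs ! a) (\<pi> a) (\<iota> a) = Idn C (Xs ! a)"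
    "\<And>a b. \<lbrakk>a < length Xs; b < length Xs; a \<noteq> b\<rbrakk> \<Longrightarrow> Cmp C (Xs ! a) Z (Xs ! b) (\<pi> b) (\<iota> a) = 0"
    "(\<Sum>a<length Xs. Cmp C Z (Xs ! a) Z (\<iota> a) (\<pi> a)) = Idn C Z"
proof -
  have o: "\<And>a. a < length Xs \<Longrightarrow> Xs ! a \<in> Obj C" "Z \<in> Obj C"
    using assms unfolding is_direct_sum_def by auto
  obtain \<iota> \<pi> where
    h: "\<forall>a<length Xs. \<iota> a \<in> Hom C (Xs ! a) Z \<and> \<pi> a \<in> Hom C Z (Xs ! a)" and
    e: "\<forall>a<length Xs. \<forall>b<length Xs.
      Cmp C (Xs ! a) Z (Xs ! b) (\<pi> b) (\<iota> a) = (if a = b then Idn C (Xs ! a) else 0)" and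
    s: "(\<Sum>a<length Xs. Cmp C Z (Xs ! a) Z (\<iota> a) (\<pi> a)) = Idn C Z"
    using assms unfolding is_direct_sum_def by (elim conjE exE) (rule that)
  show thesis
    by (rule that[of \<iota> \<pi>]) (simp_all add: o h e s)
qed

lemma is_direct_sum_2E:
  assumes "is_direct_sum C [A, B] D"
  obtains i1 i2 p1 p2 where "A \<in> Obj C" "B \<in> Obj C" "D \<in> Obj C"
    "i1 \<in> Hom C A D" "i2 \<in> Hom C B D" "p1 \<in> Hom C D A" "p2 \<in> Hom C D B"
    "Cmp C A D A p1 i1 = Idn C A" "Cmp C B D B p2 i2 = Idn C B"
    "Cmp C A D B p2 i1 = 0" "Cmp C B D A p1 i2 = 0"
    "Cmp C D A D i1 p1 + Cmp C D B D i2 p2 = Idn C D"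
proof (rule is_direct_sumE[OF assms])
  fix \<iota> \<pi>
  assume o: "\<And>a. a < length [A, B] \<Longrightarrow> [A, B] ! a \<in> Obj C" "D \<in> Obj C"
    and i: "\<And>a. a < length [A, B] \<Longrightarrow> \<iota> a \<in> Hom C ([A, B] ! a) D"
    and p: "\<And>a. a < length [A, B] \<Longrightarrow> \<pi> a \<in> Hom C D ([A, B] ! a)"
    and e: "\<And>a. a < length [A, B] \<Longrightarrow> Cmp C ([A, B] ! a) D ([A, B] ! a) (\<pi> a) (\<iota> a) = Idn C ([A, B] ! a)"
    and z: "\<And>a b. \<lbrakk>a < length [A, B]; b < length [A, B]; a \<noteq> b\<rbrakk>
      \<Longrightarrow> Cmp C ([A, B] ! a) D ([A, B] ! b) (\<pi> b) (\<iota> a) = 0"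
    and s: "(\<Sum>a<length [A, B]. Cmp C D ([A, B] ! a) D (\<iota> a) (\<pi> a)) = Idn C D"
  show thesis
    using o(1)[of 0] o(1)[of 1] o(2) i[of 0] i[of 1] p[of 0] p[of 1] e[of 0] e[of 1] z[of 0 1] z[of 1 0] s
    by (intro that[of "\<iota> 0" "\<iota> 1" "\<pi> 0" "\<pi> 1"]) simp_all
qed

lemma is_direct_sum_2I:
  assumes "A \<in> Obj C" "B \<in> Obj C" "D \<in> Obj C"
    "i1 \<in> Hom C A D" "i2 \<in> Hom C B D" "p1 \<in> Hom C D A" "p2 \<in> Hom C D B"
    "Cmp C A D A p1 i1 = Idn C A" "Cmp C B D B p2 i2 = Idn C B"
    "Cmp C A D B p2 i1 = 0" "Cmp C B D A p1 i2 = 0"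
    "Cmp C D A D i1 p1 + Cmp C D B D i2 p2 = Idn C D"
  shows "is_direct_sum C [A, B] D"
  unfolding is_direct_sum_def
  using assms
  by (intro conjI exI[of _ "\<lambda>a. if a = 0 then i1 else i2"] exI[of _ "\<lambda>a. if a = 0 then p1 else p2"])
    (auto simp: less_Suc_eq numeral_2_eq_2)

lemma direct_sum_retract:
  assumes "is_direct_sum C Xs Z" "X \<in> set Xs"
  shows "retract C X Z"
proof -
  obtain a where a: "a < length Xs" "X = Xs ! a"
    using assms(2) by (auto simp: in_set_conv_nth)
  show ?thesis
    by (rule is_direct_sumE[OF assms(1)]) (unfold retract_def a(2), meson a(1))
qed

text \<open>Direct sums of the same family are isomorphic; only the following half of this is needed.\<close>

lemma direct_sum_retract_direct_sum:
  assumes "is_direct_sum C Xs Z" "is_direct_sum C Xs Z'"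
  shows "retract C Z Z'"
proof -
  let ?n = "length Xs"
  obtain \<iota> \<pi> where o: "\<And>a. a < ?n \<Longrightarrow> Xs ! a \<in> Obj C" "Z \<in> Obj C"
    and h: "\<And>a. a < ?n \<Longrightarrow> \<iota> a \<in> Hom C (Xs ! a) Z" "\<And>a. a < ?n \<Longrightarrow> \<pi> a \<in> Hom C Z (Xs ! a)"
    and s: "(\<Sum>a<?n. Cmp C Z (Xs ! a) Z (\<iota> a) (\<pi> a)) = Idn C Z"
    by (rule is_direct_sumE[OF assms(1)]) blast
  obtain \<iota>' \<pi>' where o': "Z' \<in> Obj C"
    and h': "\<And>a. a < ?n \<Longrightarrow> \<iota>' a \<in> Hom C (Xs ! a) Z'" "\<And>a. a < ?n \<Longrightarrow> \<pi>' a \<in> Hom C Z' (Xs ! a)"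
    and e: "\<And>a. a < ?n \<Longrightarrow> Cmp C (Xs ! a) Z' (Xs ! a) (\<pi>' a) (\<iota>' a) = Idn C (Xs ! a)"
    and z: "\<And>a b. \<lbrakk>a < ?n; b < ?n; a \<noteq> b\<rbrakk> \<Longrightarrow> Cmp C (Xs ! a) Z' (Xs ! b) (\<pi>' b) (\<iota>' a) = 0"
    by (rule is_direct_sumE[OF assms(2)]) blast
  note o = o o'
let ?i = "\<Sum>a<?n. Cmp C Z (Xs ! a) Z' (\<iota>' a) (\<pi> a)"
  let ?p = "\<Sum>b<?n. Cmp C Z' (Xs ! b) Z (\<iota> b) (\<pi>' b)"
  have i: "?i \<in> Hom C Z Z'" and p: "?p \<in> Hom C Z' Z"
    using o h h' by (auto intro!: Hom_sum)
  have "Cmp C Z Z' Z ?p ?i = (\<Sum>a<?n. Cmp C Z Z' Z ?p (Cmp C Z (Xs ! a) Z' (\<iota>' a) (\<pi> a)))"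
    by (rule Cmp_sum_right) (use o h h' p in auto)
  also have "\<dots> =
    (\<Sum>a<?n. \<Sum>b<?n. Cmp C Z Z' Z (Cmp C Z' (Xs ! b) Z (\<iota> b) (\<pi>' b)) (Cmp C Z (Xs ! a) Z' (\<iota>' a) (\<pi> a)))"
    by (intro sum.cong refl Cmp_sum_left) (use o h h' in auto)
  also have "\<dots> = (\<Sum>a<?n. \<Sum>b<?n. if a = b then Cmp C Z (Xs ! a) Z (\<iota> a) (\<pi> a) else 0)"
  proof (intro sum.cong refl)
    fix a b assume "a \<in> {..<?n}" "b \<in> {..<?n}"
    then have ab: "a < ?n" "b < ?n" by auto
    have "Cmp C Z Z' Z (Cmp C Z' (Xs ! b) Z (\<iota> b) (\<pi>' b)) (Cmp C Z (Xs ! a) Z' (\<iota>' a) (\<pi> a)) =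
      Cmp C Z (Xs ! b) Z (\<iota> b) (Cmp C Z (Xs ! a) (Xs ! b) (Cmp C (Xs ! a) Z' (Xs ! b) (\<pi>' b) (\<iota>' a)) (\<pi> a))"
      using o h h' ab by (simp add: Cmp_assoc)
    then show "Cmp C Z Z' Z (Cmp C Z' (Xs ! b) Z (\<iota> b) (\<pi>' b)) (Cmp C Z (Xs ! a) Z' (\<iota>' a) (\<pi> a)) =
      (if a = b then Cmp C Z (Xs ! a) Z (\<iota> a) (\<pi> a) else 0)"
      using o h ab e z by (cases "a = b") (simp_all add: Cmp_Idn_left)
  qed
  also have "\<dots> = Idn C Z"
    using s by (simp add: sum.delta')
  finally show ?thesis
    unfolding retract_def using i p by blast
qed

end

context linear_category
begin

lemma is_direct_sum_Cons:
  assumes "is_direct_sum C Xs W" "is_direct_sum C [X, W] D"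
  shows "is_direct_sum C (X # Xs) D"
proof -
  let ?n = "length Xs"
  obtain \<iota> \<pi> where o: "\<And>a. a < ?n \<Longrightarrow> Xs ! a \<in> Obj C" "W \<in> Obj C"
    and h: "\<And>a. a < ?n \<Longrightarrow> \<iota> a \<in> Hom C (Xs ! a) W" "\<And>a. a < ?n \<Longrightarrow> \<pi> a \<in> Hom C W (Xs ! a)"
    and e: "\<And>a. a < ?n \<Longrightarrow> Cmp C (Xs ! a) W (Xs ! a) (\<pi> a) (\<iota> a) = Idn C (Xs ! a)"
    and z: "\<And>a b. \<lbrakk>a < ?n; b < ?n; a \<noteq> b\<rbrakk> \<Longrightarrow> Cmp C (Xs ! a) W (Xs ! b) (\<pi> b) (\<iota> a) = 0"
    and s: "(\<Sum>a<?n. Cmp C W (Xs ! a) W (\<iota> a) (\<pi> a)) = Idn C W"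
    by (rule is_direct_sumE[OF assms(1)]) blast
  obtain i1 i2 p1 p2 where o2: "X \<in> Obj C" "D \<in> Obj C"
    and h2: "i1 \<in> Hom C X D" "i2 \<in> Hom C W D" "p1 \<in> Hom C D X" "p2 \<in> Hom C D W"
    and e2: "Cmp C X D X p1 i1 = Idn C X" "Cmp C W D W p2 i2 = Idn C W"
      "Cmp C X D W p2 i1 = 0" "Cmp C W D X p1 i2 = 0"
    and s2: "Cmp C D X D i1 p1 + Cmp C D W D i2 p2 = Idn C D"
    by (rule is_direct_sum_2E[OF assms(2)]) blast
  let ?i = "\<lambda>a. case a of 0 \<Rightarrow> i1 | Suc a \<Rightarrow> Cmp C (Xs ! a) W D i2 (\<iota> a)"
  let ?p = "\<lambda>a. case a of 0 \<Rightarrow> p1 | Suc a \<Rightarrow> Cmp C D W (Xs ! a) (\<pi> a) p2"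
  have hom: "?i a \<in> Hom C ((X # Xs) ! a) D \<and> ?p a \<in> Hom C D ((X # Xs) ! a)"
    if "a < length (X # Xs)" for a
    using that o h o2 h2 by (cases a) auto
  have mid: "Cmp C A D B (Cmp C D W B v p2) (Cmp C A W D i2 u) = Cmp C A W B v u"
    if "A \<in> Obj C" "B \<in> Obj C" "u \<in> Hom C A W" "v \<in> Hom C W B" for A B u v
  proof -
    have "Cmp C A D B (Cmp C D W B v p2) (Cmp C A W D i2 u) =
      Cmp C A W B v (Cmp C A W W (Cmp C W D W p2 i2) u)"
      using that o o2 h2 by (simp add: Cmp_assoc del: e2)
    then show ?thesis
      using that o e2 by (simp add: Cmp_Idn_left)
  qed
  have orth: "Cmp C ((X # Xs) ! a) D ((X # Xs) ! b) (?p b) (?i a) =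
      (if a = b then Idn C ((X # Xs) ! a) else 0)"
    if "a < length (X # Xs)" "b < length (X # Xs)" for a b
  proof (cases a; cases b)
    fix b' assume ab: "a = 0" "b = Suc b'"
    then show ?thesis
      using that o h o2 h2 e2 by (simp add: Cmp_assoc[symmetric])
  next
    fix a' assume ab: "a = Suc a'" "b = 0"
    then show ?thesis
      using that o h o2 h2 e2 by (simp add: Cmp_assoc)
  next
    fix a' b' assume ab: "a = Suc a'" "b = Suc b'"
    then show ?thesis
      using that o h e z by (auto simp: mid)
  qed (use e2 in simp)
  have "(\<Sum>a<?n. Cmp C D (Xs ! a) D (Cmp C (Xs ! a) W D i2 (\<iota> a)) (Cmp C D W (Xs ! a) (\<pi> a) p2)) =
    (\<Sum>a<?n. Cmp C D W D i2 (Cmp C D W W (Cmp C W (Xs ! a) W (\<iota> a) (\<pi> a)) p2))"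
    using o h o2 h2 by (intro sum.cong refl) (simp add: Cmp_assoc)
  also have "\<dots> = Cmp C D W D i2 (\<Sum>a<?n. Cmp C D W W (Cmp C W (Xs ! a) W (\<iota> a) (\<pi> a)) p2)"
    by (rule Cmp_sum_right[symmetric]) (use o h o2 h2 in auto)
  also have "(\<Sum>a<?n. Cmp C D W W (Cmp C W (Xs ! a) W (\<iota> a) (\<pi> a)) p2) = Cmp C D W W (Idn C W) p2"
    unfolding s[symmetric] by (rule Cmp_sum_left[symmetric]) (use o h o2 h2 in auto)
  finally have "(\<Sum>a<length (X # Xs). Cmp C D ((X # Xs) ! a) D (?i a) (?p a)) = Idn C D"
    using o o2 h2 s2 by (simp add: sum.lessThan_Suc_shift Cmp_Idn_left del: sum.lessThan_Suc)
  moreover have "set (X # Xs) \<subseteq> Obj C"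
    using assms(1) o2 unfolding is_direct_sum_def by auto
  ultimately show ?thesis
    unfolding is_direct_sum_def using hom orth o2 by blast
qed

lemma is_direct_sum_Nil: "is_direct_sum C [] Z \<longleftrightarrow> is_zero C Z"
  by (auto simp: is_direct_sum_def is_zero_iff)

lemma zero_retract: "\<lbrakk>is_zero C Z; X \<in> Obj C\<rbrakk> \<Longrightarrow> retract C Z X"
  unfolding retract_def is_zero_iff by (auto intro!: bexI[of _ 0])

end

section \<open>Exact sequences in triangulated categories\<close>

context triangulated_category
begin

lemma Sh_Obj [simp]: "X \<in> Obj T \<Longrightarrow> Sh T X \<in> Obj T"
  and ShM_Idn: "X \<in> Obj T \<Longrightarrow> ShM T X X (Idn T X) = Idn T (Sh T X)"
  and ShM_Hom [simp]: "\<lbrakk>X \<in> Obj T; Y \<in> Obj T; f \<in> Hom T X Y\<rbrakk> \<Longrightarrow> ShM T X Y f \<in> Hom T (Sh T X) (Sh T Y)"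
  and ShM_Cmp: "\<lbrakk>X \<in> Obj T; Y \<in> Obj T; Z \<in> Obj T; f \<in> Hom T X Y; g \<in> Hom T Y Z\<rbrakk> \<Longrightarrow>
    ShM T X Z (Cmp T X Y Z g f) = Cmp T (Sh T X) (Sh T Y) (Sh T Z) (ShM T Y Z g) (ShM T X Y f)"
  and ShM_bij: "\<lbrakk>X \<in> Obj T; Y \<in> Obj T\<rbrakk> \<Longrightarrow>
    bij_betw (ShM T X Y) (Hom T X Y) (Hom T (Sh T X) (Sh T Y))"
  and ShM_add: "\<lbrakk>X \<in> Obj T; Y \<in> Obj T; f \<in> Hom T X Y; g \<in> Hom T X Y\<rbrakk> \<Longrightarrow>
    ShM T X Y (f + g) = ShM T X Y f + ShM T X Y g"
  and ShM_scale: "\<lbrakk>X \<in> Obj T; Y \<in> Obj T; f \<in> Hom T X Y\<rbrakk> \<Longrightarrow>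
    ShM T X Y (scale a f) = scale a (ShM T X Y f)"
  and desuspend: "Z \<in> Obj T \<Longrightarrow> \<exists>X \<in> Obj T. isomorphic T (Sh T X) Z"
  using Sh_equivalence unfolding linear_equivalence_def linear_functor_def by simp_all

lemma ShM_0 [simp]: "\<lbrakk>X \<in> Obj T; Y \<in> Obj T\<rbrakk> \<Longrightarrow> ShM T X Y 0 = 0"
  using ShM_add[of X Y 0 0] by simp

lemma ShM_eq_iff:
  "\<lbrakk>X \<in> Obj T; Y \<in> Obj T; f \<in> Hom T X Y; g \<in> Hom T X Y\<rbrakk> \<Longrightarrow> ShM T X Y f = ShM T X Y g \<longleftrightarrow> f = g"
  using ShM_bij[of X Y] by (auto simp: bij_betw_def inj_on_eq_iff)

lemma ShM_eq_0_iff: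
  "\<lbrakk>X \<in> Obj T; Y \<in> Obj T; f \<in> Hom T X Y\<rbrakk> \<Longrightarrow> ShM T X Y f = 0 \<longleftrightarrow> f = 0"
  using ShM_eq_iff[of X Y f 0] by simp

lemma ShM_fullE:
  assumes "X \<in> Obj T" "Y \<in> Obj T" "\<phi> \<in> Hom T (Sh T X) (Sh T Y)"
  obtains f where "f \<in> Hom T X Y" "\<phi> = ShM T X Y f"
  using ShM_bij[OF assms(1,2)] assms(3) by (auto simp: bij_betw_def)

lemma desuspendE:
  assumes "Z \<in> Obj T"
  obtains X u v where "X \<in> Obj T" "u \<in> Hom T Z (Sh T X)" "v \<in> Hom T (Sh T X) Z"
    "Cmp T Z (Sh T X) Z v u = Idn T Z" "Cmp T (Sh T X) Z (Sh T X) u v = Idn T (Sh T X)"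
    "isomorphic T (Sh T X) Z"
proof -
  obtain X where X: "X \<in> Obj T" "isomorphic T (Sh T X) Z"
    using desuspend[OF assms] by blast
  then obtain v u where "v \<in> Hom T (Sh T X) Z" "u \<in> Hom T Z (Sh T X)"
    "Cmp T (Sh T X) Z (Sh T X) u v = Idn T (Sh T X)" "Cmp T Z (Sh T X) Z v u = Idn T Z"
    unfolding isomorphic_def is_iso_def by blast
  then show thesis using that X by blast
qed

lemma zero_objE: obtains N where "is_zero T N"
  using direct_sums is_direct_sum_Nil unfolding has_direct_sums_def by (metis empty_set empty_subsetI)

lemma rotate: "(X, Y, Z, f, g, h) \<in> Tri T \<Longrightarrow> (Y, Z, Sh T X, g, h, - ShM T X Y f) \<in> Tri T"
  using Tri_closed Tri_rotate by blast

lemma tri_comp_0: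
  assumes t: "(X, Y, Z, f, g, h) \<in> Tri T"
  shows "Cmp T X Y Z g f = 0" "Cmp T Y Z (Sh T X) h g = 0"
    "Cmp T Z (Sh T X) (Sh T Y) (ShM T X Y f) h = 0"
proof -
  have *: "Cmp T X Y Z g f = 0" if t: "(X, Y, Z, f, g, h) \<in> Tri T" for X Y Z f g h
  proof -
    note c = Tri_closed[OF t]
    obtain N where N: "is_zero T N" by (rule zero_objE)
    have "(X, X, N, Idn T X, 0, 0) \<in> Tri T"
      using Tri_Idn c N by blast
    then obtain e where e: "e \<in> Hom T N Z" "Cmp T X N Z e 0 = Cmp T X Y Z g f"
      using Tri_morphism[OF _ t, of X X N "Idn T X" 0 0 "Idn T X" f] c by auto
    then show ?thesis
      using c N by (simp add: is_zero_iff)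
  qed
  show "Cmp T X Y Z g f = 0" "Cmp T Y Z (Sh T X) h g = 0"
    using *[OF t] *[OF rotate[OF t]] .
  show "Cmp T Z (Sh T X) (Sh T Y) (ShM T X Y f) h = 0"
    using *[OF rotate[OF rotate[OF t]]] Tri_closed[OF t] by (simp add: Cmp_minus_left)
qed

text \<open>The long exact sequence of the covariant functor represented by \<open>R\<close>.\<close>

lemma tri_exact:
  assumes t: "(X, Y, Z, f, g, h) \<in> Tri T" and R: "R \<in> Obj T"
  shows "\<lbrakk>\<phi> \<in> Hom T R Y; Cmp T R Y Z g \<phi> = 0\<rbrakk> \<Longrightarrow> \<exists>\<psi> \<in> Hom T R X. \<phi> = Cmp T R X Y f \<psi>"
    "\<lbrakk>\<phi>' \<in> Hom T R Z; Cmp T R Z (Sh T X) h \<phi>' = 0\<rbrakk> \<Longrightarrow> \<exists>\<psi> \<in> Hom T R Y. \<phi>' = Cmp T R Y Z g \<psi>"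
    "\<lbrakk>\<phi>'' \<in> Hom T R (Sh T X); Cmp T R (Sh T X) (Sh T Y) (ShM T X Y f) \<phi>'' = 0\<rbrakk>
      \<Longrightarrow> \<exists>\<psi> \<in> Hom T R Z. \<phi>'' = Cmp T R Z (Sh T X) h \<psi>"
proof -
  have *: "\<exists>\<psi> \<in> Hom T R X. \<phi> = Cmp T R X Y f \<psi>"
    if t: "(X, Y, Z, f, g, h) \<in> Tri T" and p: "\<phi> \<in> Hom T R Y" "Cmp T R Y Z g \<phi> = 0" for X Y Z f g h \<phi>
  proof -
    note c = Tri_closed[OF t]
    \<comment> \<open>Extend \<open>\<phi>\<close> and \<open>0\<close> to a morphism from the rotated triangle of the identity of \<open>R\<close>; its third
      component is the suspension of the required \<open>\<psi>\<close>.\<close>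
    obtain N where N: "is_zero T N" by (rule zero_objE)
    then have "(R, N, Sh T R, 0, 0, - ShM T R R (Idn T R)) \<in> Tri T"
      using Tri_Idn R rotate by blast
    then obtain e where e: "e \<in> Hom T (Sh T R) (Sh T X)"
      "Cmp T (Sh T R) (Sh T R) (Sh T Y) (ShM T R Y \<phi>) (- ShM T R R (Idn T R)) =
        Cmp T (Sh T R) (Sh T X) (Sh T Y) (- ShM T X Y f) e"
      using Tri_morphism[OF _ rotate[OF t], of R N "Sh T R" 0 0 "- ShM T R R (Idn T R)" \<phi> 0] c N R p
      by (auto simp: is_zero_iff)
    obtain \<psi> where psi: "\<psi> \<in> Hom T R X" "e = ShM T R X \<psi>"
      using ShM_fullE[of R X e] c R e(1) by auto
    have "ShM T R Y \<phi> = ShM T R Y (Cmp T R X Y f \<psi>)"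
      using e(2) c R p psi by (simp add: Cmp_minus_left Cmp_minus_right ShM_Idn Cmp_Idn_right ShM_Cmp)
    then have "\<phi> = Cmp T R X Y f \<psi>"
      using c R p psi by (simp add: ShM_eq_iff)
    with psi show ?thesis by blast
  qed
  show "\<lbrakk>\<phi> \<in> Hom T R Y; Cmp T R Y Z g \<phi> = 0\<rbrakk> \<Longrightarrow> \<exists>\<psi> \<in> Hom T R X. \<phi> = Cmp T R X Y f \<psi>"
    "\<lbrakk>\<phi>' \<in> Hom T R Z; Cmp T R Z (Sh T X) h \<phi>' = 0\<rbrakk> \<Longrightarrow> \<exists>\<psi> \<in> Hom T R Y. \<phi>' = Cmp T R Y Z g \<psi>"
    using *[OF t] *[OF rotate[OF t]] by blast+
  show "\<exists>\<psi> \<in> Hom T R Z. \<phi>'' = Cmp T R Z (Sh T X) h \<psi>"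
    if "\<phi>'' \<in> Hom T R (Sh T X)" "Cmp T R (Sh T X) (Sh T Y) (ShM T X Y f) \<phi>'' = 0"
    using *[OF rotate[OF rotate[OF t]], of \<phi>''] Tri_closed[OF t] that R by (simp add: Cmp_minus_left)
qed

text \<open>Two exact places of the contravariant functor represented by \<open>W\<close>.\<close>

lemma tri_coexact:
  assumes t: "(X, Y, Z, f, g, h) \<in> Tri T" and W: "W \<in> Obj T"
  shows "\<lbrakk>\<phi> \<in> Hom T Y W; Cmp T X Y W \<phi> f = 0\<rbrakk> \<Longrightarrow> \<exists>\<psi> \<in> Hom T Z W. \<phi> = Cmp T Y Z W \<psi> g"
    "\<lbrakk>\<phi>' \<in> Hom T Z W; Cmp T Y Z W \<phi>' g = 0\<rbrakk> \<Longrightarrow> \<exists>\<psi> \<in> Hom T (Sh T X) W. \<phi>' = Cmp T Z (Sh T X) W \<psi> h"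
proof -
  have *: "\<exists>\<psi> \<in> Hom T Z W. \<phi> = Cmp T Y Z W \<psi> g"
    if t: "(X, Y, Z, f, g, h) \<in> Tri T" and p: "\<phi> \<in> Hom T Y W" "Cmp T X Y W \<phi> f = 0" for X Y Z f g h \<phi>
  proof -
    note c = Tri_closed[OF t]
    \<comment> \<open>Dually, extend \<open>0\<close> and \<open>\<phi>\<close> to a morphism to the triangle \<open>N \<rightarrow> W \<rightarrow> W\<close>.\<close>
    obtain N where N: "is_zero T N" by (rule zero_objE)
    then have N': "N \<in> Obj T" by (simp add: is_zero_iff)
    then have "is_zero T (Sh T N)"
      using N ShM_Idn[of N] by (simp add: is_zero_iff)
    then have "(W, W, Sh T N, Idn T W, 0, - ShM T N W 0) \<in> Tri T"
      using Tri_Idn W N' by simp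
    then have "(N, W, W, 0, Idn T W, 0) \<in> Tri T"
      using Tri_rotate[of N W W 0 "Idn T W" 0] W N' by simp
    then obtain \<psi> where "\<psi> \<in> Hom T Z W" "Cmp T Y Z W \<psi> g = Cmp T Y W W (Idn T W) \<phi>"
      using Tri_morphism[OF t, of N W W 0 "Idn T W" 0 0 \<phi>] c N' W p by auto
    then show ?thesis
      using c W p by (auto simp: Cmp_Idn_left)
  qed
  show "\<lbrakk>\<phi> \<in> Hom T Y W; Cmp T X Y W \<phi> f = 0\<rbrakk> \<Longrightarrow> \<exists>\<psi> \<in> Hom T Z W. \<phi> = Cmp T Y Z W \<psi> g"
    "\<lbrakk>\<phi>' \<in> Hom T Z W; Cmp T Y Z W \<phi>' g = 0\<rbrakk> \<Longrightarrow> \<exists>\<psi> \<in> Hom T (Sh T X) W. \<phi>' = Cmp T Z (Sh T X) W \<psi> h"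
    using *[OF t] *[OF rotate[OF t]] by blast+
qed

text \<open>A triangle on a split monomorphism splits.\<close>

lemma split_mono_tri:
  assumes t: "(X, Y, Z, f, g, h) \<in> Tri T" and p: "p \<in> Hom T Y X" "Cmp T X Y X p f = Idn T X"
  obtains s where "h = 0" "s \<in> Hom T Z Y" "Cmp T Z Y Z g s = Idn T Z"
proof -
  note c = Tri_closed[OF t]
  have "Cmp T (Sh T X) (Sh T Y) (Sh T X) (ShM T Y X p) (ShM T X Y f) = Idn T (Sh T X)"
    using c p by (simp add: ShM_Cmp[symmetric] ShM_Idn)
  then have "h = Cmp T Z (Sh T X) (Sh T X) (Cmp T (Sh T X) (Sh T Y) (Sh T X) (ShM T Y X p) (ShM T X Y f)) h"
    using c by (simp add: Cmp_Idn_left)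
  also have "\<dots> = Cmp T Z (Sh T Y) (Sh T X) (ShM T Y X p) (Cmp T Z (Sh T X) (Sh T Y) (ShM T X Y f) h)"
    using c p by (simp add: Cmp_assoc)
  also have "\<dots> = 0"
    using c p tri_comp_0(3)[OF t] by simp
  finally have "h = 0" .
  then obtain s where "s \<in> Hom T Z Y" "Idn T Z = Cmp T Z Y Z g s"
    using tri_exact(2)[OF t, of Z "Idn T Z"] c by auto
  with \<open>h = 0\<close> show thesis using that by simp
qed

text \<open>The complement of a retract is the cone of its inclusion.\<close>

lemma retract_iff_summand:
  assumes "X \<in> Obj T" "Y \<in> Obj T"
  shows "retract T X Y \<longleftrightarrow> is_summand T X Y"
proof
  assume "is_summand T X Y"
  then show "retract T X Y"
    unfolding is_summand_def using direct_sum_retract[of "[X, _]" Y X] by auto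
next
  assume "retract T X Y"
  then obtain f p where f: "f \<in> Hom T X Y" and p: "p \<in> Hom T Y X" "Cmp T X Y X p f = Idn T X"
    unfolding retract_def by blast
  obtain Z g h where t: "(X, Y, Z, f, g, h) \<in> Tri T"
    using Tri_ex assms f by blast
  note c = Tri_closed[OF t]
  obtain s0 where s0: "s0 \<in> Hom T Z Y" "Cmp T Z Y Z g s0 = Idn T Z"
    using split_mono_tri[OF t p] by blast
  \<comment> \<open>Correct the section \<open>s0\<close> of \<open>g\<close> so that \<open>p\<close> vanishes on it.\<close>
  let ?s = "s0 - Cmp T Z X Y f (Cmp T Z Y X p s0)"
  have s: "?s \<in> Hom T Z Y" using c p s0 by simp
  have gf: "Cmp T X Y Z g f = 0" by (rule tri_comp_0(1)[OF t])
  have gs: "Cmp T Z Y Z g ?s = Idn T Z"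
    using c p s0 gf by (simp add: Cmp_diff_right Cmp_assoc)
  have ps: "Cmp T Z Y X p ?s = 0"
    using c p s0 by (simp add: Cmp_diff_right Cmp_assoc Cmp_Idn_left)
  let ?d = "Idn T Y - Cmp T Y X Y f p - Cmp T Y Z Y ?s g"
  have d: "?d \<in> Hom T Y Y" using c p s by simp
  have "Cmp T Y Y Z g ?d = g - Cmp T Y X Z (Cmp T X Y Z g f) p - Cmp T Y Z Z (Cmp T Z Y Z g ?s) g"
    using c p s by (simp add: Cmp_diff_right[of Y Y Z] Cmp_assoc Cmp_Idn_right)
  also have "\<dots> = 0"
    unfolding gs gf using c p by (simp add: Cmp_Idn_left)
  finally obtain \<psi> where psi: "\<psi> \<in> Hom T Y X" "?d = Cmp T Y X Y f \<psi>"
    using tri_exact(1)[OF t _ d] c by blast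
  have "Cmp T Y Y X p ?d = p - Cmp T Y X X (Cmp T X Y X p f) p - Cmp T Y Z X (Cmp T Z Y X p ?s) g"
    using c p s by (simp add: Cmp_diff_right[of Y Y X] Cmp_assoc Cmp_Idn_right)
  also have "\<dots> = 0"
    unfolding ps p(2) using c p by (simp add: Cmp_Idn_left)
  finally have "Cmp T Y X X (Cmp T X Y X p f) \<psi> = 0"
    using c p psi by (simp add: Cmp_assoc)
  then have "\<psi> = 0"
    using c p psi by (simp add: Cmp_Idn_left)
  then have "?d = 0"
    using psi c by simp
  then have "Cmp T Y X Y f p + Cmp T Y Z Y ?s g = Idn T Y"
    by (simp add: algebra_simps)
  then have "is_direct_sum T [X, Z] Y"
    using is_direct_sum_2I[of X Z Y f ?s p g] c p s gf gs ps by blast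
  then show "is_summand T X Y"
    unfolding is_summand_def by blast
qed

end

section \<open>Thick subcategories\<close>

lemma full_sub_simps [simp]:
  "Obj (full_sub T S) = S" "Hom (full_sub T S) = Hom T" "Idn (full_sub T S) = Idn T"
  "Cmp (full_sub T S) = Cmp T" "Sh (full_sub T S) = Sh T" "ShM (full_sub T S) = ShM T"
  "Tri (full_sub T S) = {(X, Y, Z, f, g, h) \<in> Tri T. X \<in> S \<and> Y \<in> S \<and> Z \<in> S}"
  by (simp_all add: full_sub_def)

lemma is_iso_full_sub [simp]: "is_iso (full_sub T S) = is_iso T"
  by (simp add: is_iso_def fun_eq_iff)

lemma is_direct_sum_full_sub:
  "S \<subseteq> Obj T \<Longrightarrow> is_direct_sum (full_sub T S) Xs Z \<longleftrightarrow> is_direct_sum T Xs Z \<and> set Xs \<subseteq> S \<and> Z \<in> S"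
  unfolding is_direct_sum_def full_sub_simps by blast

context triangulated_category
begin

text \<open>
  A nonempty class of objects closed under retracts, cones and desuspension is thick. Closure under
  suspension and direct sums is automatic: \<open>Sh X\<close> is the cone of \<open>X \<rightarrow> 0\<close>, and \<open>Sh (A \<oplus> B)\<close> is a
  cone of the zero morphism \<open>B \<rightarrow> Sh A\<close>.
\<close>

lemma thickI:
  assumes S: "S \<subseteq> Obj T" "S \<noteq> {}"
    and ret: "\<And>X Y. \<lbrakk>Y \<in> S; X \<in> Obj T; retract T X Y\<rbrakk> \<Longrightarrow> X \<in> S"
    and cone: "\<And>X Y Z f g h. \<lbrakk>(X, Y, Z, f, g, h) \<in> Tri T; X \<in> S; Y \<in> S\<rbrakk> \<Longrightarrow> Z \<in> S"
    and desusp: "\<And>X. \<lbrakk>X \<in> Obj T; Sh T X \<in> S\<rbrakk> \<Longrightarrow> X \<in> S"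
  shows "thick scale T S"
proof -
  have SD: "X \<in> Obj T" if "X \<in> S" for X
    using that S by blast
  have zero: "N \<in> S" if "is_zero T N" for N
    using S ret that zero_retract[OF that] unfolding is_zero_def by blast
  have susp: "Sh T X \<in> S" if "X \<in> S" for X
  proof -
    obtain N where N: "is_zero T N" by (rule zero_objE)
    then show ?thesis
      using cone[OF rotate[OF Tri_Idn]] zero that SD by blast
  qed
  have iso: "X \<in> S" if "Y \<in> S" "isomorphic T X Y" for X Y
    using ret that isomorphic_retract unfolding isomorphic_def by blast
  have sum2: "D \<in> S" if "A \<in> S" "B \<in> S" and D: "is_direct_sum T [A, B] D" for A B D
  proof -
    obtain i1 i2 p1 p2 where o: "A \<in> Obj T" "B \<in> Obj T" "D \<in> Obj T"
      and h: "i1 \<in> Hom T A D" "i2 \<in> Hom T B D" "p1 \<in> Hom T D A" "p2 \<in> Hom T D B"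
      and e: "Cmp T A D A p1 i1 = Idn T A" "Cmp T B D B p2 i2 = Idn T B"
      "Cmp T A D B p2 i1 = 0" "Cmp T B D A p1 i2 = 0"
      and s: "Cmp T D A D i1 p1 + Cmp T D B D i2 p2 = Idn T D"
      by (rule is_direct_sum_2E[OF D]) blast
    obtain Z g k where t: "(A, D, Z, i1, g, k) \<in> Tri T"
      using Tri_ex o h by blast
    note c = Tri_closed[OF t]
    obtain r where r: "r \<in> Hom T Z D" "Cmp T Z D Z g r = Idn T Z"
      using split_mono_tri[OF t h(3) e(1)] by blast
    \<comment> \<open>The complement \<open>Z\<close> of \<open>A\<close> in \<open>D\<close> is a retract of \<open>B\<close>, and \<open>Sh D\<close> is a cone of \<open>Z \<rightarrow> Sh A\<close>.\<close>
    have "Cmp T Z B Z (Cmp T B D Z g i2) (Cmp T Z D B p2 r) = Cmp T Z D Z g (Cmp T Z D D (Cmp T D B D i2 p2) r)"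
      using o h c r by (simp add: Cmp_assoc)
    also have "Cmp T D B D i2 p2 = Idn T D - Cmp T D A D i1 p1"
      using s by (simp add: algebra_simps)
    also have "Cmp T Z D Z g (Cmp T Z D D (Idn T D - Cmp T D A D i1 p1) r) =
        Cmp T Z D Z g r - Cmp T Z A Z (Cmp T A D Z g i1) (Cmp T Z D A p1 r)"
      using o h c r by (simp add: Cmp_diff_left Cmp_diff_right Cmp_Idn_left Cmp_assoc)
    also have "\<dots> = Idn T Z"
      using o h c r tri_comp_0(1)[OF t] by simp
    finally have "retract T Z B"
      unfolding retract_def using o h c r
      by (intro bexI[of _ "Cmp T Z D B p2 r"] bexI[of _ "Cmp T B D Z g i2"]) simp_all
    then have "Z \<in> S"
      using ret that c by blast
    then have "Sh T D \<in> S"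
      using cone[OF rotate[OF rotate[OF t]]] susp that by blast
    then show "D \<in> S"
      using desusp o by blast
  qed
  have sums: "\<exists>Z\<in>S. is_direct_sum T Xs Z" if "set Xs \<subseteq> S" for Xs
    using that
  proof (induction Xs)
    case Nil
    then show ?case
      using zero zero_objE is_direct_sum_Nil by metis
  next
    case (Cons X Xs)
    then obtain W where W: "W \<in> S" "is_direct_sum T Xs W" by auto
    have "set [X, W] \<subseteq> Obj T"
      using W Cons.prems SD by auto
    then obtain D where D: "is_direct_sum T [X, W] D"
      using direct_sums unfolding has_direct_sums_def by blast
    then have "D \<in> S"
      using sum2[OF _ W(1) D] Cons.prems by simp
    then show ?case
      using is_direct_sum_Cons[OF W(2) D] by blast
  qed
  have eqv: "linear_equivalence scale (full_sub T S) scale (full_sub T S) (Sh T) (ShM T)"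
    unfolding linear_equivalence_def linear_functor_def full_sub_simps
  proof (intro conjI ballI)
    fix Z assume "Z \<in> S"
    then obtain X where "X \<in> Obj T" "isomorphic T (Sh T X) Z"
      using desuspend SD by blast
    moreover from this have "X \<in> S"
      using \<open>Z \<in> S\<close> iso desusp by blast
    ultimately show "\<exists>X\<in>S. isomorphic (full_sub T S) (Sh T X) Z"
      using \<open>Z \<in> S\<close> susp unfolding isomorphic_def by auto
  qed (use SD susp in \<open>auto simp: ShM_Idn ShM_scale ShM_add ShM_Cmp ShM_bij\<close>)
  have zeroT: "is_zero T Z" if "is_zero (full_sub T S) Z" for Z
  proof -
    have "Z \<in> S" "Hom T Z Z = {0}"
      using that unfolding is_zero_def by auto
    then show ?thesis
      using SD Idn_in_Hom[of Z] by (auto simp: is_zero_iff)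
  qed
  \<comment> \<open>Cases 1 to 10 are the axioms of a linear category, cases 11 to 19 the further axioms of a
    triangulated category, in the order of the locales.\<close>
  have "triangulated_category scale (full_sub T S)"
  proof (unfold_locales, unfold full_sub_simps, goal_cases)
    case 11
    show ?case
      unfolding has_direct_sums_def full_sub_simps is_direct_sum_full_sub[OF S(1)] using sums by blast
  next
    case 12
    show ?case by (rule eqv)
  next
    case 13
    then show ?case using Tri_closed by blast
  next
    case (14 X Y Z f g h X' Y' Z' f' g' h' a b c)
    then show ?case
      using Tri_iso[of X Y Z f g h X' Y' Z' f' g' h' a b c] SD by simp
  next
    case (15 X Z)
    then have "Z \<in> S"
      unfolding is_zero_def by simp
    with 15 show ?case
      using Tri_Idn[of X Z] zeroT[of Z] SD by simp
  next
    case (16 X Y f)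
    then obtain Z g h where t: "(X, Y, Z, f, g, h) \<in> Tri T"
      using Tri_ex[of X Y f] SD by blast
    with 16 show ?case using cone[OF t] by auto
  next
    case (17 X Y Z f g h)
    then show ?case using Tri_rotate[of X Y Z f g h] SD susp by simp
  next
    case (18 X Y Z f g h X' Y' Z' f' g' h' a b)
    then show ?case using Tri_morphism[of X Y Z f g h X' Y' Z' f' g' h' a b] by simp
  next
    case (19 X Y A f a a' Z B g b b' D d d')
    then show ?case using octahedral[of X Y A f a a' Z B g b b' D d d'] by simp
  qed (use SD in \<open>simp_all add: Hom_subspace Cmp_Idn_left Cmp_Idn_right Cmp_assoc bilinear Cmp_scale_left Cmp_scale_right\<close>)
  moreover have "summand_closed T S"
    unfolding summand_closed_def
  proof (intro ballI allI impI)
    fix X Y assume "X \<in> S" and s: "is_summand T Y X"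
    then have "Y \<in> Obj T"
      unfolding is_summand_def is_direct_sum_def by auto
    then show "Y \<in> S"
      using retract_iff_summand s ret \<open>X \<in> S\<close> SD by blast
  qed
  ultimately show ?thesis
    unfolding thick_def using S by blast
qed

lemma classical_generator_thick:
  assumes "classical_generator scale T G" "thick scale T S" "G \<in> S"
  shows "S = Obj T"
  using assms unfolding classical_generator_def thick_closure_def thick_def by blast

end

context linear_category
begin

text \<open>Of a biproduct only the universal property of the product is used below.\<close>

lemma is_direct_sum_productE:
  assumes "is_direct_sum C [A, B] D"
  obtains p q where "p \<in> Hom C D A" "q \<in> Hom C D B"
    "\<And>R \<theta> \<chi>. \<lbrakk>R \<in> Obj C; \<theta> \<in> Hom C R A; \<chi> \<in> Hom C R B\<rbrakk>
      \<Longrightarrow> \<exists>\<omega> \<in> Hom C R D. Cmp C R D A p \<omega> = \<theta> \<and> Cmp C R D B q \<omega> = \<chi>"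
    "\<And>R \<omega>. \<lbrakk>R \<in> Obj C; \<omega> \<in> Hom C R D; Cmp C R D A p \<omega> = 0; Cmp C R D B q \<omega> = 0\<rbrakk> \<Longrightarrow> \<omega> = 0"
proof -
  obtain i1 i2 p1 p2 where o: "A \<in> Obj C" "B \<in> Obj C" "D \<in> Obj C"
    and h: "i1 \<in> Hom C A D" "i2 \<in> Hom C B D" "p1 \<in> Hom C D A" "p2 \<in> Hom C D B"
    and e: "Cmp C A D A p1 i1 = Idn C A" "Cmp C B D B p2 i2 = Idn C B"
      "Cmp C A D B p2 i1 = 0" "Cmp C B D A p1 i2 = 0"
    and s: "Cmp C D A D i1 p1 + Cmp C D B D i2 p2 = Idn C D"
    by (rule is_direct_sum_2E[OF assms]) blast
  show thesis
  proof (rule that[of p1 p2])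
    fix R \<theta> \<chi> assume "R \<in> Obj C" "\<theta> \<in> Hom C R A" "\<chi> \<in> Hom C R B"
    then show "\<exists>\<omega> \<in> Hom C R D. Cmp C R D A p1 \<omega> = \<theta> \<and> Cmp C R D B p2 \<omega> = \<chi>"
      using o h e
      by (intro bexI[of _ "Cmp C R A D i1 \<theta> + Cmp C R B D i2 \<chi>"])
        (simp_all add: Cmp_add_right Cmp_assoc Cmp_Idn_left)
  next
    fix R \<omega> assume R: "R \<in> Obj C" "\<omega> \<in> Hom C R D"
      and z: "Cmp C R D A p1 \<omega> = 0" "Cmp C R D B p2 \<omega> = 0"
    have "\<omega> = Cmp C R D D (Cmp C D A D i1 p1 + Cmp C D B D i2 p2) \<omega>"
      using o R by (simp add: s Cmp_Idn_left)
    also have "\<dots> = Cmp C R A D i1 (Cmp C R D A p1 \<omega>) + Cmp C R B D i2 (Cmp C R D B p2 \<omega>)"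
      using o h R by (simp add: Cmp_add_left Cmp_assoc)
    also have "\<dots> = 0"
      using o h R z by simp
    finally show "\<omega> = 0" .
  qed (use h in auto)
qed

end

section \<open>Coherent objects over a semihereditary class\<close>

text \<open>
  The following notions are relative to a class \<open>P\<close> of objects. They say that \<open>m\<close> is injective, that
  \<open>g\<close> is surjective, and that \<open>\<kappa>\<close> maps onto the kernel of \<open>w\<close>, after applying the functor
  represented by \<open>R\<close>, for each \<open>R \<in> P\<close>. The source of \<open>g\<close> and of \<open>\<kappa>\<close> is required to lie in \<open>P\<close>.
\<close>

definition rel_mono :: "('o, 'm::zero, 'x) cat_scheme \<Rightarrow> 'o set \<Rightarrow> 'o \<Rightarrow> 'o \<Rightarrow> 'm \<Rightarrow> bool" where
  "rel_mono C P X Y m \<longleftrightarrow> m \<in> Hom C X Y \<and>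
     (\<forall>R \<in> P. \<forall>\<phi> \<in> Hom C R X. Cmp C R X Y m \<phi> = 0 \<longrightarrow> \<phi> = 0)"

definition rel_cover :: "('o, 'm, 'x) cat_scheme \<Rightarrow> 'o set \<Rightarrow> 'o \<Rightarrow> 'o \<Rightarrow> 'm \<Rightarrow> bool" where
  "rel_cover C P A M g \<longleftrightarrow> A \<in> P \<and> g \<in> Hom C A M \<and>
     (\<forall>R \<in> P. \<forall>\<phi> \<in> Hom C R M. \<exists>\<psi> \<in> Hom C R A. \<phi> = Cmp C R A M g \<psi>)"

definition kernel_cover ::
  "('o, 'm::zero, 'x) cat_scheme \<Rightarrow> 'o set \<Rightarrow> 'o \<Rightarrow> 'o \<Rightarrow> 'o \<Rightarrow> 'm \<Rightarrow> 'm \<Rightarrow> bool" where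
  "kernel_cover C P K A M \<kappa> w \<longleftrightarrow> K \<in> P \<and> \<kappa> \<in> Hom C K A \<and> Cmp C K A M w \<kappa> = 0 \<and>
     (\<forall>R \<in> P. \<forall>\<phi> \<in> Hom C R A. Cmp C R A M w \<phi> = 0 \<longrightarrow> (\<exists>\<psi> \<in> Hom C R K. \<phi> = Cmp C R K A \<kappa> \<psi>))"

text \<open>
  \<open>M\<close> is coherent if the contravariant functor \<open>Hom (-, M)\<close> on \<open>P\<close> is a coherent module: it is a
  quotient of a representable functor, and so is the kernel of each morphism to it from a
  representable functor. When \<open>P\<close> has finite direct sums, quotients of representable functors are the
  same as finitely generated modules.
\<close>

definition coherent_obj :: "('o, 'm::zero, 'x) cat_scheme \<Rightarrow> 'o set \<Rightarrow> 'o \<Rightarrow> bool" where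
  "coherent_obj C P M \<longleftrightarrow> M \<in> Obj C \<and> (\<exists>A g. rel_cover C P A M g) \<and>
     (\<forall>A \<in> P. \<forall>w \<in> Hom C A M. \<exists>K \<kappa>. kernel_cover C P K A M \<kappa> w)"

text \<open>
  The last axiom is the analogue of the fact that finitely generated submodules of projective modules
  over a semihereditary ring are projective: the image of \<open>f\<close> on \<open>P\<close> is represented by an object
  \<open>I\<close> of \<open>P\<close>, because \<open>m\<close> is injective on \<open>P\<close>, and \<open>m\<close> and \<open>f\<close> factor through one another.
\<close>

locale semihereditary_class = triangulated_category scale T
  for scale :: "'k::field \<Rightarrow> 'm::ab_group_add \<Rightarrow> 'm" and T :: "('o, 'm, 'x) tricat_scheme" +
  fixes P :: "'o set"
  assumes P_Obj [simp]: "A \<in> P \<Longrightarrow> A \<in> Obj T"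
    and P_retract: "\<lbrakk>Y \<in> P; X \<in> Obj T; retract T X Y\<rbrakk> \<Longrightarrow> X \<in> P"
    and P_Sh: "X \<in> Obj T \<Longrightarrow> Sh T X \<in> P \<longleftrightarrow> X \<in> P"
    and P_sum: "\<lbrakk>A \<in> P; B \<in> P\<rbrakk> \<Longrightarrow> \<exists>D \<in> P. is_direct_sum T [A, B] D"
    and P_image: "\<lbrakk>A \<in> P; B \<in> P; f \<in> Hom T A B\<rbrakk> \<Longrightarrow> \<exists>I \<in> P. \<exists>m e s. rel_mono T P I B m \<and>
      e \<in> Hom T A I \<and> s \<in> Hom T I A \<and> f = Cmp T A I B m e \<and> m = Cmp T I A B f s"
begin

lemma P_productE:
  assumes "A \<in> P" "B \<in> P"
  obtains D p q where "D \<in> P" "p \<in> Hom T D A" "q \<in> Hom T D B"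
    "\<And>R \<theta> \<chi>. \<lbrakk>R \<in> Obj T; \<theta> \<in> Hom T R A; \<chi> \<in> Hom T R B\<rbrakk>
      \<Longrightarrow> \<exists>\<omega> \<in> Hom T R D. Cmp T R D A p \<omega> = \<theta> \<and> Cmp T R D B q \<omega> = \<chi>"
proof -
  obtain D where D: "D \<in> P" "is_direct_sum T [A, B] D"
    using P_sum assms by blast
  show thesis
    using that[OF D(1)] by (rule is_direct_sum_productE[OF D(2)])
qed

lemma P_desuspendE:
  assumes "R \<in> P"
  obtains R' u v where "R' \<in> P" "u \<in> Hom T R (Sh T R')" "v \<in> Hom T (Sh T R') R"
    "Cmp T R (Sh T R') R v u = Idn T R"
proof -
  obtain R' u v where R': "R' \<in> Obj T" "u \<in> Hom T R (Sh T R')" "v \<in> Hom T (Sh T R') R"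
    "Cmp T R (Sh T R') R v u = Idn T R" "isomorphic T (Sh T R') R"
    by (rule desuspendE[OF P_Obj[OF assms]]) blast
  moreover have "R' \<in> P"
    using R' P_retract[OF assms _ isomorphic_retract] P_Sh Sh_Obj by blast
  ultimately show thesis using that by blast
qed

lemma kernel_cover_P:
  assumes "A \<in> P" "B \<in> P" "f \<in> Hom T A B"
  shows "\<exists>K \<kappa>. kernel_cover T P K A B \<kappa> f"
proof -
  obtain I m e s where I: "I \<in> P" and m: "rel_mono T P I B m"
    and h: "e \<in> Hom T A I" "s \<in> Hom T I A"
    and f: "f = Cmp T A I B m e" and ms: "m = Cmp T I A B f s"
    using P_image[OF assms] by blast
  have mh: "m \<in> Hom T I B"
    using m unfolding rel_mono_def by blast
  \<comment> \<open>As \<open>m\<close> is injective, \<open>e s\<close> is the identity, and \<open>1 - s e\<close> projects onto the kernel of \<open>e\<close>.\<close>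
  let ?k = "Idn T A - Cmp T A I A s e"
  have "Cmp T A A B f ?k = f - Cmp T A I B (Cmp T I A B f s) e"
    using assms I h by (simp add: Cmp_diff_right Cmp_Idn_right Cmp_assoc)
  then have 1: "Cmp T A A B f ?k = 0"
    by (simp flip: ms f)
  have 2: "\<phi> = Cmp T R A A ?k \<phi>"
    if "R \<in> P" "\<phi> \<in> Hom T R A" "Cmp T R A B f \<phi> = 0" for R \<phi>
  proof -
    have "Cmp T R I B m (Cmp T R A I e \<phi>) = Cmp T R A B (Cmp T A I B m e) \<phi>"
      using that assms I h mh by (simp add: Cmp_assoc)
    then have "Cmp T R I B m (Cmp T R A I e \<phi>) = 0"
      using that(3) by (simp flip: f)
    then have "Cmp T R A I e \<phi> = 0"
      using m that(1,2) assms I h unfolding rel_mono_def by simp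
    then have "Cmp T R A A (Cmp T A I A s e) \<phi> = 0"
      using that assms I h by (simp flip: Cmp_assoc)
    then show ?thesis
      using that assms I h by (simp add: Cmp_diff_left Cmp_Idn_left)
  qed
  have "kernel_cover T P A A B ?k f"
    unfolding kernel_cover_def using 1 2 assms I h by auto
  then show ?thesis by blast
qed

lemma coherent_P:
  assumes "A \<in> P"
  shows "coherent_obj T P A"
proof -
  have "rel_cover T P A A (Idn T A)"
    unfolding rel_cover_def using assms by (auto simp: Cmp_Idn_left)
  then show ?thesis
    unfolding coherent_obj_def using assms kernel_cover_P by auto
qed

lemma coherent_retract:
  assumes N: "coherent_obj T P N" and M: "M \<in> Obj T" "retract T M N"
  shows "coherent_obj T P M"
proof -
  obtain i p where h: "i \<in> Hom T M N" "p \<in> Hom T N M" and pi: "Cmp T M N M p i = Idn T M"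
    using M(2) unfolding retract_def by blast
  have No: "N \<in> Obj T"
    using N unfolding coherent_obj_def by blast
  obtain A g where A: "A \<in> P" and g: "g \<in> Hom T A N"
    and cov: "\<And>R \<phi>. \<lbrakk>R \<in> P; \<phi> \<in> Hom T R N\<rbrakk> \<Longrightarrow> \<exists>\<psi> \<in> Hom T R A. \<phi> = Cmp T R A N g \<psi>"
    using N unfolding coherent_obj_def rel_cover_def by blast
  have rec: "Cmp T R N M p (Cmp T R M N i \<phi>) = \<phi>" if "R \<in> P" "\<phi> \<in> Hom T R M" for R \<phi>
    using that M h No pi by (simp add: Cmp_assoc Cmp_Idn_left)
  have "rel_cover T P A M (Cmp T A N M p g)"
    unfolding rel_cover_def
  proof (intro conjI ballI)
    fix R \<phi> assume R: "R \<in> P" "\<phi> \<in> Hom T R M"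
    then obtain \<psi> where "\<psi> \<in> Hom T R A" "Cmp T R M N i \<phi> = Cmp T R A N g \<psi>"
      using cov[of R "Cmp T R M N i \<phi>"] M h No by auto
    then show "\<exists>\<psi>\<in>Hom T R A. \<phi> = Cmp T R A M (Cmp T A N M p g) \<psi>"
      using rec[OF R] A g M h No R by (intro bexI[of _ \<psi>]) (simp_all flip: Cmp_assoc)
  qed (use A g M h No in simp_all)
  moreover have "\<exists>K \<kappa>. kernel_cover T P K A M \<kappa> w" if A: "A \<in> P" "w \<in> Hom T A M" for A w
  proof -
    obtain K \<kappa> where K: "kernel_cover T P K A N \<kappa> (Cmp T A M N i w)"
      using N A M h No unfolding coherent_obj_def by (meson P_Obj Cmp_in_Hom)
    have iff: "Cmp T R A N (Cmp T A M N i w) \<phi> = 0 \<longleftrightarrow> Cmp T R A M w \<phi> = 0"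
      if "R \<in> P" "\<phi> \<in> Hom T R A" for R \<phi>
    proof
      assume "Cmp T R A N (Cmp T A M N i w) \<phi> = 0"
      then have "Cmp T R M N i (Cmp T R A M w \<phi>) = 0"
        using that A M h No by (simp add: Cmp_assoc)
      then show "Cmp T R A M w \<phi> = 0"
        using rec[of R "Cmp T R A M w \<phi>"] that A M h No by simp
    qed (use that A M h No in \<open>simp flip: Cmp_assoc\<close>)
    have "kernel_cover T P K A M \<kappa> w"
      using K iff unfolding kernel_cover_def by auto
    then show ?thesis by blast
  qed
  ultimately show ?thesis
    unfolding coherent_obj_def using M by blast
qed

end

context semihereditary_class
begin

lemma coherent_Obj: "coherent_obj T P M \<Longrightarrow> M \<in> Obj T"
  unfolding coherent_obj_def by blast

lemma coherent_coverE:
  assumes "coherent_obj T P M"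
  obtains A g where "A \<in> P" "g \<in> Hom T A M"
    "\<And>R \<phi>. \<lbrakk>R \<in> P; \<phi> \<in> Hom T R M\<rbrakk> \<Longrightarrow> \<exists>\<psi> \<in> Hom T R A. \<phi> = Cmp T R A M g \<psi>"
  using assms unfolding coherent_obj_def rel_cover_def by blast

lemma coherent_kernelE:
  assumes "coherent_obj T P M" "A \<in> P" "w \<in> Hom T A M"
  obtains K \<kappa> where "K \<in> P" "\<kappa> \<in> Hom T K A" "Cmp T K A M w \<kappa> = 0"
    "\<And>R \<phi>. \<lbrakk>R \<in> P; \<phi> \<in> Hom T R A; Cmp T R A M w \<phi> = 0\<rbrakk> \<Longrightarrow> \<exists>\<psi> \<in> Hom T R K. \<phi> = Cmp T R K A \<kappa> \<psi>"
  using assms unfolding coherent_obj_def kernel_cover_def by blast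

lemma coherentI:
  assumes "M \<in> Obj T" "A \<in> P" "g \<in> Hom T A M"
    and "\<And>R \<phi>. \<lbrakk>R \<in> P; \<phi> \<in> Hom T R M\<rbrakk> \<Longrightarrow> \<exists>\<psi> \<in> Hom T R A. \<phi> = Cmp T R A M g \<psi>"
    and "\<And>B w. \<lbrakk>B \<in> P; w \<in> Hom T B M\<rbrakk> \<Longrightarrow> \<exists>K \<in> P. \<exists>\<kappa> \<in> Hom T K B. Cmp T K B M w \<kappa> = 0 \<and>
      (\<forall>R \<in> P. \<forall>\<phi> \<in> Hom T R B. Cmp T R B M w \<phi> = 0 \<longrightarrow> (\<exists>\<psi> \<in> Hom T R K. \<phi> = Cmp T R K B \<kappa> \<psi>))"
  shows "coherent_obj T P M"
  using assms unfolding coherent_obj_def kernel_cover_def rel_cover_def by blast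

lemma coherent_Sh:
  assumes M: "coherent_obj T P M"
  shows "coherent_obj T P (Sh T M)"
proof -
  note Mo = coherent_Obj[OF M]
  obtain A g where A: "A \<in> P" "g \<in> Hom T A M"
    and cov: "\<And>R \<phi>. \<lbrakk>R \<in> P; \<phi> \<in> Hom T R M\<rbrakk> \<Longrightarrow> \<exists>\<psi> \<in> Hom T R A. \<phi> = Cmp T R A M g \<psi>"
    by (rule coherent_coverE[OF M]) blast
  show ?thesis
  proof (rule coherentI)
    show "Sh T A \<in> P" using A P_Sh by simp
    show "ShM T A M g \<in> Hom T (Sh T A) (Sh T M)" using A Mo by simp
    fix R \<phi> assume R: "R \<in> P" "\<phi> \<in> Hom T R (Sh T M)"
    obtain R' u v where R': "R' \<in> P" "u \<in> Hom T R (Sh T R')" "v \<in> Hom T (Sh T R') R"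
      and vu: "Cmp T R (Sh T R') R v u = Idn T R"
      by (rule P_desuspendE[OF R(1)]) blast
    obtain \<phi>' where p: "\<phi>' \<in> Hom T R' M" "Cmp T (Sh T R') R (Sh T M) \<phi> v = ShM T R' M \<phi>'"
      using ShM_fullE[of R' M "Cmp T (Sh T R') R (Sh T M) \<phi> v"] R R' Mo by auto
    obtain \<psi> where q: "\<psi> \<in> Hom T R' A" "\<phi>' = Cmp T R' A M g \<psi>"
      using cov[OF R'(1) p(1)] by blast
    have "\<phi> = Cmp T R R (Sh T M) \<phi> (Cmp T R (Sh T R') R v u)"
      using R Mo by (simp add: vu Cmp_Idn_right)
    also have "\<dots> = Cmp T R (Sh T R') (Sh T M) (ShM T R' M \<phi>') u"
      using R R' Mo by (simp add: Cmp_assoc p)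
    also have "\<dots> = Cmp T R (Sh T A) (Sh T M) (ShM T A M g) (Cmp T R (Sh T R') (Sh T A) (ShM T R' A \<psi>) u)"
      using R R' Mo A q by (simp add: ShM_Cmp Cmp_assoc)
    finally show "\<exists>\<psi>\<in>Hom T R (Sh T A). \<phi> = Cmp T R (Sh T A) (Sh T M) (ShM T A M g) \<psi>"
      using R R' A q by (intro bexI[of _ "Cmp T R (Sh T R') (Sh T A) (ShM T R' A \<psi>) u"]) simp_all
  next
    fix B w assume B: "B \<in> P" "w \<in> Hom T B (Sh T M)"
    obtain B' u v where B': "B' \<in> P" "u \<in> Hom T B (Sh T B')" "v \<in> Hom T (Sh T B') B"
      and vu: "Cmp T B (Sh T B') B v u = Idn T B"
      by (rule P_desuspendE[OF B(1)]) blast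
    obtain w' where w': "w' \<in> Hom T B' M" "Cmp T (Sh T B') B (Sh T M) w v = ShM T B' M w'"
      using ShM_fullE[of B' M "Cmp T (Sh T B') B (Sh T M) w v"] B B' Mo by auto
    obtain K \<kappa> where K: "K \<in> P" "\<kappa> \<in> Hom T K B'" "Cmp T K B' M w' \<kappa> = 0"
      and ker: "\<And>R \<phi>. \<lbrakk>R \<in> P; \<phi> \<in> Hom T R B'; Cmp T R B' M w' \<phi> = 0\<rbrakk>
        \<Longrightarrow> \<exists>\<psi> \<in> Hom T R K. \<phi> = Cmp T R K B' \<kappa> \<psi>"
      by (rule coherent_kernelE[OF M B'(1) w'(1)]) blast
    let ?k = "Cmp T (Sh T K) (Sh T B') B v (ShM T K B' \<kappa>)"
    show "\<exists>K\<in>P. \<exists>\<kappa>\<in>Hom T K B. Cmp T K B (Sh T M) w \<kappa> = 0 \<and>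
      (\<forall>R\<in>P. \<forall>\<phi>\<in>Hom T R B. Cmp T R B (Sh T M) w \<phi> = 0 \<longrightarrow> (\<exists>\<psi>\<in>Hom T R K. \<phi> = Cmp T R K B \<kappa> \<psi>))"
    proof (rule bexI[of _ "Sh T K"], rule bexI[of _ ?k], intro conjI ballI impI)
      show "Sh T K \<in> P" using K P_Sh by simp
      show "?k \<in> Hom T (Sh T K) B" using K B B' by simp
      have "Cmp T (Sh T K) B (Sh T M) w ?k =
          Cmp T (Sh T K) (Sh T B') (Sh T M) (Cmp T (Sh T B') B (Sh T M) w v) (ShM T K B' \<kappa>)"
        using K(1,2) B B' Mo by (simp add: Cmp_assoc)
      also have "\<dots> = ShM T K M (Cmp T K B' M w' \<kappa>)"
        unfolding w'(2) using K(1,2) B' Mo w'(1) by (simp add: ShM_Cmp)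
      also have "\<dots> = 0"
        unfolding K(3) using K Mo by simp
      finally show "Cmp T (Sh T K) B (Sh T M) w ?k = 0" .
      fix R \<phi> assume R: "R \<in> P" "\<phi> \<in> Hom T R B" and z: "Cmp T R B (Sh T M) w \<phi> = 0"
      obtain R' r q where R': "R' \<in> P" "r \<in> Hom T R (Sh T R')" "q \<in> Hom T (Sh T R') R"
        and qr: "Cmp T R (Sh T R') R q r = Idn T R"
        by (rule P_desuspendE[OF R(1)]) blast
      let ?f = "Cmp T (Sh T R') R (Sh T B') (Cmp T R B (Sh T B') u \<phi>) q"
      obtain \<phi>' where p: "\<phi>' \<in> Hom T R' B'" "?f = ShM T R' B' \<phi>'"
        using ShM_fullE[of R' B' ?f] R R' B B' by auto
      have vf: "Cmp T (Sh T R') (Sh T B') B v ?f = Cmp T (Sh T R') R B \<phi> q"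
        using R R' B B' by (simp add: Cmp_assoc vu Cmp_Idn_left)
      have "ShM T R' M (Cmp T R' B' M w' \<phi>') =
          Cmp T (Sh T R') (Sh T B') (Sh T M) (Cmp T (Sh T B') B (Sh T M) w v) ?f"
        using R' B' w' p Mo by (simp add: ShM_Cmp)
      also have "\<dots> = Cmp T (Sh T R') B (Sh T M) w (Cmp T (Sh T R') (Sh T B') B v ?f)"
        using R R' B B' Mo by (simp add: Cmp_assoc)
      also have "\<dots> = Cmp T (Sh T R') R (Sh T M) (Cmp T R B (Sh T M) w \<phi>) q"
        unfolding vf using R R' B Mo by (simp add: Cmp_assoc)
      also have "\<dots> = 0"
        unfolding z using R R' Mo by simp
      finally have "Cmp T R' B' M w' \<phi>' = 0"
        using R' B' w' p Mo by (simp add: ShM_eq_0_iff)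
      then obtain \<psi> where psi: "\<psi> \<in> Hom T R' K" "\<phi>' = Cmp T R' K B' \<kappa> \<psi>"
        using ker[OF R'(1) p(1)] by blast
      have "\<phi> = Cmp T R R B \<phi> (Cmp T R (Sh T R') R q r)"
        using R B by (simp add: qr Cmp_Idn_right)
      also have "\<dots> = Cmp T R (Sh T R') B (Cmp T (Sh T R') (Sh T B') B v ?f) r"
        unfolding vf using R R' B by (simp add: Cmp_assoc)
      also have "\<dots> = Cmp T R (Sh T K) B ?k (Cmp T R (Sh T R') (Sh T K) (ShM T R' K \<psi>) r)"
        unfolding p(2) psi(2) using R R' B B' K psi(1) by (simp add: Cmp_assoc ShM_Cmp)
      finally show "\<exists>\<psi>\<in>Hom T R (Sh T K). \<phi> = Cmp T R (Sh T K) B ?k \<psi>"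
        using R R' K psi(1) by (intro bexI[of _ "Cmp T R (Sh T R') (Sh T K) (ShM T R' K \<psi>) r"]) simp_all
    qed
  qed (use Mo in simp)
qed

lemma coherent_desuspend:
  assumes M: "coherent_obj T P (Sh T M)" and Mo: "M \<in> Obj T"
  shows "coherent_obj T P M"
proof -
  obtain A g where A: "A \<in> P" "g \<in> Hom T A (Sh T M)"
    and cov: "\<And>R \<phi>. \<lbrakk>R \<in> P; \<phi> \<in> Hom T R (Sh T M)\<rbrakk> \<Longrightarrow> \<exists>\<psi> \<in> Hom T R A. \<phi> = Cmp T R A (Sh T M) g \<psi>"
    by (rule coherent_coverE[OF M]) blast
  obtain A' u v where A': "A' \<in> P" "u \<in> Hom T A (Sh T A')" "v \<in> Hom T (Sh T A') A"
    and vu: "Cmp T A (Sh T A') A v u = Idn T A"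
    by (rule P_desuspendE[OF A(1)]) blast
  obtain g' where g': "g' \<in> Hom T A' M" "Cmp T (Sh T A') A (Sh T M) g v = ShM T A' M g'"
    using ShM_fullE[of A' M "Cmp T (Sh T A') A (Sh T M) g v"] A A' Mo by auto
  show ?thesis
  proof (rule coherentI[OF Mo A'(1) g'(1)])
    fix R \<phi> assume R: "R \<in> P" "\<phi> \<in> Hom T R M"
    obtain \<psi> where q: "\<psi> \<in> Hom T (Sh T R) A" "ShM T R M \<phi> = Cmp T (Sh T R) A (Sh T M) g \<psi>"
      using cov[of "Sh T R" "ShM T R M \<phi>"] R Mo P_Sh by auto
    obtain \<psi>' where p: "\<psi>' \<in> Hom T R A'" "Cmp T (Sh T R) A (Sh T A') u \<psi> = ShM T R A' \<psi>'"
      using ShM_fullE[of R A' "Cmp T (Sh T R) A (Sh T A') u \<psi>"] R A A' q by auto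
    have "ShM T R M (Cmp T R A' M g' \<psi>') = Cmp T (Sh T R) (Sh T A') (Sh T M)
        (Cmp T (Sh T A') A (Sh T M) g v) (Cmp T (Sh T R) A (Sh T A') u \<psi>)"
      using R A' g' p Mo by (simp add: ShM_Cmp)
    also have "\<dots> = Cmp T (Sh T R) A (Sh T M) g (Cmp T (Sh T R) A A (Cmp T A (Sh T A') A v u) \<psi>)"
      using R A A' q(1) Mo by (simp add: Cmp_assoc)
    also have "\<dots> = ShM T R M \<phi>"
      unfolding vu using R A q by (simp add: Cmp_Idn_left)
    finally have "\<phi> = Cmp T R A' M g' \<psi>'"
      using R A' g' p Mo by (simp add: ShM_eq_iff)
    then show "\<exists>\<psi>\<in>Hom T R A'. \<phi> = Cmp T R A' M g' \<psi>"
      using p by blast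
  next
    fix B w assume B: "B \<in> P" "w \<in> Hom T B M"
    have "Sh T B \<in> P" "ShM T B M w \<in> Hom T (Sh T B) (Sh T M)"
      using B Mo P_Sh by simp_all
    then obtain K \<kappa> where K: "K \<in> P" "\<kappa> \<in> Hom T K (Sh T B)"
        "Cmp T K (Sh T B) (Sh T M) (ShM T B M w) \<kappa> = 0"
      and ker: "\<And>R \<phi>. \<lbrakk>R \<in> P; \<phi> \<in> Hom T R (Sh T B);
          Cmp T R (Sh T B) (Sh T M) (ShM T B M w) \<phi> = 0\<rbrakk> \<Longrightarrow> \<exists>\<psi> \<in> Hom T R K. \<phi> = Cmp T R K (Sh T B) \<kappa> \<psi>"
      by (rule coherent_kernelE[OF M]) blast
    obtain K' u v where K': "K' \<in> P" "u \<in> Hom T K (Sh T K')" "v \<in> Hom T (Sh T K') K"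
      and vu: "Cmp T K (Sh T K') K v u = Idn T K"
      by (rule P_desuspendE[OF K(1)]) blast
    obtain \<kappa>' where k: "\<kappa>' \<in> Hom T K' B" "Cmp T (Sh T K') K (Sh T B) \<kappa> v = ShM T K' B \<kappa>'"
      using ShM_fullE[of K' B "Cmp T (Sh T K') K (Sh T B) \<kappa> v"] K K' B by auto
    show "\<exists>K\<in>P. \<exists>\<kappa>\<in>Hom T K B. Cmp T K B M w \<kappa> = 0 \<and>
      (\<forall>R\<in>P. \<forall>\<phi>\<in>Hom T R B. Cmp T R B M w \<phi> = 0 \<longrightarrow> (\<exists>\<psi>\<in>Hom T R K. \<phi> = Cmp T R K B \<kappa> \<psi>))"
    proof (rule bexI[OF _ K'(1)], rule bexI[OF _ k(1)], intro conjI ballI impI)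
      have "ShM T K' M (Cmp T K' B M w \<kappa>') =
          Cmp T (Sh T K') (Sh T B) (Sh T M) (ShM T B M w) (Cmp T (Sh T K') K (Sh T B) \<kappa> v)"
        using K' B k Mo by (simp add: ShM_Cmp)
      also have "\<dots> = Cmp T (Sh T K') K (Sh T M) (Cmp T K (Sh T B) (Sh T M) (ShM T B M w) \<kappa>) v"
        using K(1,2) K' B Mo by (simp add: Cmp_assoc)
      also have "\<dots> = 0"
        unfolding K(3) using K K' Mo by simp
      finally show "Cmp T K' B M w \<kappa>' = 0"
        using K' B k Mo by (simp add: ShM_eq_0_iff)
      fix R \<phi> assume R: "R \<in> P" "\<phi> \<in> Hom T R B" and z: "Cmp T R B M w \<phi> = 0"
      have "Cmp T (Sh T R) (Sh T B) (Sh T M) (ShM T B M w) (ShM T R B \<phi>) = 0"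
        using R B Mo z by (simp flip: ShM_Cmp)
      then obtain \<psi> where q: "\<psi> \<in> Hom T (Sh T R) K" "ShM T R B \<phi> = Cmp T (Sh T R) K (Sh T B) \<kappa> \<psi>"
        using ker[of "Sh T R" "ShM T R B \<phi>"] R B P_Sh by auto
      obtain \<psi>' where p: "\<psi>' \<in> Hom T R K'" "Cmp T (Sh T R) K (Sh T K') u \<psi> = ShM T R K' \<psi>'"
        using ShM_fullE[of R K' "Cmp T (Sh T R) K (Sh T K') u \<psi>"] R K K' q by auto
      have "ShM T R B (Cmp T R K' B \<kappa>' \<psi>') = Cmp T (Sh T R) (Sh T K') (Sh T B)
          (Cmp T (Sh T K') K (Sh T B) \<kappa> v) (Cmp T (Sh T R) K (Sh T K') u \<psi>)"
        using R K' k p B by (simp add: ShM_Cmp)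
      also have "\<dots> = Cmp T (Sh T R) K (Sh T B) \<kappa> (Cmp T (Sh T R) K K (Cmp T K (Sh T K') K v u) \<psi>)"
        using R K(1,2) K' q(1) B by (simp add: Cmp_assoc)
      also have "\<dots> = ShM T R B \<phi>"
        unfolding vu using R K q by (simp add: Cmp_Idn_left)
      finally have "\<phi> = Cmp T R K' B \<kappa>' \<psi>'"
        using R K' k p B by (simp add: ShM_eq_iff)
      then show "\<exists>\<psi>\<in>Hom T R K'. \<phi> = Cmp T R K' B \<kappa>' \<psi>"
        using p by blast
    qed
  qed
qed

text \<open>
  On \<open>P\<close>, the functor of \<open>Z\<close> is an extension of the kernel of \<open>Sh X \<rightarrow> Sh Y\<close> by the cokernel of
  \<open>X \<rightarrow> Y\<close>. Kernels, cokernels and extensions of coherent modules are coherent; the proof chases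
  elements through this extension.
\<close>

lemma coherent_cone:
  assumes t: "(X, Y, Z, a, b, c) \<in> Tri T" and X: "coherent_obj T P X" and Y: "coherent_obj T P Y"
  shows "coherent_obj T P Z"
proof -
  note o = Tri_closed[OF t]
  note t0 = tri_comp_0[OF t]
  obtain A gx where A: "A \<in> P" "gx \<in> Hom T A (Sh T X)"
    and cx: "\<And>R \<phi>. \<lbrakk>R \<in> P; \<phi> \<in> Hom T R (Sh T X)\<rbrakk> \<Longrightarrow> \<exists>\<psi> \<in> Hom T R A. \<phi> = Cmp T R A (Sh T X) gx \<psi>"
    by (rule coherent_coverE[OF coherent_Sh[OF X]]) blast
  have "Cmp T A (Sh T X) (Sh T Y) (ShM T X Y a) gx \<in> Hom T A (Sh T Y)"
    using A o by simp
  then obtain K \<kappa> where K: "K \<in> P" "\<kappa> \<in> Hom T K A"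
      "Cmp T K A (Sh T Y) (Cmp T A (Sh T X) (Sh T Y) (ShM T X Y a) gx) \<kappa> = 0"
    and ker: "\<And>R \<phi>. \<lbrakk>R \<in> P; \<phi> \<in> Hom T R A;
        Cmp T R A (Sh T Y) (Cmp T A (Sh T X) (Sh T Y) (ShM T X Y a) gx) \<phi> = 0\<rbrakk>
      \<Longrightarrow> \<exists>\<psi> \<in> Hom T R K. \<phi> = Cmp T R K A \<kappa> \<psi>"
    by (rule coherent_kernelE[OF coherent_Sh[OF Y] A(1)]) blast
  let ?x = "Cmp T K A (Sh T X) gx \<kappa>"
  have "?x \<in> Hom T K (Sh T X)" "Cmp T K (Sh T X) (Sh T Y) (ShM T X Y a) ?x = 0"
    using A K o by (simp_all add: Cmp_assoc)
  then obtain z where z: "z \<in> Hom T K Z" "?x = Cmp T K Z (Sh T X) c z"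
    using tri_exact(3)[OF t P_Obj[OF K(1)]] by blast
  obtain B gy where B: "B \<in> P" "gy \<in> Hom T B Y"
    and cy: "\<And>R \<phi>. \<lbrakk>R \<in> P; \<phi> \<in> Hom T R Y\<rbrakk> \<Longrightarrow> \<exists>\<psi> \<in> Hom T R B. \<phi> = Cmp T R B Y gy \<psi>"
    by (rule coherent_coverE[OF Y]) blast
  obtain D p q where D: "D \<in> P" "p \<in> Hom T D B" "q \<in> Hom T D K"
    and pair: "\<And>R \<theta> \<chi>. \<lbrakk>R \<in> Obj T; \<theta> \<in> Hom T R B; \<chi> \<in> Hom T R K\<rbrakk>
      \<Longrightarrow> \<exists>\<omega> \<in> Hom T R D. Cmp T R D B p \<omega> = \<theta> \<and> Cmp T R D K q \<omega> = \<chi>"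
    by (rule P_productE[OF B(1) K(1)]) blast
  \<comment> \<open>\<open>K\<close> covers the kernel of \<open>Sh X \<rightarrow> Sh Y\<close> and \<open>B\<close> covers \<open>Y\<close>; together they cover \<open>Z\<close>.\<close>
  let ?G = "Cmp T D Y Z b (Cmp T D B Y gy p) + Cmp T D K Z z q"
  show ?thesis
  proof (rule coherentI)
    show "Z \<in> Obj T" "D \<in> P" "?G \<in> Hom T D Z"
      using o D B z K by simp_all
    fix R \<phi> assume R: "R \<in> P" "\<phi> \<in> Hom T R Z"
    have cp: "Cmp T R Z (Sh T X) c \<phi> \<in> Hom T R (Sh T X)"
      using R o by simp
    then obtain \<psi> where psi: "\<psi> \<in> Hom T R A" "Cmp T R Z (Sh T X) c \<phi> = Cmp T R A (Sh T X) gx \<psi>"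
      using cx[OF R(1)] by blast
    have "Cmp T R A (Sh T Y) (Cmp T A (Sh T X) (Sh T Y) (ShM T X Y a) gx) \<psi> =
        Cmp T R (Sh T X) (Sh T Y) (ShM T X Y a) (Cmp T R A (Sh T X) gx \<psi>)"
      using R A o psi(1) by (simp add: Cmp_assoc)
    also have "\<dots> = Cmp T R Z (Sh T Y) (Cmp T Z (Sh T X) (Sh T Y) (ShM T X Y a) c) \<phi>"
      unfolding psi(2)[symmetric] using R o by (simp add: Cmp_assoc)
    also have "\<dots> = 0"
      unfolding t0 using R o by simp
    finally obtain \<chi> where chi: "\<chi> \<in> Hom T R K" "\<psi> = Cmp T R K A \<kappa> \<chi>"
      using ker[OF R(1) psi(1)] by blast
    have "Cmp T R Z (Sh T X) c (\<phi> - Cmp T R K Z z \<chi>) =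
        Cmp T R Z (Sh T X) c \<phi> - Cmp T R K (Sh T X) (Cmp T K Z (Sh T X) c z) \<chi>"
      using R o K z(1) chi by (simp add: Cmp_diff_right Cmp_assoc)
    also have "\<dots> = 0"
      unfolding z(2)[symmetric] psi(2) chi(2) using R A K chi(1) o by (simp add: Cmp_assoc)
    finally obtain \<eta> where eta: "\<eta> \<in> Hom T R Y" "\<phi> - Cmp T R K Z z \<chi> = Cmp T R Y Z b \<eta>"
      using tri_exact(2)[OF t, of R "\<phi> - Cmp T R K Z z \<chi>"] R o K z chi by auto
    obtain \<theta> where theta: "\<theta> \<in> Hom T R B" "\<eta> = Cmp T R B Y gy \<theta>"
      using cy[OF R(1) eta(1)] by blast
    obtain \<omega> where om: "\<omega> \<in> Hom T R D" "Cmp T R D B p \<omega> = \<theta>" "Cmp T R D K q \<omega> = \<chi>"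
      using pair[of R \<theta> \<chi>] R theta chi by auto
    have "Cmp T R D Z ?G \<omega> = Cmp T R Y Z b (Cmp T R B Y gy (Cmp T R D B p \<omega>)) + Cmp T R K Z z (Cmp T R D K q \<omega>)"
      using R o D B K z(1) om(1) by (simp add: Cmp_add_left Cmp_assoc)
    also have "\<dots> = \<phi>"
      unfolding om(2,3) theta(2)[symmetric] eta(2)[symmetric] by simp
    finally show "\<exists>\<psi>\<in>Hom T R D. \<phi> = Cmp T R D Z ?G \<psi>"
      using om(1) by blast
  next
    fix A w assume A: "A \<in> P" "w \<in> Hom T A Z"
    have "Cmp T A Z (Sh T X) c w \<in> Hom T A (Sh T X)"
      using A o by simp
    then obtain K k where K: "K \<in> P" "k \<in> Hom T K A"
        "Cmp T K A (Sh T X) (Cmp T A Z (Sh T X) c w) k = 0"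
      and ker: "\<And>R \<phi>. \<lbrakk>R \<in> P; \<phi> \<in> Hom T R A;
          Cmp T R A (Sh T X) (Cmp T A Z (Sh T X) c w) \<phi> = 0\<rbrakk>
        \<Longrightarrow> \<exists>\<psi> \<in> Hom T R K. \<phi> = Cmp T R K A k \<psi>"
      by (rule coherent_kernelE[OF coherent_Sh[OF X] A(1)]) blast
    have "Cmp T K Z (Sh T X) c (Cmp T K A Z w k) = 0"
      using K A o by (simp add: Cmp_assoc)
    then obtain y where y: "y \<in> Hom T K Y" "Cmp T K A Z w k = Cmp T K Y Z b y"
      using tri_exact(2)[OF t, of K "Cmp T K A Z w k"] K A o by auto
    obtain E g where E: "E \<in> P" "g \<in> Hom T E X"
      and cov: "\<And>R \<phi>. \<lbrakk>R \<in> P; \<phi> \<in> Hom T R X\<rbrakk> \<Longrightarrow> \<exists>\<psi> \<in> Hom T R E. \<phi> = Cmp T R E X g \<psi>"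
      by (rule coherent_coverE[OF X]) blast
    obtain D p q where D: "D \<in> P" "p \<in> Hom T D K" "q \<in> Hom T D E"
      and pair: "\<And>R \<theta> \<chi>. \<lbrakk>R \<in> Obj T; \<theta> \<in> Hom T R K; \<chi> \<in> Hom T R E\<rbrakk>
        \<Longrightarrow> \<exists>\<omega> \<in> Hom T R D. Cmp T R D K p \<omega> = \<theta> \<and> Cmp T R D E q \<omega> = \<chi>"
      by (rule P_productE[OF K(1) E(1)]) blast
    \<comment> \<open>On the kernel \<open>K\<close> of \<open>c w\<close>, the morphism \<open>w\<close> comes from \<open>y : K \<rightarrow> Y\<close>. It vanishes where \<open>y\<close> comes
      from \<open>X\<close>, that is, on the pullback of \<open>y\<close> and \<open>a g\<close>, which \<open>L\<close> covers.\<close>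
    let ?q = "Cmp T D K Y y p - Cmp T D X Y a (Cmp T D E X g q)"
    have qh: "?q \<in> Hom T D Y"
      using o D E K y by simp
    obtain L l where L: "L \<in> P" "l \<in> Hom T L D" "Cmp T L D Y ?q l = 0"
      and ker2: "\<And>R \<phi>. \<lbrakk>R \<in> P; \<phi> \<in> Hom T R D; Cmp T R D Y ?q \<phi> = 0\<rbrakk>
        \<Longrightarrow> \<exists>\<psi> \<in> Hom T R L. \<phi> = Cmp T R L D l \<psi>"
      by (rule coherent_kernelE[OF Y D(1) qh]) blast
    let ?k = "Cmp T L K A k (Cmp T L D K p l)"
    show "\<exists>K\<in>P. \<exists>\<kappa>\<in>Hom T K A. Cmp T K A Z w \<kappa> = 0 \<and>
      (\<forall>R\<in>P. \<forall>\<phi>\<in>Hom T R A. Cmp T R A Z w \<phi> = 0 \<longrightarrow> (\<exists>\<psi>\<in>Hom T R K. \<phi> = Cmp T R K A \<kappa> \<psi>))"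
    proof (rule bexI[OF _ L(1)], rule bexI[of _ ?k], intro conjI ballI impI)
      show "?k \<in> Hom T L A" using L D K A by simp
      have "Cmp T L A Z w ?k = Cmp T L K Z (Cmp T K A Z w k) (Cmp T L D K p l)"
        using L D K A o by (simp add: Cmp_assoc)
      also have "\<dots> = Cmp T L D Z (Cmp T D K Z (Cmp T K Y Z b y) p) l"
        unfolding y(2) using L D K y(1) o by (simp add: Cmp_assoc)
      also have "Cmp T D K Z (Cmp T K Y Z b y) p = Cmp T D Y Z b (?q + Cmp T D X Y a (Cmp T D E X g q))"
        using D K y(1) o by (simp add: Cmp_assoc)
      also have "\<dots> = Cmp T D Y Z b ?q + Cmp T D Y Z b (Cmp T D X Y a (Cmp T D E X g q))"
        by (rule Cmp_add_right) (use D E qh o in simp_all)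
      also have "Cmp T D Y Z b (Cmp T D X Y a (Cmp T D E X g q)) = Cmp T D X Z (Cmp T X Y Z b a) (Cmp T D E X g q)"
        by (rule Cmp_assoc) (use D E o in simp_all)
      also have "Cmp T D Y Z b ?q + Cmp T D X Z (Cmp T X Y Z b a) (Cmp T D E X g q) = Cmp T D Y Z b ?q"
        unfolding t0 using D E o by simp
      also have "Cmp T L D Z (Cmp T D Y Z b ?q) l = Cmp T L Y Z b (Cmp T L D Y ?q l)"
        using L(1,2) D qh o by (simp add: Cmp_assoc)
      also have "\<dots> = 0"
        unfolding L(3) using L o by simp
      finally show "Cmp T L A Z w ?k = 0" .
      fix R \<phi> assume R: "R \<in> P" "\<phi> \<in> Hom T R A" and z: "Cmp T R A Z w \<phi> = 0"
      have "Cmp T R A (Sh T X) (Cmp T A Z (Sh T X) c w) \<phi> = Cmp T R Z (Sh T X) c (Cmp T R A Z w \<phi>)"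
        using R A o by (simp add: Cmp_assoc)
      also have "\<dots> = 0"
        unfolding z using R o by simp
      finally obtain \<theta> where theta: "\<theta> \<in> Hom T R K" "\<phi> = Cmp T R K A k \<theta>"
        using ker[OF R] by blast
      have "Cmp T R Y Z b (Cmp T R K Y y \<theta>) = Cmp T R K Z (Cmp T K A Z w k) \<theta>"
        unfolding y(2) using R K y(1) o theta(1) by (simp add: Cmp_assoc)
      also have "\<dots> = 0"
        using z R K A o theta by (simp add: Cmp_assoc)
      finally obtain \<xi> where xi: "\<xi> \<in> Hom T R X" "Cmp T R K Y y \<theta> = Cmp T R X Y a \<xi>"
        using tri_exact(1)[OF t, of R "Cmp T R K Y y \<theta>"] R K y o theta by auto
      obtain \<xi>' where xi': "\<xi>' \<in> Hom T R E" "\<xi> = Cmp T R E X g \<xi>'"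
        using cov[OF R(1) xi(1)] by blast
      obtain \<omega> where om: "\<omega> \<in> Hom T R D" "Cmp T R D K p \<omega> = \<theta>" "Cmp T R D E q \<omega> = \<xi>'"
        using pair[of R \<theta> \<xi>'] R theta xi' by auto
      have "Cmp T R D Y ?q \<omega> = Cmp T R K Y y (Cmp T R D K p \<omega>) - Cmp T R X Y a (Cmp T R E X g (Cmp T R D E q \<omega>))"
        using R o D E K y(1) om(1) by (simp add: Cmp_diff_left Cmp_assoc)
      also have "\<dots> = 0"
        unfolding om(2,3) xi'(2)[symmetric] xi(2) by simp
      finally obtain \<psi> where psi: "\<psi> \<in> Hom T R L" "\<omega> = Cmp T R L D l \<psi>"
        using ker2[OF R(1) om(1)] by blast
      have "\<phi> = Cmp T R K A k (Cmp T R D K p (Cmp T R L D l \<psi>))"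
        unfolding psi(2)[symmetric] om(2) theta(2) ..
      also have "\<dots> = Cmp T R L A ?k \<psi>"
        using R K D L A psi(1) by (simp add: Cmp_assoc)
      finally show "\<exists>\<psi>\<in>Hom T R L. \<phi> = Cmp T R L A ?k \<psi>"
        using psi(1) by blast
    qed
  qed
qed

lemma thick_coherent:
  assumes "P \<noteq> {}"
  shows "thick scale T {M. coherent_obj T P M}"
proof (rule thickI)
  show "{M. coherent_obj T P M} \<noteq> {}" using coherent_P assms by blast
qed (use coherent_Obj coherent_retract coherent_cone coherent_desuspend in blast)+

end

section \<open>Presentations of length one\<close>

context triangulated_category
begin

lemma zero_cone_iso:
  assumes t: "(X, Y, Z, f, g, h) \<in> Tri T" and Z: "is_zero T Z"
  shows "is_iso T X Y f"
proof -
  note o = Tri_closed[OF t]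
  have Z0: "Hom T R Z = {0}" if "R \<in> Obj T" for R
    using Z that unfolding is_zero_def by blast
  have "g = 0" using Z0[of Y] o by auto
  then obtain v where v: "v \<in> Hom T Y X" "Idn T Y = Cmp T Y X Y f v"
    using tri_exact(1)[OF t, of Y "Idn T Y"] o by auto
  let ?d = "Cmp T X Y X v f - Idn T X"
  have d: "?d \<in> Hom T X X" using o v(1) by simp
  have "Cmp T X X Y f ?d = Cmp T X Y Y (Cmp T Y X Y f v) f - f"
    using o v(1) by (simp add: Cmp_diff_right Cmp_assoc Cmp_Idn_right)
  also have "\<dots> = 0"
    unfolding v(2)[symmetric] using o by (simp add: Cmp_Idn_left)
  finally have "Cmp T (Sh T X) (Sh T X) (Sh T Y) (ShM T X Y f) (ShM T X X ?d) = 0"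
    using o d by (simp flip: ShM_Cmp)
  then obtain \<psi> where "\<psi> \<in> Hom T (Sh T X) Z" "ShM T X X ?d = Cmp T (Sh T X) Z (Sh T X) h \<psi>"
    using tri_exact(3)[OF t, of "Sh T X" "ShM T X X ?d"] o d by auto
  then have "ShM T X X ?d = 0"
    using Z0[of "Sh T X"] o by auto
  then have "?d = 0"
    using d o by (simp only: ShM_eq_0_iff)
  then show ?thesis
    unfolding is_iso_def using o v by auto
qed

end

context semihereditary_class
begin

lemma rel_mono_Sh:
  assumes m: "rel_mono T P X Y m" and o: "X \<in> Obj T" "Y \<in> Obj T"
  shows "rel_mono T P (Sh T X) (Sh T Y) (ShM T X Y m)"
  unfolding rel_mono_def
proof (intro conjI ballI impI)
  have mh: "m \<in> Hom T X Y"
    and inj: "\<And>R \<phi>. \<lbrakk>R \<in> P; \<phi> \<in> Hom T R X; Cmp T R X Y m \<phi> = 0\<rbrakk> \<Longrightarrow> \<phi> = 0"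
    using m unfolding rel_mono_def by blast+
  show "ShM T X Y m \<in> Hom T (Sh T X) (Sh T Y)" using mh o by simp
  fix R \<phi> assume R: "R \<in> P" "\<phi> \<in> Hom T R (Sh T X)" and z: "Cmp T R (Sh T X) (Sh T Y) (ShM T X Y m) \<phi> = 0"
  obtain R' u v where R': "R' \<in> P" "u \<in> Hom T R (Sh T R')" "v \<in> Hom T (Sh T R') R"
    and vu: "Cmp T R (Sh T R') R v u = Idn T R"
    by (rule P_desuspendE[OF R(1)]) blast
  obtain \<phi>' where p: "\<phi>' \<in> Hom T R' X" "Cmp T (Sh T R') R (Sh T X) \<phi> v = ShM T R' X \<phi>'"
    using ShM_fullE[of R' X "Cmp T (Sh T R') R (Sh T X) \<phi> v"] R R' o by auto
  have "ShM T R' Y (Cmp T R' X Y m \<phi>') =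
      Cmp T (Sh T R') (Sh T X) (Sh T Y) (ShM T X Y m) (Cmp T (Sh T R') R (Sh T X) \<phi> v)"
    unfolding p(2) using R' o mh p(1) by (simp add: ShM_Cmp)
  also have "\<dots> = Cmp T (Sh T R') R (Sh T Y) (Cmp T R (Sh T X) (Sh T Y) (ShM T X Y m) \<phi>) v"
    using R R' o mh by (simp add: Cmp_assoc)
  also have "\<dots> = 0"
    unfolding z using R R' o by simp
  finally have "Cmp T R' X Y m \<phi>' = 0"
    using R' o mh p(1) by (simp add: ShM_eq_0_iff)
  then have "Cmp T (Sh T R') R (Sh T X) \<phi> v = 0"
    using inj[OF R'(1) p(1)] R' p(2) o by simp
  then have "Cmp T R R (Sh T X) \<phi> (Cmp T R (Sh T R') R v u) = 0"
    using R R' o by (simp add: Cmp_assoc)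
  then show "\<phi> = 0"
    using R o by (simp add: vu Cmp_Idn_right)
qed

text \<open>
  An object without nonzero morphisms from \<open>P\<close> is zero, since the objects without nonzero morphisms to
  all such objects form a thick subcategory.
\<close>

lemma rel_acyclic_zero:
  assumes G: "classical_generator scale T G" "G \<in> P"
    and W: "W \<in> Obj T" "\<And>R \<phi>. \<lbrakk>R \<in> P; \<phi> \<in> Hom T R W\<rbrakk> \<Longrightarrow> \<phi> = 0"
  shows "is_zero T W"
proof -
  define \<W> where "\<W> = {W \<in> Obj T. \<forall>R \<in> P. \<forall>\<phi> \<in> Hom T R W. \<phi> = 0}"
  define N where "N = {X \<in> Obj T. \<forall>W \<in> \<W>. \<forall>\<phi> \<in> Hom T X W. \<phi> = 0}"
  have WO: "W \<in> Obj T" if "W \<in> \<W>" for W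
    using that unfolding \<W>_def by blast
  have susp: "Sh T W \<in> \<W>" if "W \<in> \<W>" for W
  proof -
    note o = WO[OF that]
    have "\<phi> = 0" if R: "R \<in> P" "\<phi> \<in> Hom T R (Sh T W)" for R \<phi>
    proof -
      obtain R' u v where R': "R' \<in> P" "u \<in> Hom T R (Sh T R')" "v \<in> Hom T (Sh T R') R"
        and vu: "Cmp T R (Sh T R') R v u = Idn T R"
        by (rule P_desuspendE[OF R(1)]) blast
      obtain \<phi>' where p: "\<phi>' \<in> Hom T R' W" "Cmp T (Sh T R') R (Sh T W) \<phi> v = ShM T R' W \<phi>'"
        using ShM_fullE[of R' W "Cmp T (Sh T R') R (Sh T W) \<phi> v"] R R' o by auto
      have "\<phi>' = 0"
        using p R' \<open>W \<in> \<W>\<close> unfolding \<W>_def by blast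
      then have "Cmp T R R (Sh T W) \<phi> (Cmp T R (Sh T R') R v u) = 0"
        using p R R' o by (simp add: Cmp_assoc)
      then show "\<phi> = 0"
        using R o by (simp add: vu Cmp_Idn_right)
    qed
    then show ?thesis unfolding \<W>_def using o by simp
  qed
  have "thick scale T N"
  proof (rule thickI)
    show "N \<noteq> {}"
      using G unfolding N_def \<W>_def classical_generator_def by blast
    show "X \<in> N" if Y: "Y \<in> N" and X: "X \<in> Obj T" "retract T X Y" for X Y
    proof -
      obtain i p where h: "i \<in> Hom T X Y" "p \<in> Hom T Y X" and pi: "Cmp T X Y X p i = Idn T X"
        using X(2) unfolding retract_def by blast
      have Yo: "Y \<in> Obj T" using Y unfolding N_def by blast
      have "\<phi> = 0" if W: "W \<in> \<W>" and p: "\<phi> \<in> Hom T X W" for W \<phi>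
      proof -
        have "Cmp T Y X W \<phi> p \<in> Hom T Y W"
          using p X Yo h WO[OF W] by simp
        then have z: "Cmp T Y X W \<phi> p = 0"
          using Y W unfolding N_def by blast
        have "\<phi> = Cmp T X X W \<phi> (Cmp T X Y X p i)"
          using p X WO[OF W] by (simp add: pi Cmp_Idn_right)
        also have "\<dots> = Cmp T X Y W (Cmp T Y X W \<phi> p) i"
          using p X Yo h WO[OF W] by (simp add: Cmp_assoc)
        also have "\<dots> = 0"
          unfolding z using X Yo h WO[OF W] by simp
        finally show ?thesis .
      qed
      then show ?thesis unfolding N_def using X by blast
    qed
    show "Z \<in> N" if t: "(X, Y, Z, f, g, h) \<in> Tri T" and X: "X \<in> N" and Y: "Y \<in> N" for X Y Z f g h
    proof -
      note o = Tri_closed[OF t]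
      have "\<phi> = 0" if W: "W \<in> \<W>" and p: "\<phi> \<in> Hom T Z W" for W \<phi>
      proof -
        note Wo = WO[OF W]
        have "Cmp T Y Z W \<phi> g \<in> Hom T Y W"
          using p o Wo by simp
        then have "Cmp T Y Z W \<phi> g = 0"
          using Y W unfolding N_def by blast
        then obtain \<psi> where psi: "\<psi> \<in> Hom T (Sh T X) W" "\<phi> = Cmp T Z (Sh T X) W \<psi> h"
          using tri_coexact(2)[OF t Wo p] by blast
        obtain W' u v where W': "W' \<in> Obj T" "u \<in> Hom T W (Sh T W')" "v \<in> Hom T (Sh T W') W"
          and vu: "Cmp T W (Sh T W') W v u = Idn T W"
          and uv: "Cmp T (Sh T W') W (Sh T W') u v = Idn T (Sh T W')"
          by (rule desuspendE[OF Wo]) blast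
        have "\<chi> = 0" if R: "R \<in> P" "\<chi> \<in> Hom T R W'" for R \<chi>
        proof -
          have "Cmp T (Sh T R) (Sh T W') W v (ShM T R W' \<chi>) = 0"
            using W R W' Wo P_Sh[of R] unfolding \<W>_def by simp
          then have "Cmp T (Sh T R) (Sh T W') (Sh T W') (Cmp T (Sh T W') W (Sh T W') u v) (ShM T R W' \<chi>) = 0"
            using R W' Wo by (simp flip: Cmp_assoc)
          then show ?thesis
            unfolding uv using R W' by (simp add: Cmp_Idn_left ShM_eq_0_iff)
        qed
        then have W'W: "W' \<in> \<W>"
          unfolding \<W>_def using W' by blast
        obtain \<psi>' where p': "\<psi>' \<in> Hom T X W'" "Cmp T (Sh T X) W (Sh T W') u \<psi> = ShM T X W' \<psi>'"
          using ShM_fullE[of X W' "Cmp T (Sh T X) W (Sh T W') u \<psi>"] psi(1) o W' Wo by auto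
        have "\<psi>' = 0"
          using p'(1) W'W X unfolding N_def by blast
        then have "Cmp T (Sh T X) W W (Cmp T W (Sh T W') W v u) \<psi> = 0"
          using p'(2) psi(1) o W' Wo by (simp flip: Cmp_assoc)
        then have "\<psi> = 0"
          using psi(1) o Wo by (simp add: vu Cmp_Idn_left)
        then show ?thesis
          using psi o Wo by simp
      qed
      then show ?thesis unfolding N_def using o by blast
    qed
    show "X \<in> N" if X: "X \<in> Obj T" "Sh T X \<in> N" for X
    proof -
      have "\<phi> = 0" if W: "W \<in> \<W>" "\<phi> \<in> Hom T X W" for W \<phi>
      proof -
        have "ShM T X W \<phi> = 0"
          using X W susp[OF W(1)] WO[OF W(1)] unfolding N_def by simp
        then show ?thesis
          using X W WO by (simp add: ShM_eq_0_iff)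
      qed
      then show ?thesis unfolding N_def using X by blast
    qed
  qed (auto simp: N_def)
  moreover have "G \<in> N"
    using G unfolding N_def \<W>_def classical_generator_def by blast
  ultimately have "N = Obj T"
    using G classical_generator_thick by blast
  moreover have "W \<in> \<W>"
    using W unfolding \<W>_def by blast
  ultimately have "Idn T W = 0"
    using W Idn_in_Hom unfolding N_def by blast
  then show ?thesis
    using W by (simp add: is_zero_iff)
qed

text \<open>
  Every object has a presentation of length one: let \<open>A \<rightarrow> M\<close> be a cover and \<open>I \<rightarrow> A\<close> represent
  its kernel. The cone of \<open>I \<rightarrow> A\<close> maps to \<open>M\<close>, and by construction this morphism becomes bijective
  after applying \<open>Hom R\<close> for every \<open>R \<in> P\<close>. Its cone is then orthogonal to \<open>P\<close>, hence zero.
\<close>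

lemma presentation:
  assumes G: "classical_generator scale T G" "G \<in> P" and M: "M \<in> Obj T"
  shows "\<exists>A B f g h. (A, M, B, f, g, h) \<in> Tri T \<and> A \<in> P \<and> B \<in> P"
proof -
  have "{M. coherent_obj T P M} = Obj T"
    using classical_generator_thick[OF G(1) thick_coherent] coherent_P G(2) by blast
  then have coh: "coherent_obj T P M" using M by blast
  obtain A g where A: "A \<in> P" "g \<in> Hom T A M"
    and cov: "\<And>R \<phi>. \<lbrakk>R \<in> P; \<phi> \<in> Hom T R M\<rbrakk> \<Longrightarrow> \<exists>\<psi> \<in> Hom T R A. \<phi> = Cmp T R A M g \<psi>"
    by (rule coherent_coverE[OF coh]) blast
  obtain K \<kappa> where K: "K \<in> P" "\<kappa> \<in> Hom T K A" "Cmp T K A M g \<kappa> = 0"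
    and ker: "\<And>R \<phi>. \<lbrakk>R \<in> P; \<phi> \<in> Hom T R A; Cmp T R A M g \<phi> = 0\<rbrakk> \<Longrightarrow> \<exists>\<psi> \<in> Hom T R K. \<phi> = Cmp T R K A \<kappa> \<psi>"
    by (rule coherent_kernelE[OF coh A]) blast
  obtain I m e s where I: "I \<in> P" and m: "rel_mono T P I A m"
    and h: "e \<in> Hom T K I" "s \<in> Hom T I K"
    and fac: "\<kappa> = Cmp T K I A m e" "m = Cmp T I K A \<kappa> s"
    using P_image[OF K(1) A(1) K(2)] by blast
  have mh: "m \<in> Hom T I A"
    using m unfolding rel_mono_def by blast
  have "Cmp T I A M g m = Cmp T I K M (Cmp T K A M g \<kappa>) s"
    unfolding fac(2) using A K(1,2) I h M by (simp add: Cmp_assoc)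
  then have gm: "Cmp T I A M g m = 0"
    unfolding K(3) using K I h M by simp
  obtain C q r where t: "(I, A, C, m, q, r) \<in> Tri T"
    using Tri_ex[of I A m] I A mh by auto
  note o = Tri_closed[OF t] and t0 = tri_comp_0[OF t]
  obtain b where b: "b \<in> Hom T C M" "g = Cmp T A C M b q"
    using tri_coexact(1)[OF t M A(2) gm] by blast
  have bmono: "rel_mono T P C M b"
    unfolding rel_mono_def
  proof (intro conjI ballI impI)
    fix R \<phi> assume R: "R \<in> P" "\<phi> \<in> Hom T R C" and z: "Cmp T R C M b \<phi> = 0"
    have "Cmp T R (Sh T I) (Sh T A) (ShM T I A m) (Cmp T R C (Sh T I) r \<phi>) =
        Cmp T R C (Sh T A) (Cmp T C (Sh T I) (Sh T A) (ShM T I A m) r) \<phi>"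
      using R o by (simp add: Cmp_assoc)
    also have "\<dots> = 0"
      unfolding t0 using R o by simp
    finally have "Cmp T R C (Sh T I) r \<phi> = 0"
      using rel_mono_Sh[OF m] R o unfolding rel_mono_def by simp
    then obtain \<psi> where psi: "\<psi> \<in> Hom T R A" "\<phi> = Cmp T R A C q \<psi>"
      using tri_exact(2)[OF t _ R(2)] R by auto
    have "Cmp T R A M g \<psi> = Cmp T R C M b (Cmp T R A C q \<psi>)"
      unfolding b(2) using R o b(1) psi(1) M by (simp add: Cmp_assoc)
    then have "Cmp T R A M g \<psi> = 0"
      unfolding psi(2)[symmetric] z .
    then obtain \<chi> where chi: "\<chi> \<in> Hom T R K" "\<psi> = Cmp T R K A \<kappa> \<chi>"
      using ker[OF R(1) psi(1)] by blast
    have "\<phi> = Cmp T R I C (Cmp T I A C q m) (Cmp T R K I e \<chi>)"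
      unfolding psi(2) chi(2) fac(1) using R K(1) h(1) o chi(1) by (simp add: Cmp_assoc)
    also have "\<dots> = 0"
      unfolding t0 using R K h o chi(1) by simp
    finally show "\<phi> = 0" .
  qed (rule b)
  obtain W x y where tb: "(C, M, W, b, x, y) \<in> Tri T"
    using Tri_ex[of C M b] o M b by auto
  note ob = Tri_closed[OF tb] and tb0 = tri_comp_0[OF tb]
  have "\<phi> = 0" if R: "R \<in> P" "\<phi> \<in> Hom T R W" for R \<phi>
  proof -
    have "Cmp T R (Sh T C) (Sh T M) (ShM T C M b) (Cmp T R W (Sh T C) y \<phi>) =
        Cmp T R W (Sh T M) (Cmp T W (Sh T C) (Sh T M) (ShM T C M b) y) \<phi>"
      using R ob by (simp add: Cmp_assoc)
    also have "\<dots> = 0"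
      unfolding tb0 using R ob by simp
    finally have "Cmp T R W (Sh T C) y \<phi> = 0"
      using rel_mono_Sh[OF bmono] R ob unfolding rel_mono_def by simp
    then obtain \<psi> where psi: "\<psi> \<in> Hom T R M" "\<phi> = Cmp T R M W x \<psi>"
      using tri_exact(2)[OF tb _ R(2)] R by auto
    obtain \<eta> where eta: "\<eta> \<in> Hom T R A" "\<psi> = Cmp T R A M g \<eta>"
      using cov[OF R(1) psi(1)] by blast
    have "\<phi> = Cmp T R C W (Cmp T C M W x b) (Cmp T R A C q \<eta>)"
      unfolding psi(2) eta(2) b(2) using R A(1) o ob eta(1) by (simp add: Cmp_assoc)
    also have "\<dots> = 0"
      unfolding tb0 using R A o ob eta(1) by simp
    finally show "\<phi> = 0" .
  qed
  then have "is_zero T W"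
    using rel_acyclic_zero[OF G] ob by blast
  then have iso: "is_iso T C M b"
    by (rule zero_cone_iso[OF tb])
  then obtain v where v: "v \<in> Hom T M C" "Cmp T C M C v b = Idn T C"
    unfolding is_iso_def by blast
  have "(A, M, Sh T I, g, Cmp T M C (Sh T I) r v, - ShM T I A m) \<in> Tri T"
  proof (rule Tri_iso[OF rotate[OF t], where a = "Idn T A" and b = b and c = "Idn T (Sh T I)"])
    show "Cmp T A C M b q = Cmp T A A M g (Idn T A)"
      using b A o M by (simp add: Cmp_Idn_right)
    have "Cmp T C M (Sh T I) (Cmp T M C (Sh T I) r v) b = Cmp T C C (Sh T I) r (Cmp T C M C v b)"
      using o ob v(1) by (simp add: Cmp_assoc)
    then show "Cmp T C (Sh T I) (Sh T I) (Idn T (Sh T I)) r = Cmp T C M (Sh T I) (Cmp T M C (Sh T I) r v) b"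
      unfolding v(2) using o by (simp add: Cmp_Idn_left Cmp_Idn_right)
    show "Cmp T (Sh T I) (Sh T A) (Sh T A) (ShM T A A (Idn T A)) (- ShM T I A m) =
        Cmp T (Sh T I) (Sh T I) (Sh T A) (- ShM T I A m) (Idn T (Sh T I))"
      using o by (simp add: ShM_Idn Cmp_Idn_left Cmp_Idn_right)
  qed (use A I M o v(1) iso in \<open>simp_all add: is_iso_Idn\<close>)
  moreover have "Sh T I \<in> P"
    using I P_Sh by simp
  ultimately show ?thesis
    using A by blast
qed

end

section \<open>Indecomposable objects and one-dimensional morphism spaces\<close>

context linear_category
begin

lemma local_End_indecomposable:
  assumes X: "X \<in> Obj C" and l: "local_End C X"
  shows "indecomposable C X"
  unfolding indecomposable_def
proof (intro conjI allI impI)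
  show "\<not> is_zero C X"
    using l unfolding local_End_def is_zero_iff by blast
  fix A B assume "is_direct_sum C [A, B] X"
  then obtain i1 i2 p1 p2 where o: "A \<in> Obj C" "B \<in> Obj C"
    and h: "i1 \<in> Hom C A X" "i2 \<in> Hom C B X" "p1 \<in> Hom C X A" "p2 \<in> Hom C X B"
    and e: "Cmp C A X A p1 i1 = Idn C A" "Cmp C B X B p2 i2 = Idn C B"
      "Cmp C A X B p2 i1 = 0" "Cmp C B X A p1 i2 = 0"
    and s: "Cmp C X A X i1 p1 + Cmp C X B X i2 p2 = Idn C X"
    by (rule is_direct_sum_2E) blast
  have zero: "is_zero C B" if o: "A \<in> Obj C" "B \<in> Obj C"
      and h: "i1 \<in> Hom C A X" "i2 \<in> Hom C B X" "p1 \<in> Hom C X A" "p2 \<in> Hom C X B"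
      and e: "Cmp C B X B p2 i2 = Idn C B" "Cmp C B X A p1 i2 = 0"
      and iso: "is_iso C X X (Cmp C X A X i1 p1)" for A B i1 i2 p1 p2
  proof -
    obtain v where v: "v \<in> Hom C X X" "Cmp C X X X v (Cmp C X A X i1 p1) = Idn C X"
      using iso unfolding is_iso_def by blast
    have "i2 = Cmp C B X X (Cmp C X X X v (Cmp C X A X i1 p1)) i2"
      unfolding v(2) using X o h by (simp add: Cmp_Idn_left)
    also have "\<dots> = Cmp C B X X v (Cmp C B A X i1 (Cmp C B X A p1 i2))"
      using X o h v(1) by (simp add: Cmp_assoc)
    also have "\<dots> = 0"
      unfolding e(2) using X o h v(1) by simp
    finally have "Idn C B = 0"
      using e(1) X o h by simp
    then show ?thesis
      using o by (simp add: is_zero_iff)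
  qed
  have "is_iso C X X (Cmp C X A X i1 p1) \<or> is_iso C X X (Cmp C X B X i2 p2)"
    using l X o h s is_iso_Idn[OF X] unfolding local_End_def by auto
  then show "is_zero C A \<or> is_zero C B"
    using zero[OF o h e(2,4)] zero[OF o(2,1) h(2,1,4,3) e(1,3)] by blast
qed (rule X)

lemma hom_le_iff:
  assumes "P \<in> Obj C" "Q \<in> Obj C"
  shows "hom_le scale C Q P \<longleftrightarrow> (\<exists>u \<in> Hom C P Q. u \<noteq> 0 \<and> (\<forall>f \<in> Hom C P Q. \<exists>a. f = scale a u))"
proof
  assume "hom_le scale C Q P"
  then obtain \<phi> :: "'k \<Rightarrow> 'm" where l: "Vector_Spaces.linear (*) scale \<phi>" and b: "bij_betw \<phi> UNIV (Hom C P Q)"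
    unfolding hom_le_def by blast
  interpret l: Vector_Spaces.linear "(*)" scale \<phi> by (rule l)
  have s: "\<phi> a = scale a (\<phi> 1)" for a
    using l.scale[of a 1] by simp
  have "\<phi> 1 \<noteq> \<phi> 0"
    using b by (metis UNIV_I bij_betw_def inj_on_eq_iff zero_neq_one)
  then have "\<phi> 1 \<noteq> 0" by (simp add: l.zero)
  moreover have "Hom C P Q = range \<phi>"
    using b unfolding bij_betw_def by simp
  then have "\<phi> 1 \<in> Hom C P Q" "\<forall>f \<in> Hom C P Q. \<exists>a. f = scale a (\<phi> 1)"
    by (auto intro: s)
  ultimately show "\<exists>u \<in> Hom C P Q. u \<noteq> 0 \<and> (\<forall>f \<in> Hom C P Q. \<exists>a. f = scale a u)"
    by blast
next
  assume "\<exists>u \<in> Hom C P Q. u \<noteq> 0 \<and> (\<forall>f \<in> Hom C P Q. \<exists>a. f = scale a u)"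
  then obtain u where u: "u \<in> Hom C P Q" "u \<noteq> 0" "\<And>f. f \<in> Hom C P Q \<Longrightarrow> \<exists>a. f = scale a u"
    by blast
  have "Vector_Spaces.linear (*) scale (\<lambda>a. scale a u)"
    by unfold_locales (simp_all add: algebra_simps)
  moreover have "bij_betw (\<lambda>a. scale a u) UNIV (Hom C P Q)"
    unfolding bij_betw_def using u assms by (auto simp: inj_on_def)
  ultimately show "hom_le scale C Q P"
    unfolding hom_le_def by blast
qed

lemma hom_le_isomorphic:
  assumes le: "hom_le scale C Q P" and iso: "isomorphic C Q Q'" "isomorphic C P P'"
  shows "hom_le scale C Q' P'"
proof -
  obtain q r where q: "q \<in> Hom C Q Q'" "r \<in> Hom C Q' Q" "Cmp C Q Q' Q r q = Idn C Q" "Cmp C Q' Q Q' q r = Idn C Q'"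
    and Qo: "Q \<in> Obj C" "Q' \<in> Obj C"
    using iso(1) unfolding isomorphic_def is_iso_def by blast
  obtain p s where p: "p \<in> Hom C P P'" "s \<in> Hom C P' P" "Cmp C P P' P s p = Idn C P" "Cmp C P' P P' p s = Idn C P'"
    and Po: "P \<in> Obj C" "P' \<in> Obj C"
    using iso(2) unfolding isomorphic_def is_iso_def by blast
  obtain u where u: "u \<in> Hom C P Q" "u \<noteq> 0" and sp: "\<And>f. f \<in> Hom C P Q \<Longrightarrow> \<exists>a. f = scale a u"
    using le Po Qo by (auto simp: hom_le_iff)
  let ?u = "Cmp C P' Q Q' q (Cmp C P' P Q u s)"
  have uh: "?u \<in> Hom C P' Q'" using u p q Po Qo by simp
  have "Cmp C P P' Q (Cmp C P' Q' Q r ?u) p = Cmp C P Q Q (Cmp C Q Q' Q r q) (Cmp C P P Q u (Cmp C P P' P s p))"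
    using u p(1,2) q(1,2) Po Qo by (simp add: Cmp_assoc)
  also have "\<dots> = u"
    unfolding p(3) q(3) using u Po Qo by (simp add: Cmp_Idn_left Cmp_Idn_right)
  finally have "?u \<noteq> 0"
    using u p q Po Qo by auto
  moreover have "\<exists>a. f = scale a ?u" if f: "f \<in> Hom C P' Q'" for f
  proof -
    have "Cmp C P P' Q (Cmp C P' Q' Q r f) p \<in> Hom C P Q"
      using f p q Po Qo by simp
    then obtain a where a: "Cmp C P P' Q (Cmp C P' Q' Q r f) p = scale a u"
      using sp by blast
    have "f = Cmp C P' Q' Q' (Cmp C Q' Q Q' q r) (Cmp C P' P' Q' f (Cmp C P' P P' p s))"
      unfolding p(4) q(4) using f Po Qo by (simp add: Cmp_Idn_left Cmp_Idn_right)
    also have "\<dots> = Cmp C P' Q Q' q (Cmp C P' P Q (Cmp C P P' Q (Cmp C P' Q' Q r f) p) s)"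
      using f p(1,2) q(1,2) Po Qo by (simp add: Cmp_assoc)
    also have "\<dots> = scale a ?u"
      unfolding a using u(1) p q Po Qo by (simp add: Cmp_scale_left Cmp_scale_right)
    finally show ?thesis by blast
  qed
  ultimately show ?thesis
    using uh Po Qo by (auto simp: hom_le_iff)
qed

end

section \<open>The additive closure\<close>

context triangulated_category
begin

text \<open>The classes of objects whose intersection is the additive closure of \<open>G\<close>.\<close>

definition additive_family :: "'o \<Rightarrow> 'o set set" where
  "additive_family G = {S. S \<subseteq> Obj T \<and> G \<in> S \<and> has_direct_sums (full_sub T S) \<and>
     summand_closed T S \<and> Sh_closed T S}"

lemma additive_closure_eq: "additive_closure T G = \<Inter> (additive_family G)"
  unfolding additive_closure_def additive_family_def ..

lemma mem_additive_closure: "G \<in> additive_closure T G"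
  unfolding additive_closure_eq additive_family_def by blast

lemma additive_closure_Obj:
  assumes "G \<in> Obj T"
  shows "additive_closure T G \<subseteq> Obj T"
proof -
  have "has_direct_sums (full_sub T (Obj T))"
    using direct_sums unfolding has_direct_sums_def full_sub_simps is_direct_sum_full_sub[OF order_refl]
    unfolding is_direct_sum_def by blast
  moreover have "summand_closed T (Obj T)"
    unfolding summand_closed_def is_summand_def is_direct_sum_def by auto
  ultimately have "Obj T \<in> additive_family G"
    unfolding additive_family_def Sh_closed_def using assms by auto
  then show ?thesis
    unfolding additive_closure_eq by blast
qed

lemma additive_closure_retract:
  assumes G: "G \<in> Obj T" and Y: "Y \<in> additive_closure T G" and X: "X \<in> Obj T" "retract T X Y"
  shows "X \<in> additive_closure T G"
proof -
  have "is_summand T X Y"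
    using retract_iff_summand X Y additive_closure_Obj[OF G] by blast
  then show ?thesis
    using Y unfolding additive_closure_eq additive_family_def summand_closed_def by blast
qed

lemma additive_closure_Sh:
  assumes "X \<in> Obj T"
  shows "Sh T X \<in> additive_closure T G \<longleftrightarrow> X \<in> additive_closure T G"
  using assms unfolding additive_closure_eq additive_family_def Sh_closed_def by blast

lemma additive_closure_direct_sum:
  assumes Xs: "set Xs \<subseteq> additive_closure T G" and Z: "is_direct_sum T Xs Z"
  shows "Z \<in> additive_closure T G"
proof -
  have "Z \<in> S" if S: "S \<in> additive_family G" for S
  proof -
    have SO: "S \<subseteq> Obj T" and sums: "has_direct_sums (full_sub T S)" and cl: "summand_closed T S"
      using S unfolding additive_family_def by blast+
    have "set Xs \<subseteq> S"
      using Xs S unfolding additive_closure_eq by blast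
    then obtain Z' where Z': "Z' \<in> S" "is_direct_sum T Xs Z'"
      using sums unfolding has_direct_sums_def full_sub_simps is_direct_sum_full_sub[OF SO] by blast
    have "Z \<in> Obj T"
      using Z unfolding is_direct_sum_def by blast
    then have "is_summand T Z Z'"
      using retract_iff_summand[of Z Z'] direct_sum_retract_direct_sum[OF Z Z'(2)] Z'(1) SO by blast
    then show ?thesis
      using cl Z'(1) unfolding summand_closed_def by blast
  qed
  then show ?thesis
    unfolding additive_closure_eq by blast
qed

lemma additive_closure_indecs:
  assumes G: "G \<in> Obj T" and ks: "krull_schmidt T" and X: "X \<in> additive_closure T G"
  shows "\<exists>Xs. is_direct_sum T Xs X \<and> set Xs \<subseteq> indecs T G"
proof -
  have "X \<in> Obj T" using X additive_closure_Obj[OF G] by blast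
  then obtain Xs where Xs: "is_direct_sum T Xs X" "\<forall>Y \<in> set Xs. local_End T Y"
    using ks unfolding krull_schmidt_def by blast
  have "Y \<in> indecs T G" if Y: "Y \<in> set Xs" for Y
  proof -
    have Yo: "Y \<in> Obj T"
      using Xs Y unfolding is_direct_sum_def by blast
    then have "Y \<in> additive_closure T G"
      using additive_closure_retract[OF G X] direct_sum_retract Xs(1) Y by blast
    then show ?thesis
      unfolding indecs_def using local_End_indecomposable Xs(2) Y Yo by simp
  qed
  then show ?thesis using Xs by blast
qed

end

section \<open>Linear generators\<close>

locale linearly_generated = triangulated_category scale T
  for scale :: "'k::field \<Rightarrow> 'm::ab_group_add \<Rightarrow> 'm" and T :: "('o, 'm, 'x) tricat_scheme" +
  fixes G :: 'o
  assumes krull_schmidt: "krull_schmidt T"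
    and linear_generator: "linear_generator scale T G"
begin

text \<open>
  The objects of \<open>proj\<close> represent projective modules over the category of indecomposables \<open>ind\<close>.
\<close>

abbreviation proj :: "'o set" where "proj \<equiv> additive_closure T G"
abbreviation ind :: "'o set" where "ind \<equiv> indecs T G"
abbreviation le :: "'o \<Rightarrow> 'o \<Rightarrow> bool" where "le \<equiv> hom_le scale T"

lemma G_Obj: "G \<in> Obj T"
  using linear_generator unfolding linear_generator_def classical_generator_def by blast

lemma proj_Obj [simp]: "X \<in> proj \<Longrightarrow> X \<in> Obj T"
  using additive_closure_Obj[OF G_Obj] by blast

lemma ind_proj [simp]: "X \<in> ind \<Longrightarrow> X \<in> proj"
  unfolding indecs_def by simp

subsection \<open>The order on indecomposables\<close>

lemma iso_class_pair_iff:
  assumes P: "P \<in> ind" and Q: "Q \<in> ind"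
  shows "(iso_class T Q, iso_class T P) \<in> {(iso_class T Q, iso_class T P) | Q P. Q \<in> ind \<and> P \<in> ind \<and> le Q P}
    \<longleftrightarrow> le Q P" (is "?l \<longleftrightarrow> _")
proof
  assume ?l
  then obtain Q' P' where h: "iso_class T Q = iso_class T Q'" "iso_class T P = iso_class T P'" "le Q' P'"
    by blast
  have "isomorphic T Q' Q" "isomorphic T P' P"
    using h(1,2) P Q isomorphic_refl unfolding iso_class_def by auto
  then show "le Q P"
    using hom_le_isomorphic[OF h(3)] by blast
qed (use assms in blast)

text \<open>The order on isomorphism classes, as a total preorder on the indecomposables themselves.\<close>

lemma le_linear_order:
  shows le_refl: "P \<in> ind \<Longrightarrow> le P P"
    and le_trans: "\<lbrakk>P \<in> ind; Q \<in> ind; R \<in> ind; le R Q; le Q P\<rbrakk> \<Longrightarrow> le R P"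
    and le_total: "\<lbrakk>P \<in> ind; Q \<in> ind\<rbrakk> \<Longrightarrow> le P Q \<or> le Q P"
proof -
  let ?r = "{(iso_class T Q, iso_class T P) | Q P. Q \<in> ind \<and> P \<in> ind \<and> le Q P}"
  have "linear_order_on (iso_classes T ind) ?r"
    using linear_generator unfolding linear_generator_def by (elim conjE)
  then have r: "refl_on (iso_classes T ind) ?r" and tr: "trans ?r" and tot: "total_on (iso_classes T ind) ?r"
    unfolding linear_order_on_def partial_order_on_def preorder_on_def by blast+
  have mem: "iso_class T P \<in> iso_classes T ind" if "P \<in> ind" for P
    unfolding iso_classes_def iso_class_def using that by (rule quotientI)
  show refl: "le P P" if P: "P \<in> ind" for P
    using refl_onD[OF r mem[OF P]] iso_class_pair_iff[OF P P] by blast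
  show "le R P" if P: "P \<in> ind" and Q: "Q \<in> ind" and R: "R \<in> ind" and le: "le R Q" "le Q P" for P Q R
    using transD[OF tr] le iso_class_pair_iff[OF P R] iso_class_pair_iff[OF P Q] iso_class_pair_iff[OF Q R]
    by blast
  show "le P Q \<or> le Q P" if P: "P \<in> ind" and Q: "Q \<in> ind" for P Q
  proof (cases "iso_class T P = iso_class T Q")
    case True
    then show ?thesis
      using refl_onD[OF r mem[OF P]] iso_class_pair_iff[OF P Q] by simp
  next
    case False
    then show ?thesis
      using tot mem[OF P] mem[OF Q] iso_class_pair_iff[OF P Q] iso_class_pair_iff[OF Q P]
      unfolding total_on_def by blast
  qed
qed

lemma Hom_eq_0:
  assumes "P \<in> ind" "Q \<in> ind" "le Q P" "\<not> isomorphic T Q P"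
  shows "Hom T Q P = {0}"
proof -
  have "\<forall>P \<in> ind. \<forall>Q \<in> ind. le Q P \<and> \<not> isomorphic T Q P \<longrightarrow> Hom T Q P = {0}"
    using linear_generator unfolding linear_generator_def by (elim conjE)
  then show ?thesis
    using assms by simp
qed

lemma nonzero_imp_le:
  assumes P: "P \<in> ind" and Q: "Q \<in> ind" and f: "f \<in> Hom T P Q" "f \<noteq> 0"
  shows "le Q P"
proof (rule ccontr)
  assume n: "\<not> le Q P"
  then have "le P Q" using le_total P Q by blast
  moreover have "isomorphic T P Q"
    using Hom_eq_0[OF Q P] calculation f by auto
  ultimately show False
    using n hom_le_isomorphic[OF le_refl[OF P]] isomorphic_refl P by auto
qed

lemma scalar_multiple:
  assumes P: "P \<in> ind" and Q: "Q \<in> ind" and b: "b \<in> Hom T P Q" "b \<noteq> 0" and f: "f \<in> Hom T P Q"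
  shows "\<exists>a. f = scale a b"
proof -
  have "le Q P" by (rule nonzero_imp_le[OF P Q b])
  then obtain u where u: "u \<noteq> 0" and sp: "\<And>f. f \<in> Hom T P Q \<Longrightarrow> \<exists>a. f = scale a u"
    using P Q by (auto simp: hom_le_iff)
  obtain c d where c: "b = scale c u" and d: "f = scale d u"
    using sp b(1) f by blast
  have "c \<noteq> 0" using b(2) c by auto
  then have "f = scale (d / c) b"
    using c d by simp
  then show ?thesis by blast
qed

lemma factor:
  assumes P: "P \<in> ind" and Q: "Q \<in> ind" and R: "R \<in> ind" and le: "le R Q"
    and b: "b \<in> Hom T P Q" "b \<noteq> 0" and f: "f \<in> Hom T P R"
  shows "\<exists>c \<in> Hom T Q R. f = Cmp T P Q R c b"
proof (cases "f = 0")
  case True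
  then show ?thesis
    using P Q R b by (intro bexI[of _ 0]) simp_all
next
  case False
  have G4: "\<forall>P \<in> ind. \<forall>Q \<in> ind. \<forall>R \<in> ind. le R Q \<and> le Q P \<longrightarrow>
      (\<forall>f \<in> Hom T P R. f \<noteq> 0 \<longrightarrow> (\<exists>g \<in> Hom T P Q. \<exists>h \<in> Hom T Q R. g \<noteq> 0 \<and> h \<noteq> 0 \<and> f = Cmp T P Q R h g))"
    using linear_generator unfolding linear_generator_def by (elim conjE)
  obtain g h where g: "g \<in> Hom T P Q" and h: "h \<in> Hom T Q R" and e: "f = Cmp T P Q R h g"
    using G4 P Q R le nonzero_imp_le[OF P Q b] f False by blast
  obtain a where a: "g = scale a b"
    using scalar_multiple[OF P Q b g] by blast
  have "f = Cmp T P Q R (scale a h) b"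
    unfolding e a using P Q R b h by (simp add: Cmp_scale_left Cmp_scale_right)
  then show ?thesis
    using P Q R h by (intro bexI[of _ "scale a h"]) simp_all
qed

text \<open>
  The space of morphisms \<open>P \<rightarrow> R\<close> is nonzero by transitivity, and its elements factor through \<open>b\<close> and
  hence are multiples of \<open>c b\<close>.
\<close>

lemma Cmp_nonzero:
  assumes P: "P \<in> ind" and Q: "Q \<in> ind" and R: "R \<in> ind"
    and b: "b \<in> Hom T P Q" "b \<noteq> 0" and c: "c \<in> Hom T Q R" "c \<noteq> 0"
  shows "Cmp T P Q R c b \<noteq> 0"
proof
  assume z: "Cmp T P Q R c b = 0"
  have le: "le R Q" "le Q P" by (rule nonzero_imp_le[OF Q R c] nonzero_imp_le[OF P Q b])+
  then have "le R P" using le_trans P Q R by blast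
  then obtain u where u: "u \<in> Hom T P R" "u \<noteq> 0"
    using P R by (auto simp: hom_le_iff)
  obtain d where d: "d \<in> Hom T Q R" "u = Cmp T P Q R d b"
    using factor[OF P Q R le(1) b u(1)] by blast
  obtain a where "d = scale a c"
    using scalar_multiple[OF Q R c d(1)] by blast
  then have "u = scale a (Cmp T P Q R c b)"
    using d(2) P Q R b c by (simp add: Cmp_scale_left)
  then show False
    using z u by simp
qed

lemma greatest_index:
  assumes "finite F" "F \<noteq> {}" "\<And>a. a \<in> F \<Longrightarrow> X a \<in> ind"
  shows "\<exists>a\<in>F. \<forall>b\<in>F. le (X b) (X a)"
  using assms
proof (induction F rule: finite_ne_induct)
  case (singleton a)
  then show ?case using le_refl by simp
next
  case (insert x F)
  then obtain a where a: "a \<in> F" "\<And>b. b \<in> F \<Longrightarrow> le (X b) (X a)" by auto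
  have i: "X x \<in> ind" "X a \<in> ind" using insert.prems a(1) by simp_all
  show ?case
  proof (cases "le (X x) (X a)")
    case True
    then show ?thesis using a by auto
  next
    case False
    then have l: "le (X a) (X x)" using le_total i by blast
    have "le (X b) (X x)" if "b \<in> F" for b
      using le_trans[OF i _ a(2)[OF that] l] insert.prems that by simp
    then show ?thesis using le_refl[OF i(1)] by auto
  qed
qed

subsection \<open>Testing on indecomposables\<close>

lemma proj_indE:
  assumes "X \<in> proj"
  obtains n \<iota> \<pi> Y where "\<And>a. a < n \<Longrightarrow> Y a \<in> ind"
    "\<And>a. a < n \<Longrightarrow> \<iota> a \<in> Hom T (Y a) X" "\<And>a. a < n \<Longrightarrow> \<pi> a \<in> Hom T X (Y a)"
    "(\<Sum>a<(n::nat). Cmp T X (Y a) X (\<iota> a) (\<pi> a)) = Idn T X"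
proof -
  obtain Xs where Xs: "is_direct_sum T Xs X" "set Xs \<subseteq> ind"
    using additive_closure_indecs[OF G_Obj krull_schmidt assms] by blast
  show thesis
    by (rule is_direct_sumE[OF Xs(1)], rule that[of "length Xs" "\<lambda>a. Xs ! a"]) (use Xs(2) in auto)
qed

text \<open>A nonzero morphism between indecomposables is epic within \<open>proj\<close>.\<close>

lemma ind_cancel:
  assumes R: "R \<in> ind" and Q: "Q \<in> ind" and B: "B \<in> proj" and b: "b \<in> Hom T R Q" "b \<noteq> 0"
    and c: "c \<in> Hom T Q B" "Cmp T R Q B c b = 0"
  shows "c = 0"
proof -
  obtain n \<iota> \<pi> Y where Y: "\<And>a. a < n \<Longrightarrow> Y a \<in> ind"
    and h: "\<And>a. a < n \<Longrightarrow> \<iota> a \<in> Hom T (Y a) B" "\<And>a. a < n \<Longrightarrow> \<pi> a \<in> Hom T B (Y a)"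
    and s: "(\<Sum>a<(n::nat). Cmp T B (Y a) B (\<iota> a) (\<pi> a)) = Idn T B"
    by (rule proj_indE[OF B]) blast
  have z: "Cmp T Q B (Y a) (\<pi> a) c = 0" if a: "a < n" for a
  proof (rule ccontr)
    assume "Cmp T Q B (Y a) (\<pi> a) c \<noteq> 0"
    then have "Cmp T R Q (Y a) (Cmp T Q B (Y a) (\<pi> a) c) b \<noteq> 0"
      using Cmp_nonzero[OF R Q Y[OF a] b] c(1) Q B Y[OF a] h a by simp
    moreover have "Cmp T R Q (Y a) (Cmp T Q B (Y a) (\<pi> a) c) b = Cmp T R B (Y a) (\<pi> a) (Cmp T R Q B c b)"
      using R Q B Y[OF a] b c(1) h a by (simp add: Cmp_assoc)
    ultimately show False
      unfolding c(2) using R B Y[OF a] h a by simp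
  qed
  have "c = Cmp T Q B B (\<Sum>a<n. Cmp T B (Y a) B (\<iota> a) (\<pi> a)) c"
    unfolding s using Q B c by (simp add: Cmp_Idn_left)
  also have "\<dots> = (\<Sum>a<n. Cmp T Q B B (Cmp T B (Y a) B (\<iota> a) (\<pi> a)) c)"
    by (rule Cmp_sum_left) (use Q B c Y h in auto)
  also have "\<dots> = (\<Sum>a<n. Cmp T Q (Y a) B (\<iota> a) (Cmp T Q B (Y a) (\<pi> a) c))"
    using Q B c Y h by (intro sum.cong refl) (simp add: Cmp_assoc)
  also have "\<dots> = 0"
    using Q B Y h by (intro sum.neutral) (simp add: z)
  finally show ?thesis .
qed

lemma rel_mono_projI:
  assumes o: "X \<in> Obj T" "Y \<in> Obj T" and m: "m \<in> Hom T X Y"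
    and inj: "\<And>R \<phi>. \<lbrakk>R \<in> ind; \<phi> \<in> Hom T R X; Cmp T R X Y m \<phi> = 0\<rbrakk> \<Longrightarrow> \<phi> = 0"
  shows "rel_mono T proj X Y m"
  unfolding rel_mono_def
proof (intro conjI ballI impI)
  fix R \<phi> assume R: "R \<in> proj" "\<phi> \<in> Hom T R X" and z: "Cmp T R X Y m \<phi> = 0"
  obtain n \<iota> \<pi> V where V: "\<And>a. a < n \<Longrightarrow> V a \<in> ind"
    and h: "\<And>a. a < n \<Longrightarrow> \<iota> a \<in> Hom T (V a) R" "\<And>a. a < n \<Longrightarrow> \<pi> a \<in> Hom T R (V a)"
    and s: "(\<Sum>a<(n::nat). Cmp T R (V a) R (\<iota> a) (\<pi> a)) = Idn T R"
    by (rule proj_indE[OF R(1)]) blast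
  have 0: "Cmp T (V a) R X \<phi> (\<iota> a) = 0" if a: "a < n" for a
  proof (rule inj[OF V[OF a]])
    show "Cmp T (V a) R X \<phi> (\<iota> a) \<in> Hom T (V a) X"
      using V[OF a] h a R o by simp
    have "Cmp T (V a) X Y m (Cmp T (V a) R X \<phi> (\<iota> a)) = Cmp T (V a) R Y (Cmp T R X Y m \<phi>) (\<iota> a)"
      using V[OF a] h a R o m by (simp add: Cmp_assoc)
    then show "Cmp T (V a) X Y m (Cmp T (V a) R X \<phi> (\<iota> a)) = 0"
      unfolding z using V[OF a] h a R o by simp
  qed
  have "\<phi> = Cmp T R R X \<phi> (\<Sum>a<n. Cmp T R (V a) R (\<iota> a) (\<pi> a))"
    unfolding s using R o by (simp add: Cmp_Idn_right)
  also have "\<dots> = (\<Sum>a<n. Cmp T R R X \<phi> (Cmp T R (V a) R (\<iota> a) (\<pi> a)))"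
    by (rule Cmp_sum_right) (use R o V h in auto)
  also have "\<dots> = (\<Sum>a<n. Cmp T R (V a) X (Cmp T (V a) R X \<phi> (\<iota> a)) (\<pi> a))"
    using R o V h by (intro sum.cong refl) (simp add: Cmp_assoc)
  also have "\<dots> = 0"
    using R o V h by (intro sum.neutral) (simp add: 0)
  finally show "\<phi> = 0" .
qed (rule m)

subsection \<open>The class \<open>proj\<close> is semihereditary\<close>

text \<open>
  Gaussian elimination on the columns \<open>c a : X a \<rightarrow> B\<close> of a morphism. The columns are taken in
  increasing order; the largest one, \<open>c t\<close>, is kept only if it does not factor through the image \<open>m\<close>
  of the others. If it is kept, the enlarged morphism \<open>(m, c t)\<close> is still injective on
  indecomposables: in a relation \<open>m y + c t b = 0\<close> with \<open>b : R \<rightarrow> X t\<close> nonzero, the morphism \<open>y\<close>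
  factors as \<open>y' b\<close> because the components of its target lie below \<open>X t\<close>, and cancelling \<open>b\<close> yields
  \<open>c t = - m y'\<close>. The last conjunct states this factorisation for every \<open>Q\<close> above the family.
\<close>

lemma image_of_family:
  assumes "finite F" "\<And>a. a \<in> F \<Longrightarrow> X a \<in> ind" "\<And>a. a \<in> F \<Longrightarrow> c a \<in> Hom T (X a) B" and B: "B \<in> proj"
  shows "\<exists>I\<in>proj. \<exists>m\<in>Hom T I B. \<exists>e s.
    (\<forall>a\<in>F. e a \<in> Hom T (X a) I \<and> c a = Cmp T (X a) I B m (e a)) \<and>
    (\<forall>a\<in>F. s a \<in> Hom T I (X a)) \<and> m = (\<Sum>a\<in>F. Cmp T I (X a) B (c a) (s a)) \<and>
    (\<forall>R\<in>ind. \<forall>\<phi>\<in>Hom T R I. Cmp T R I B m \<phi> = 0 \<longrightarrow> \<phi> = 0) \<and>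
    (\<forall>Q\<in>ind. \<forall>R\<in>ind. \<forall>b\<in>Hom T R Q. \<forall>y\<in>Hom T R I. (\<forall>a\<in>F. le (X a) Q) \<longrightarrow> b \<noteq> 0 \<longrightarrow>
      (\<exists>y'\<in>Hom T Q I. y = Cmp T R Q I y' b))"
  using assms(1-3)
proof (induction "card F" arbitrary: F)
  case 0
  then have F: "F = {}" by simp
  obtain N where N: "is_zero T N" by (rule zero_objE)
  then have No: "N \<in> Obj T" "\<And>R. R \<in> Obj T \<Longrightarrow> Hom T R N = {0}"
    unfolding is_zero_def by blast+
  have "N \<in> proj"
    using additive_closure_direct_sum[of "[]" G N] N is_direct_sum_Nil by simp
  then show ?case
    unfolding F using No B by (intro bexI[of _ N] bexI[of _ 0]) auto
next
  case (Suc n)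
  then have "F \<noteq> {}" by auto
  then obtain t where t: "t \<in> F" and top: "\<And>b. b \<in> F \<Longrightarrow> le (X b) (X t)"
    using greatest_index[of F X] Suc.prems by blast
  let ?F = "F - {t}"
  have F: "F = insert t ?F" "finite ?F" "t \<notin> ?F" "n = card ?F"
    using t Suc.prems(1) Suc.hyps(2) by auto
  have tX: "X t \<in> ind" and tc: "c t \<in> Hom T (X t) B"
    using Suc.prems t by auto
  have Xi: "\<And>a. a \<in> ?F \<Longrightarrow> X a \<in> ind" and ch: "\<And>a. a \<in> ?F \<Longrightarrow> c a \<in> Hom T (X a) B"
    using Suc.prems by auto
  obtain I m e s where I: "I \<in> proj" and m: "m \<in> Hom T I B"
    and e0: "\<forall>a\<in>?F. e a \<in> Hom T (X a) I \<and> c a = Cmp T (X a) I B m (e a)"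
    and s0: "\<forall>a\<in>?F. s a \<in> Hom T I (X a)" and ms: "m = (\<Sum>a\<in>?F. Cmp T I (X a) B (c a) (s a))"
    and inj0: "\<forall>R\<in>ind. \<forall>\<phi>\<in>Hom T R I. Cmp T R I B m \<phi> = 0 \<longrightarrow> \<phi> = 0"
    and fac0: "\<forall>Q\<in>ind. \<forall>R\<in>ind. \<forall>b\<in>Hom T R Q. \<forall>y\<in>Hom T R I. (\<forall>a\<in>?F. le (X a) Q) \<longrightarrow> b \<noteq> 0 \<longrightarrow>
      (\<exists>y'\<in>Hom T Q I. y = Cmp T R Q I y' b)"
    by (rule bexE[OF Suc.hyps(1)[OF F(4,2) Xi ch]], assumption, assumption, elim bexE exE conjE)
      (rule that; assumption)
  have e: "\<And>a. a \<in> ?F \<Longrightarrow> e a \<in> Hom T (X a) I" "\<And>a. a \<in> ?F \<Longrightarrow> c a = Cmp T (X a) I B m (e a)"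
    and s: "\<And>a. a \<in> ?F \<Longrightarrow> s a \<in> Hom T I (X a)"
    and inj: "\<And>R \<phi>. \<lbrakk>R \<in> ind; \<phi> \<in> Hom T R I; Cmp T R I B m \<phi> = 0\<rbrakk> \<Longrightarrow> \<phi> = 0"
    and fac: "\<And>Q R b y. \<lbrakk>Q \<in> ind; R \<in> ind; b \<in> Hom T R Q; y \<in> Hom T R I; \<And>a. a \<in> ?F \<Longrightarrow> le (X a) Q; b \<noteq> 0\<rbrakk>
      \<Longrightarrow> \<exists>y'\<in>Hom T Q I. y = Cmp T R Q I y' b"
    using e0 s0 inj0 fac0 by simp_all
  show ?case
  proof (cases "\<exists>e0\<in>Hom T (X t) I. c t = Cmp T (X t) I B m e0")
    case True
    then obtain e1 where e1: "e1 \<in> Hom T (X t) I" "c t = Cmp T (X t) I B m e1" by blast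
    have "m = (\<Sum>a\<in>F. Cmp T I (X a) B (c a) ((s(t := 0)) a))"
    proof -
      have "(\<Sum>a\<in>F. Cmp T I (X a) B (c a) ((s(t := 0)) a)) =
          Cmp T I (X t) B (c t) 0 + (\<Sum>a\<in>?F. Cmp T I (X a) B (c a) ((s(t := 0)) a))"
        using sum.insert[OF F(2,3)] F(1) by (metis (no_types, lifting) fun_upd_same)
      also have "\<dots> = m"
        unfolding ms using I tX B tc by (auto intro: sum.cong)
      finally show ?thesis by simp
    qed
    moreover have "\<forall>a\<in>F. (s(t := 0)) a \<in> Hom T I (X a)"
      using s I tX by auto
    moreover have "\<forall>a\<in>F. (e(t := e1)) a \<in> Hom T (X a) I \<and> c a = Cmp T (X a) I B m ((e(t := e1)) a)"
      using e e1 by auto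
    moreover have "\<forall>Q\<in>ind. \<forall>R\<in>ind. \<forall>b\<in>Hom T R Q. \<forall>y\<in>Hom T R I. (\<forall>a\<in>F. le (X a) Q) \<longrightarrow> b \<noteq> 0 \<longrightarrow>
        (\<exists>y'\<in>Hom T Q I. y = Cmp T R Q I y' b)"
      using fac by blast
    ultimately show ?thesis
      using I m inj by blast
  next
    case new: False
    obtain D where D: "is_direct_sum T [I, X t] D"
      using direct_sums I tX unfolding has_direct_sums_def by (metis empty_set empty_subsetI insert_subset list.simps(15) ind_proj proj_Obj)
    have Dp: "D \<in> proj"
      using additive_closure_direct_sum[OF _ D] I tX by simp
    obtain p q where pq: "p \<in> Hom T D I" "q \<in> Hom T D (X t)"
      and pair: "\<And>R \<theta> \<chi>. \<lbrakk>R \<in> Obj T; \<theta> \<in> Hom T R I; \<chi> \<in> Hom T R (X t)\<rbrakk>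
        \<Longrightarrow> \<exists>\<omega> \<in> Hom T R D. Cmp T R D I p \<omega> = \<theta> \<and> Cmp T R D (X t) q \<omega> = \<chi>"
      and joint: "\<And>R \<omega>. \<lbrakk>R \<in> Obj T; \<omega> \<in> Hom T R D; Cmp T R D I p \<omega> = 0; Cmp T R D (X t) q \<omega> = 0\<rbrakk> \<Longrightarrow> \<omega> = 0"
      by (rule is_direct_sum_productE[OF D]) blast
    let ?m = "Cmp T D I B m p + Cmp T D (X t) B (c t) q"
    have mh: "?m \<in> Hom T D B"
      using Dp I B tX pq m tc by simp
    have mw: "Cmp T R D B ?m \<omega> = Cmp T R I B m (Cmp T R D I p \<omega>) + Cmp T R (X t) B (c t) (Cmp T R D (X t) q \<omega>)"
      if "R \<in> Obj T" "\<omega> \<in> Hom T R D" for R \<omega>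
      using that Dp I B tX pq m tc by (simp add: Cmp_add_left Cmp_assoc)
    have "\<exists>\<omega>\<in>Hom T (X a) D. c a = Cmp T (X a) D B ?m \<omega>" if a: "a \<in> F" for a
    proof (cases "a = t")
      case True
      have "0 \<in> Hom T (X t) I" "Idn T (X t) \<in> Hom T (X t) (X t)" "X t \<in> Obj T"
        using I tX by simp_all
      then obtain \<omega> where om: "\<omega> \<in> Hom T (X t) D" "Cmp T (X t) D I p \<omega> = 0" "Cmp T (X t) D (X t) q \<omega> = Idn T (X t)"
        using pair by blast
      have "Cmp T (X t) D B ?m \<omega> = c t"
        using mw[OF _ om(1)] om(2,3) tX I B m tc by (simp add: Cmp_Idn_right)
      then show ?thesis unfolding True by (intro bexI[OF _ om(1)]) simp
    next
      case False
      then have aF: "a \<in> ?F" using a by simp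
      have o: "X a \<in> Obj T" "0 \<in> Hom T (X a) (X t)" using Xi[OF aF] tX by simp_all
      obtain \<omega> where om: "\<omega> \<in> Hom T (X a) D" "Cmp T (X a) D I p \<omega> = e a" "Cmp T (X a) D (X t) q \<omega> = 0"
        using pair[OF o(1) e(1)[OF aF] o(2)] by blast
      have "Cmp T (X a) D B ?m \<omega> = c a"
        using mw[OF o(1) om(1)] om(2,3) o tX B tc e(2)[OF aF] by simp
      then show ?thesis by (intro bexI[OF _ om(1)]) simp
    qed
    then obtain e' where e': "\<forall>a\<in>F. e' a \<in> Hom T (X a) D \<and> c a = Cmp T (X a) D B ?m (e' a)"
      by metis
    let ?s = "\<lambda>a. if a = t then q else Cmp T D I (X a) (s a) p"
    have s': "\<forall>a\<in>F. ?s a \<in> Hom T D (X a)"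
      using s Xi Dp I pq by auto
    have "Cmp T D I B m p = (\<Sum>a\<in>?F. Cmp T D I B (Cmp T I (X a) B (c a) (s a)) p)"
      by (subst ms, rule Cmp_sum_left) (use s Xi ch Dp I B pq in auto)
    also have "\<dots> = (\<Sum>a\<in>?F. Cmp T D (X a) B (c a) (?s a))"
      using s Xi ch Dp I B pq by (intro sum.cong refl) (auto simp: Cmp_assoc)
    finally have ms': "?m = (\<Sum>a\<in>F. Cmp T D (X a) B (c a) (?s a))"
      using sum.remove[OF Suc.prems(1) t, of "\<lambda>a. Cmp T D (X a) B (c a) (?s a)"] by (simp add: add.commute)
    have inj': "\<phi> = 0" if R: "R \<in> ind" and p: "\<phi> \<in> Hom T R D" and z: "Cmp T R D B ?m \<phi> = 0" for R \<phi>
    proof -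
      let ?y = "Cmp T R D I p \<phi>" and ?b = "Cmp T R D (X t) q \<phi>"
      have yh: "?y \<in> Hom T R I" and bh: "?b \<in> Hom T R (X t)"
        using R p Dp I tX pq by simp_all
      have z': "Cmp T R I B m ?y + Cmp T R (X t) B (c t) ?b = 0"
        using mw[OF _ p] R z by simp
      have b0: "?b = 0"
      proof (rule ccontr)
        assume b: "?b \<noteq> 0"
        obtain y' where y': "y' \<in> Hom T (X t) I" "?y = Cmp T R (X t) I y' ?b"
          using fac[OF tX R bh yh _ b] top by blast
        have "Cmp T R (X t) B (Cmp T (X t) I B m y' + c t) ?b = Cmp T R I B m (Cmp T R (X t) I y' ?b) + Cmp T R (X t) B (c t) ?b"
          using R bh tX I B m tc y'(1) by (simp add: Cmp_add_left Cmp_assoc)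
        also have "\<dots> = 0"
          using z' unfolding y'(2)[symmetric] .
        finally have "Cmp T (X t) I B m y' + c t = 0"
          using ind_cancel[OF R tX B bh b] tX I B m tc y'(1) by simp
        then have "c t = Cmp T (X t) I B m (- y')"
          using tX I B m y'(1) by (simp add: Cmp_minus_right add_eq_0_iff)
        moreover have "- y' \<in> Hom T (X t) I"
          using tX I y'(1) by simp
        ultimately show False
          using new by blast
      qed
      have "?y = 0"
        using inj[OF R yh] z' R tX B tc unfolding b0 by simp
      then show ?thesis
        using joint[OF _ p] b0 R by simp
    qed
    have fac': "\<exists>y'\<in>Hom T Q D. y = Cmp T R Q D y' b"
      if Q: "Q \<in> ind" and R: "R \<in> ind" and b: "b \<in> Hom T R Q" and y: "y \<in> Hom T R D"
        and up: "\<forall>a\<in>F. le (X a) Q" and b0: "b \<noteq> 0" for Q R b y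
    proof -
      have "Cmp T R D I p y \<in> Hom T R I" "Cmp T R D (X t) q y \<in> Hom T R (X t)"
        using R y Dp I tX pq by simp_all
      then obtain y1 y2 where y1: "y1 \<in> Hom T Q I" "Cmp T R D I p y = Cmp T R Q I y1 b"
        and y2: "y2 \<in> Hom T Q (X t)" "Cmp T R D (X t) q y = Cmp T R Q (X t) y2 b"
        using fac[OF Q R b _ _ b0] factor[OF R Q tX _ b b0] up t by blast
      obtain y' where y': "y' \<in> Hom T Q D" "Cmp T Q D I p y' = y1" "Cmp T Q D (X t) q y' = y2"
        using pair[OF _ y1(1) y2(1)] Q by auto
      have d: "y - Cmp T R Q D y' b \<in> Hom T R D"
        using Q R b y y'(1) Dp by simp
      have "Cmp T R D I p (y - Cmp T R Q D y' b) = Cmp T R D I p y - Cmp T R Q I (Cmp T Q D I p y') b"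
        using Q R b y y'(1) Dp I pq by (simp add: Cmp_diff_right Cmp_assoc)
      then have 1: "Cmp T R D I p (y - Cmp T R Q D y' b) = 0"
        unfolding y'(2) y1(2) by simp
      have "Cmp T R D (X t) q (y - Cmp T R Q D y' b) = Cmp T R D (X t) q y - Cmp T R Q (X t) (Cmp T Q D (X t) q y') b"
        using Q R b y y'(1) Dp tX pq by (simp add: Cmp_diff_right Cmp_assoc)
      then have 2: "Cmp T R D (X t) q (y - Cmp T R Q D y' b) = 0"
        unfolding y'(3) y2(2) by simp
      have "y - Cmp T R Q D y' b = 0"
        using joint[OF _ d 1 2] R by simp
      then show ?thesis
        using y'(1) by auto
    qed
    show ?thesis
      by (rule bexI[OF _ Dp], rule bexI[OF _ mh], rule exI[of _ e'], rule exI[of _ ?s])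
        (intro conjI ballI impI e' s' ms'; use e' s' inj' fac' in blast)
  qed
qed

end

context linearly_generated
begin

lemma image_of_morphism:
  assumes A: "A \<in> proj" and B: "B \<in> proj" and f: "f \<in> Hom T A B"
  shows "\<exists>I\<in>proj. \<exists>m e s. rel_mono T proj I B m \<and>
    e \<in> Hom T A I \<and> s \<in> Hom T I A \<and> f = Cmp T A I B m e \<and> m = Cmp T I A B f s"
proof -
  obtain n \<iota> \<pi> X where X: "\<And>a. a < n \<Longrightarrow> X a \<in> ind"
    and h: "\<And>a. a < n \<Longrightarrow> \<iota> a \<in> Hom T (X a) A" "\<And>a. a < n \<Longrightarrow> \<pi> a \<in> Hom T A (X a)"
    and sum1: "(\<Sum>a<(n::nat). Cmp T A (X a) A (\<iota> a) (\<pi> a)) = Idn T A"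
    by (rule proj_indE[OF A]) blast
  let ?c = "\<lambda>a. Cmp T (X a) A B f (\<iota> a)"
  have X': "\<And>a. a \<in> {..<n} \<Longrightarrow> X a \<in> ind" and c: "\<And>a. a \<in> {..<n} \<Longrightarrow> ?c a \<in> Hom T (X a) B"
    using X h A B f by simp_all
  obtain I m e s where I: "I \<in> proj" and m: "m \<in> Hom T I B"
    and e0: "\<forall>a\<in>{..<n}. e a \<in> Hom T (X a) I \<and> ?c a = Cmp T (X a) I B m (e a)"
    and s0: "\<forall>a\<in>{..<n}. s a \<in> Hom T I (X a)" and ms: "m = (\<Sum>a<n. Cmp T I (X a) B (?c a) (s a))"
    and inj: "\<forall>R\<in>ind. \<forall>\<phi>\<in>Hom T R I. Cmp T R I B m \<phi> = 0 \<longrightarrow> \<phi> = 0"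
    by (rule bexE[OF image_of_family[OF finite_lessThan X' c B]], assumption, assumption, elim bexE exE conjE)
      (rule that; assumption)
  have e: "\<And>a. a < n \<Longrightarrow> e a \<in> Hom T (X a) I" "\<And>a. a < n \<Longrightarrow> ?c a = Cmp T (X a) I B m (e a)"
    and s: "\<And>a. a < n \<Longrightarrow> s a \<in> Hom T I (X a)"
    using e0 s0 by simp_all
  let ?e = "\<Sum>a<n. Cmp T A (X a) I (e a) (\<pi> a)" and ?s = "\<Sum>a<n. Cmp T I (X a) A (\<iota> a) (s a)"
  have eh: "?e \<in> Hom T A I" and sh: "?s \<in> Hom T I A"
    using A I X h e s by (auto intro!: Hom_sum)
  have "Cmp T A I B m ?e = (\<Sum>a<n. Cmp T A I B m (Cmp T A (X a) I (e a) (\<pi> a)))"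
    by (rule Cmp_sum_right) (use A B I m X h e in auto)
  also have "\<dots> = (\<Sum>a<n. Cmp T A (X a) B (Cmp T (X a) I B m (e a)) (\<pi> a))"
    using A B I m X h e(1) by (intro sum.cong refl) (simp add: Cmp_assoc)
  also have "\<dots> = (\<Sum>a<n. Cmp T A A B f (Cmp T A (X a) A (\<iota> a) (\<pi> a)))"
    using A B f X h by (intro sum.cong refl) (simp add: Cmp_assoc flip: e(2))
  also have "\<dots> = Cmp T A A B f (\<Sum>a<n. Cmp T A (X a) A (\<iota> a) (\<pi> a))"
    by (rule Cmp_sum_right[symmetric]) (use A B f X h in auto)
  also have "\<dots> = f"
    unfolding sum1 using A B f by (simp add: Cmp_Idn_right)
  finally have fe: "f = Cmp T A I B m ?e" ..
  have "m = (\<Sum>a<n. Cmp T I A B f (Cmp T I (X a) A (\<iota> a) (s a)))"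
    unfolding ms using A B I f X h s by (intro sum.cong refl) (simp add: Cmp_assoc)
  also have "\<dots> = Cmp T I A B f ?s"
    by (rule Cmp_sum_right[symmetric]) (use A B I f X h s in auto)
  finally have fs: "m = Cmp T I A B f ?s" .
  have "rel_mono T proj I B m"
    using I B m inj by (intro rel_mono_projI) auto
  then show ?thesis
    using I eh sh fe fs by blast
qed

sublocale semihereditary_class scale T "additive_closure T G"
proof
  show "\<exists>D\<in>proj. is_direct_sum T [A, B] D" if AB: "A \<in> proj" "B \<in> proj" for A B
  proof -
    have "set [A, B] \<subseteq> Obj T" using AB by simp
    then obtain D where D: "is_direct_sum T [A, B] D"
      using direct_sums unfolding has_direct_sums_def by blast
    then have "D \<in> proj"
      using additive_closure_direct_sum[OF _ D] AB by simp
    then show ?thesis using D by blast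
  qed
qed (fact proj_Obj additive_closure_retract[OF G_Obj] additive_closure_Sh image_of_morphism)+

lemma level_2_eq: "level T G 2 = Obj T"
proof -
  have level: "level T G 2 = {M. \<exists>A B f g h. (A, M, B, f, g, h) \<in> Tri T \<and> A \<in> proj \<and> B \<in> proj}"
    by (simp add: numeral_2_eq_2)
  have "classical_generator scale T G"
    using linear_generator unfolding linear_generator_def by (elim conjE)
  then show ?thesis
    unfolding level using presentation[OF _ mem_additive_closure] Tri_closed by blast
qed

text \<open>
  Let \<open>Q \<le> P\<close> be nonisomorphic indecomposables. If every object lies in \<open>proj\<close>, then a nonzero
  \<open>u : P \<rightarrow> Q\<close> is a monomorphism, so its triangle splits and \<open>1 = s g + u r\<close> on \<open>Q\<close> with
  \<open>r : Q \<rightarrow> P\<close>. But \<open>r = 0\<close>, so that \<open>u = s g u = 0\<close>.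
\<close>

lemma level_1_neq:
  assumes PQ: "P \<in> ind" "Q \<in> ind" "\<not> isomorphic T P Q"
  shows "level T G 1 \<noteq> Obj T"
proof
  assume eq: "level T G 1 = Obj T"
  have all: "X \<in> proj" if "X \<in> Obj T" for X
    using that unfolding eq[symmetric] One_nat_def level.simps .
  have no: False if P: "P \<in> ind" and Q: "Q \<in> ind" and le: "le Q P" and ni: "\<not> isomorphic T Q P" for P Q
  proof -
    have o: "P \<in> Obj T" "Q \<in> Obj T" using P Q by simp_all
    obtain u where u: "u \<in> Hom T P Q" "u \<noteq> 0"
      using le o by (auto simp: hom_le_iff)
    have mono: "rel_mono T proj P Q u"
      using Cmp_nonzero[OF _ P Q _ _ u] by (intro rel_mono_projI o u) blast
    obtain Z g h where t: "(P, Q, Z, u, g, h) \<in> Tri T"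
      using Tri_ex[OF o u(1)] by blast
    note c = Tri_closed[OF t]
    have "h = 0"
      using rel_mono_Sh[OF mono o] all[of Z] c tri_comp_0(3)[OF t] unfolding rel_mono_def by blast
    then obtain s where s: "s \<in> Hom T Z Q" "Idn T Z = Cmp T Z Q Z g s"
      using tri_exact(2)[OF t, of Z "Idn T Z"] c by auto
    let ?d = "Idn T Q - Cmp T Q Z Q s g"
    have d: "?d \<in> Hom T Q Q" using c s(1) by simp
    have "Cmp T Q Q Z g ?d = g - Cmp T Q Z Z (Cmp T Z Q Z g s) g"
      using c s(1) by (simp add: Cmp_diff_right Cmp_Idn_right Cmp_assoc)
    also have "\<dots> = 0"
      unfolding s(2)[symmetric] using c by (simp add: Cmp_Idn_left)
    finally obtain r where r: "r \<in> Hom T Q P" "?d = Cmp T Q P Q u r"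
      using tri_exact(1)[OF t o(2) d] by blast
    have "r = 0"
      using Hom_eq_0[OF P Q le ni] r(1) by blast
    then have id: "Idn T Q = Cmp T Q Z Q s g"
      using r(2) c by simp
    have "u = Cmp T P Q Q (Cmp T Q Z Q s g) u"
      unfolding id[symmetric] using c by (simp add: Cmp_Idn_left)
    also have "\<dots> = Cmp T P Z Q s (Cmp T P Q Z g u)"
      using c s(1) by (simp add: Cmp_assoc)
    also have "\<dots> = 0"
      unfolding tri_comp_0(1)[OF t] using c s(1) by simp
    finally show False
      using u(2) by simp
  qed
  show False
    using no[OF PQ(1,2)] no[OF PQ(2,1)] le_total[OF PQ(1,2)] PQ(3) isomorphic_sym by blast
qed

end

section \<open>Generation time\<close>

theorem theorem2p16:
  fixes scale :: "'k::alg_closed_field \<Rightarrow> 'm::ab_group_add \<Rightarrow> 'm"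
    and T :: "('o, 'm) tricat"
    and G :: 'o
  assumes "triangulated_category scale T"
    and "hom_finite scale T"
    and "krull_schmidt T"
    and "linear_generator scale T G"
  shows "triangulated_category scale (full_sub T (level T G 2)) \<and>
    linear_equivalence scale (full_sub T (level T G 2)) scale T (\<lambda>X. X) (\<lambda>X Y f. f) \<and>
    (\<exists>t\<le>1. has_generation_time T G t) \<and>
    ((\<exists>P \<in> indecs T G. \<exists>Q \<in> indecs T G. \<not> isomorphic T P Q) \<longrightarrow> has_generation_time T G 1)"
proof -
  interpret linearly_generated scale T G
    by (intro linearly_generated.intro linearly_generated_axioms.intro assms)
  have Tri: "{(X, Y, Z, f, g, h) \<in> Tri T. X \<in> Obj T \<and> Y \<in> Obj T \<and> Z \<in> Obj T} = Tri T"
    using Tri_closed by blast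
  have T: "full_sub T (level T G 2) = T"
    unfolding level_2_eq full_sub_def Tri by simp
  have "linear_equivalence scale T scale T (\<lambda>X. X) (\<lambda>X Y f. f)"
    unfolding linear_equivalence_def linear_functor_def
    using isomorphic_refl by (auto simp: bij_betw_def)
  moreover have 1: "has_generation_time T G 1" if "level T G 1 \<noteq> Obj T"
    unfolding has_generation_time_def
  proof (intro conjI allI impI)
    show "level T G (1 + 1) = Obj T"
      using level_2_eq by (simp only: one_add_one)
    fix n :: nat assume "1 \<le> n \<and> n < 1 + 1"
    then have "n = 1" by linarith
    then show "level T G n \<noteq> Obj T"
      using that by (simp only: not_False_eq_True)
  qed
  moreover have "\<exists>t\<le>1. has_generation_time T G t"
  proof (cases "level T G 1 = Obj T")
    case True
    then have "level T G (0 + 1) = Obj T" by (simp only: add_0)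
    moreover have "\<not> (1 \<le> n \<and> n < 0 + 1)" for n :: nat by linarith
    ultimately have "has_generation_time T G 0"
      unfolding has_generation_time_def by blast
    then show ?thesis by blast
  next
    case False
    then show ?thesis using 1 by blast
  qed
  ultimately show ?thesis
    unfolding T using assms(1) level_1_neq by blast
qed

end
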